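(* Let $q_1,q_2\in\partial_\infty\mathbb{H}^2$ be two distinct asymptotic points and let $\gamma\subset\mathbb{H}^2$ be the complete geodesic with asymptotic boundary $\{q_1,q_2\}$. Let $c_1$ (resp. $c_2$) be the closed arc in $\partial_\infty\mathbb{H}^2$ joining $q_1$ to $q_2$ (resp. $q_2$ to $q_1$) with respect to the counterclockwise orientation. There exists a one-parameter family $M_d$, $d>0$, of complete properly embedded minimal surfaces in $\mathbb{H}^2\times\mathbb{R}$, invariant by the hyperbolic translations along $\gamma$, with the following geometric behaviour. (1) If $d>1$, then $M_d$ contains the equidistant line $\gamma_d$ of $\gamma$ in $\mathbb{H}^2\times\{0\}$ staying at distance $\cosh^{-1}(d)$ from $\gamma$ in the connected component of $\mathbb{H}^2\setminus\gamma$ whose asymptotic boundary is $c_1$. Furthermore $M_d$ is symmetric with respect to the slice $\mathbb{H}^2\times\{0\}$ and $$\partial_\infty M_d=(c_1\times\{-H(d)\})\cup(c_1\times\{H(d)\})\cup(\{q_2\}\times[-H(d),H(d)])\cup(\{q_1\}\times[-H(d),H(d)]),$$ where $$H(d):=\int_{\cosh^{-1}(d)}^{+\infty}\frac{d}{\sqrt{\cosh^2u-d^2}}\,du,\qquad d>1.$$ Therefore $\partial_\infty M_d$ is a Jordan curve homologous to zero in $\partial_\infty\mathbb{H}^2\times\mathbb{R}$. Furthermore, $M_d\cap(\mathbb{H}^2\times[0,H(d)])$ is a vertical graph over the component of $\mathbb{H}^2\setminus\gamma_d$ whose asymptotic boundary is $c_1$. Finally, $H$ is a nonincreasing function satisfying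 $$\lim_{d\to1}H(d)=+\infty,\qquad\lim_{d\to+\infty}H(d)=\frac{\pi}{2}.$$ (2) If $d=1$, then $M_1$ is congruent to the minimal graph given, in the half-plane model $\{(x,y): y>0\}$ of $\mathbb{H}^2$, by $$t=\ln\left(\frac{\sqrt{x^2+y^2}+y}{x}\right),\qquad y>0,\ x>0,$$ and its asymptotic boundary is $$\partial_\infty M_1=(\{q_1\}\times(-\infty,0])\cup c_1\cup(\{q_2\}\times(-\infty,0]).$$ (3) If $0<d<1$, then $M_d$ is an entire vertical graph over $\mathbb{H}^2$ and contains the geodesic $\gamma\times\{0\}$. The asymptotic boundary of $M_d$ is $$\partial_\infty M_d=(c_2\times\{-G(d)\})\cup(c_1\times\{G(d)\})\cup(\{q_1\}\times[-G(d),G(d)])\cup(\{q_2\}\times[-G(d),G(d)]),$$ where $$G(d):=\int_0^{+\infty}\frac{d}{\sqrt{\cosh^2u-d^2}}\,du,\qquad 0<d<1.$$ Therefore $\partial_\infty M_d$ is a Jordan curve non homologous to zero in $\partial_\infty\mathbb{H}^2\times\mathbb{R}$. Furthermore $G$ is a nondecreasing function and $$\lim_{d\to0}G(d)=0,\qquad\lim_{d\to1}G(d)=+\infty.$$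
   Context: $\mathbb{H}^2$ is the hyperbolic plane (curvature $-1$), $\mathbb{H}^2\times\mathbb{R}$ has the product metric, and $\mathbb{H}^2$ (resp. $\partial_\infty\mathbb{H}^2$) is identified with $\mathbb{H}^2\times\{0\}$ (resp. $\partial_\infty\mathbb{H}^2\times\{0\}$). In the Poincaré disk model, $\overline{\mathbb{H}^2}=\mathbb{H}^2\cup\partial_\infty\mathbb{H}^2$ is the closed unit disk with its Euclidean topology. The asymptotic boundary $\partial_\infty M$ of a surface $M\subset\mathbb{H}^2\times\mathbb{R}$ is the set of points of $\partial_\infty\mathbb{H}^2\times\mathbb{R}$ that are limits, in $\overline{\mathbb{H}^2}\times\mathbb{R}$, of sequences of points of $M$. Hyperbolic translations along $\gamma$ act on $\mathbb{H}^2\times\mathbb{R}$ by acting on the first factor and trivially on $\mathbb{R}$. A (vertical) graph over a set $D\subset\mathbb{H}^2$ is the graph $\{(p,u(p)):p\in D\}$ of a function $u$; it is entire if $D=\mathbb{H}^2$. Congruent means equal up to an isometry of $\mathbb{H}^2\times\mathbb{R}$. $\cosh^{-1}$ is the inverse of $\cosh:[0,\infty)\to[1,\infty)$.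
   Formalization: In (1), M_d ∩ (H²×[0,H(d)]) is stated to be a vertical graph over the component of H²∖γ_d together with its boundary line γ_d; over the open component alone the claim fails, since M_d contains γ_d×{0}. *)

theory Defs
  imports "HOL-Analysis.Analysis" "HOL-Homology.Homology"
begin

section \<open>Smooth maps on open sets\<close>

primrec Ck_on :: "nat \<Rightarrow> 'a set \<Rightarrow> ('a::real_normed_vector \<Rightarrow> 'b::real_normed_vector) \<Rightarrow> bool" where
  "Ck_on 0 U f \<longleftrightarrow> continuous_on U f"
| "Ck_on (Suc k) U f \<longleftrightarrow>
     (\<forall>x\<in>U. f differentiable (at x)) \<and> (\<forall>v. Ck_on k U (\<lambda>x. frechet_derivative f (at x) v))"

definition smooth_on :: "'a set \<Rightarrow> ('a::real_normed_vector \<Rightarrow> 'b::real_normed_vector) \<Rightarrow> bool" where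
  "smooth_on U f \<longleftrightarrow> (\<forall>k. Ck_on k U f)"


section \<open>Riemannian metrics on open subsets of a vector space\<close>

text \<open>A metric \<open>g\<close> assigns to a point \<open>p\<close> the inner product \<open>g p\<close> on the tangent space at \<open>p\<close>,
  which is the whole vector space.\<close>

type_synonym 'a metric_tensor = "'a \<Rightarrow> 'a \<Rightarrow> 'a \<Rightarrow> real"

text \<open>Christoffel symbols of the first kind: for a curve or a parametrized surface, with tangent
  fields \<open>V\<close>, \<open>W\<close>, the Levi-Civita connection satisfies
  \<open>g (\<nabla>\<^sub>V W) u = g (D\<^sub>V W) u + christoffel g p V W u\<close> (Koszul formula with constant
  vector fields).\<close>

definition christoffel :: "('a::real_normed_vector) metric_tensor \<Rightarrow> 'a \<Rightarrow> 'a \<Rightarrow> 'a \<Rightarrow> 'a \<Rightarrow> real" where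
  "christoffel g p v w u =
     (frechet_derivative (\<lambda>q. g q w u) (at p) v
      + frechet_derivative (\<lambda>q. g q v u) (at p) w
      - frechet_derivative (\<lambda>q. g q v w) (at p) u) / 2"

definition unit_speed_geodesic ::
    "'a set \<Rightarrow> ('a::real_normed_vector) metric_tensor \<Rightarrow> (real \<Rightarrow> 'a) \<Rightarrow> bool" where
  "unit_speed_geodesic S g c \<longleftrightarrow>
     smooth_on UNIV c \<and> range c \<subseteq> S \<and>
     (\<forall>s. let c' = (\<lambda>r. vector_derivative c (at r)); c'' = (\<lambda>r. vector_derivative c' (at r)) in
        g (c s) (c' s) (c' s) = 1 \<and>
        (\<forall>u. g (c s) (c'' s) u + christoffel g (c s) (c' s) (c' s) u = 0))"

definition complete_geodesic :: "'a set \<Rightarrow> ('a::real_normed_vector) metric_tensor \<Rightarrow> 'a set \<Rightarrow> bool" where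
  "complete_geodesic S g \<Gamma> \<longleftrightarrow> (\<exists>c. unit_speed_geodesic S g c \<and> range c = \<Gamma>)"

text \<open>The length is a nonnegative integral, so that a path whose speed is not integrable has
  length \<open>\<infinity>\<close> (a \<open>valid_path\<close> may have unbounded speed near its finitely many exceptional points).\<close>

definition curve_length :: "('a::real_normed_vector) metric_tensor \<Rightarrow> (real \<Rightarrow> 'a) \<Rightarrow> ennreal" where
  "curve_length g c =
     (\<integral>\<^sup>+ s\<in>{0..1}. ennreal (sqrt (g (c s) (vector_derivative c (at s)) (vector_derivative c (at s)))) \<partial>lborel)"

text \<open>The infimum of the lengths of paths inside \<open>S\<close>. For an open set \<open>S\<close> this is the Riemannian
  distance of \<open>(S, g)\<close>; for a surface \<open>S\<close> it is the intrinsic distance of the induced metric.\<close>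

definition path_dist :: "('a::real_normed_vector) metric_tensor \<Rightarrow> 'a set \<Rightarrow> 'a \<Rightarrow> 'a \<Rightarrow> ennreal" where
  "path_dist g S p q =
     (INF c\<in>{c. valid_path c \<and> path_image c \<subseteq> S \<and> pathstart c = p \<and> pathfinish c = q}. curve_length g c)"

definition riemannian_isometry ::
    "('a::real_normed_vector) set \<Rightarrow> 'a metric_tensor \<Rightarrow>
     ('b::real_normed_vector) set \<Rightarrow> 'b metric_tensor \<Rightarrow> ('a \<Rightarrow> 'b) \<Rightarrow> bool" where
  "riemannian_isometry S g S' g' F \<longleftrightarrow>
     bij_betw F S S' \<and> smooth_on S F \<and>
     (\<forall>p\<in>S. \<forall>v w. g' (F p) (frechet_derivative F (at p) v) (frechet_derivative F (at p) w) = g p v w)"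


section \<open>Surfaces\<close>

definition local_parametrization ::
    "('a::real_normed_vector) set \<Rightarrow> 'a \<Rightarrow> (real \<times> real) set \<Rightarrow> (real \<times> real \<Rightarrow> 'a) \<Rightarrow> bool" where
  "local_parametrization M p U X \<longleftrightarrow>
     open U \<and> smooth_on U X \<and> (\<forall>x\<in>U. inj (frechet_derivative X (at x))) \<and>
     (\<exists>V Y. open V \<and> p \<in> V \<and> homeomorphism U (M \<inter> V) X Y)"

definition embedded_surface :: "('a::real_normed_vector) set \<Rightarrow> 'a set \<Rightarrow> bool" where
  "embedded_surface S M \<longleftrightarrow>
     M \<noteq> {} \<and> connected M \<and> M \<subseteq> S \<and> (\<forall>p\<in>M. \<exists>U X. local_parametrization M p U X)"

text \<open>The inclusion of \<open>M\<close> into \<open>S\<close> is a proper map.\<close>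

definition properly_embedded_surface :: "('a::real_normed_vector) set \<Rightarrow> 'a set \<Rightarrow> bool" where
  "properly_embedded_surface S M \<longleftrightarrow>
     embedded_surface S M \<and> (\<forall>K. compact K \<and> K \<subseteq> S \<longrightarrow> compact (M \<inter> K))"

definition complete_surface :: "('a::real_normed_vector) metric_tensor \<Rightarrow> 'a set \<Rightarrow> bool" where
  "complete_surface g M \<longleftrightarrow>
     (\<forall>\<sigma>::nat \<Rightarrow> 'a. range \<sigma> \<subseteq> M \<and>
        (\<forall>\<epsilon>>0. \<exists>N. \<forall>m\<ge>N. \<forall>n\<ge>N. path_dist g M (\<sigma> m) (\<sigma> n) < \<epsilon>) \<longrightarrow>
        (\<exists>l\<in>M. (\<lambda>n. path_dist g M (\<sigma> n) l) \<longlonglongrightarrow> 0))"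

text \<open>The component along the normal vector \<open>N\<close> of \<open>\<nabla>\<close> of the field \<open>\<partial>\<^sub>w X\<close> in the
  direction \<open>\<partial>\<^sub>v X\<close>, at the parameter \<open>x\<close>.\<close>

definition second_fundamental_form ::
    "('a::real_normed_vector) metric_tensor \<Rightarrow> (real \<times> real \<Rightarrow> 'a) \<Rightarrow> real \<times> real \<Rightarrow> 'a \<Rightarrow>
     real \<times> real \<Rightarrow> real \<times> real \<Rightarrow> real" where
  "second_fundamental_form g X x N v w =
     g (X x) (frechet_derivative (\<lambda>y. frechet_derivative X (at y) w) (at x) v) N
     + christoffel g (X x) (frechet_derivative X (at x) v) (frechet_derivative X (at x) w) N"

definition mean_curvature ::
    "('a::real_normed_vector) metric_tensor \<Rightarrow> (real \<times> real \<Rightarrow> 'a) \<Rightarrow> real \<times> real \<Rightarrow> 'a \<Rightarrow> real" where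
  "mean_curvature g X x N =
     (let I = (\<lambda>v w. g (X x) (frechet_derivative X (at x) v) (frechet_derivative X (at x) w));
          II = second_fundamental_form g X x N;
          e1 = (1, 0); e2 = (0, 1)
      in (II e1 e1 * I e2 e2 - 2 * II e1 e2 * I e1 e2 + II e2 e2 * I e1 e1)
         / (2 * (I e1 e1 * I e2 e2 - (I e1 e2)\<^sup>2)))"

text \<open>Vanishing of the mean curvature does not depend on the parametrization.\<close>

definition minimal_surface :: "('a::real_normed_vector) set \<Rightarrow> 'a metric_tensor \<Rightarrow> 'a set \<Rightarrow> bool" where
  "minimal_surface S g M \<longleftrightarrow>
     embedded_surface S M \<and>
     (\<forall>p\<in>M. \<exists>U X. local_parametrization M p U X \<and>
        (\<forall>x\<in>U. \<forall>N. g (X x) N N = 1 \<and> (\<forall>v. g (X x) N (frechet_derivative X (at x) v) = 0)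
                \<longrightarrow> mean_curvature g X x N = 0))"


section \<open>The hyperbolic plane and its product with the real line\<close>

definition disk :: "complex set" where
  "disk = ball 0 1"

definition disk_metric :: "complex metric_tensor" where
  "disk_metric z v w = 4 * (v \<bullet> w) / (1 - (norm z)\<^sup>2)\<^sup>2"

definition half_plane :: "complex set" where
  "half_plane = {z. Im z > 0}"

definition half_plane_metric :: "complex metric_tensor" where
  "half_plane_metric z v w = (v \<bullet> w) / (Im z)\<^sup>2"

definition times_R :: "complex metric_tensor \<Rightarrow> (complex \<times> real) metric_tensor" where
  "times_R g p v w = g (fst p) (fst v) (fst w) + snd v * snd w"

abbreviation H2xR :: "(complex \<times> real) set" where
  "H2xR \<equiv> disk \<times> UNIV"

abbreviation H2xR_metric :: "(complex \<times> real) metric_tensor" where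
  "H2xR_metric \<equiv> times_R disk_metric"

definition ideal_boundary :: "complex set \<Rightarrow> complex set" where
  "ideal_boundary A = {q. norm q = 1 \<and> (\<exists>\<sigma>::nat \<Rightarrow> complex. range \<sigma> \<subseteq> A \<and> \<sigma> \<longlonglongrightarrow> q)}"

definition asymptotic_boundary :: "(complex \<times> real) set \<Rightarrow> (complex \<times> real) set" where
  "asymptotic_boundary M =
     {q. norm (fst q) = 1 \<and> (\<exists>\<sigma>::nat \<Rightarrow> complex \<times> real. range \<sigma> \<subseteq> M \<and> \<sigma> \<longlonglongrightarrow> q)}"

text \<open>The closed counterclockwise arc of the unit circle from \<open>p\<close> to \<open>q\<close>.\<close>

definition ccw_arc :: "complex \<Rightarrow> complex \<Rightarrow> complex set" where
  "ccw_arc p q = (\<lambda>\<theta>. p * cis \<theta>) ` {0..Arg2pi (q / p)}"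

definition the_component :: "complex set \<Rightarrow> complex set \<Rightarrow> complex set" where
  "the_component A c = (THE C. C \<in> components (disk - A) \<and> ideal_boundary C = c)"

definition equidistant_line :: "complex set \<Rightarrow> complex set \<Rightarrow> real \<Rightarrow> complex set" where
  "equidistant_line \<Gamma> C r = {p \<in> C. (INF q\<in>\<Gamma>. path_dist disk_metric disk p q) = ennreal r}"

text \<open>In the conformal model, an isometry preserves the orientation iff it is holomorphic.\<close>

definition hyperbolic_translation :: "complex set \<Rightarrow> (complex \<Rightarrow> complex) \<Rightarrow> bool" where
  "hyperbolic_translation \<Gamma> T \<longleftrightarrow>
     riemannian_isometry disk disk_metric disk disk_metric T \<and> T holomorphic_on disk \<and>
     (\<exists>c \<tau>. unit_speed_geodesic disk disk_metric c \<and> range c = \<Gamma> \<and> (\<forall>s. T (c s) = c (s + \<tau>)))"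

definition translation_invariant :: "complex set \<Rightarrow> (complex \<times> real) set \<Rightarrow> bool" where
  "translation_invariant \<Gamma> M \<longleftrightarrow> (\<forall>T. hyperbolic_translation \<Gamma> T \<longrightarrow> (\<lambda>(z, t). (T z, t)) ` M = M)"

definition symmetric_wrt_slice :: "(complex \<times> real) set \<Rightarrow> bool" where
  "symmetric_wrt_slice M \<longleftrightarrow> (\<lambda>(z, t). (z, - t)) ` M = M"

definition vertical_graph_over :: "complex set \<Rightarrow> (complex \<times> real) set \<Rightarrow> bool" where
  "vertical_graph_over D M \<longleftrightarrow> (\<exists>u::complex \<Rightarrow> real. M = (\<lambda>p. (p, u p)) ` D)"


section \<open>Jordan curves and homology\<close>

definition parametrizes_Jordan_curve :: "(real \<Rightarrow> 'a::topological_space) \<Rightarrow> 'a set \<Rightarrow> bool" where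
  "parametrizes_Jordan_curve \<alpha> J \<longleftrightarrow> simple_path \<alpha> \<and> pathfinish \<alpha> = pathstart \<alpha> \<and> path_image \<alpha> = J"

definition Jordan_curve :: "'a::topological_space set \<Rightarrow> bool" where
  "Jordan_curve J \<longleftrightarrow> (\<exists>\<alpha>. parametrizes_Jordan_curve \<alpha> J)"

text \<open>A path as a singular 1-chain; the standard 1-simplex is parametrized by the second
  barycentric coordinate.\<close>

definition path_chain :: "(real \<Rightarrow> 'a) \<Rightarrow> 'a chain" where
  "path_chain \<alpha> = frag_of (restrict (\<lambda>x. \<alpha> (x 1)) (standard_simplex 1))"

definition loop_null_homologous :: "'a topology \<Rightarrow> (real \<Rightarrow> 'a) \<Rightarrow> bool" where
  "loop_null_homologous X \<alpha> \<longleftrightarrow> singular_relboundary 1 X {} (path_chain \<alpha>)"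

text \<open>Simple closed parametrizations of the same Jordan curve are homologous up to sign, so the two
  notions below are complementary.\<close>

definition Jordan_curve_homologous_to_zero ::
    "'a::topological_space topology \<Rightarrow> 'a set \<Rightarrow> bool" where
  "Jordan_curve_homologous_to_zero X J \<longleftrightarrow>
     Jordan_curve J \<and> (\<forall>\<alpha>. parametrizes_Jordan_curve \<alpha> J \<longrightarrow> loop_null_homologous X \<alpha>)"

definition Jordan_curve_not_homologous_to_zero ::
    "'a::topological_space topology \<Rightarrow> 'a set \<Rightarrow> bool" where
  "Jordan_curve_not_homologous_to_zero X J \<longleftrightarrow>
     Jordan_curve J \<and> (\<forall>\<alpha>. parametrizes_Jordan_curve \<alpha> J \<longrightarrow> \<not> loop_null_homologous X \<alpha>)"

definition ideal_cylinder :: "(complex \<times> real) topology" where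
  "ideal_cylinder = top_of_set (sphere 0 1 \<times> UNIV)"


section \<open>The explicit data of the family\<close>

definition H_height :: "real \<Rightarrow> real" where
  "H_height d = integral {arcosh d..} (\<lambda>u. d / sqrt ((cosh u)\<^sup>2 - d\<^sup>2))"

definition G_height :: "real \<Rightarrow> real" where
  "G_height d = integral {0..} (\<lambda>u. d / sqrt ((cosh u)\<^sup>2 - d\<^sup>2))"

definition half_plane_graph :: "(complex \<times> real) set" where
  "half_plane_graph =
     {(Complex x y, ln ((sqrt (x\<^sup>2 + y\<^sup>2) + y) / x)) | x y. y > 0 \<and> x > 0}"

end

theory Submission
  imports Defs "HOL-Complex_Analysis.Complex_Analysis" "HOL-Real_Asymp.Real_Asymp"
begin

text \<open>Write a point of the disk through the half plane coordinate \<open>\<zeta> = k z\<close> that sends \<open>q1\<close> to \<open>0\<close>,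
  \<open>q2\<close> to \<open>\<infinity>\<close> and the interior of the arc \<open>c1\<close> to the positive real axis. The geodesic \<open>\<gamma>\<close>
  becomes the imaginary axis, the translations along \<open>\<gamma>\<close> become the dilations of \<open>\<zeta>\<close>, and
  \<open>f z = Re \<zeta> / Im \<zeta>\<close> is invariant under them: it is the hyperbolic sine of the signed distance
  to \<open>\<gamma>\<close>. An invariant surface is therefore the set of all \<open>(z, t)\<close> for which \<open>(f z, t)\<close> lies on
  a plane curve \<open>(\<phi>, \<tau>)\<close>, the profile.

  A translation moves a point at distance \<open>\<rho>\<close> from \<open>\<gamma>\<close> with speed \<open>cosh \<rho>\<close>. When the profile has
  unit speed, the flux of the vertical Killing field, \<open>cosh \<rho> \<tau>'\<close>, is constant on a minimal
  surface; call it \<open>d\<close>. With \<open>\<phi> = sinh \<rho>\<close> this gives \<open>\<tau>' = d / sqrt (1 + \<phi>\<^sup>2)\<close>, unit speed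
  becomes \<open>\<phi>'\<^sup>2 + d\<^sup>2 = 1 + \<phi>\<^sup>2\<close>, and differentiating yields the linear equation \<open>\<phi>'' = \<phi>\<close>. Its
  solutions are \<open>sqrt (d\<^sup>2 - 1) cosh w\<close> for \<open>d > 1\<close>, \<open>exp w\<close> for \<open>d = 1\<close> and
  \<open>sqrt (1 - d\<^sup>2) sinh w\<close> for \<open>d < 1\<close>. In the parameter \<open>w\<close> the profile is smooth also where the
  integrand \<open>d / sqrt (cosh\<^sup>2 u - d\<^sup>2)\<close> of the height is singular. Conversely, in the parameters
  \<open>(s, w)\<close> with \<open>s\<close> the logarithm of \<open>\<bar>\<zeta>\<bar>\<close> the induced metric is \<open>(1 + \<phi>\<^sup>2) ds\<^sup>2 + dw\<^sup>2\<close>, and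
  the trace of the covariant second derivative is a multiple of the tangent vector \<open>\<partial>\<^sub>w\<close>
  (\<open>mean_curvature_zero\<close>); so the surface is minimal. These parameters form one global chart,
  which shows that the surface is embedded; it is proper because the profile is closed, and
  complete because some functions that do not increase lengths keep a Cauchy sequence inside a
  compact set (\<open>complete_surface_criterion\<close>).

  For the asymptotic boundary, \<open>f\<close> tends to \<open>+\<infinity>\<close> at interior points of \<open>c1\<close> and to \<open>-\<infinity>\<close> at
  interior points of \<open>c2\<close>, while \<open>q1\<close> and \<open>q2\<close> can be approached with any prescribed values of
  \<open>f\<close>. So the points over the open arcs are the limits of \<open>\<tau>\<close> at the ends of the profile, and
  those over \<open>q1\<close>, \<open>q2\<close> are the closure of the range of \<open>\<tau>\<close> (\<open>asymptotic_boundary_profile_set\<close>).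
  The substitution \<open>sinh u = \<phi> w\<close> identifies these limits with \<open>H_height\<close> and \<open>G_height\<close>, and
  comparing \<open>\<tau>\<close> with \<open>arctan (sinh w)\<close>, whose limit is \<open>\<pi> / 2\<close>, gives their behaviour in \<open>d\<close>.

  The curve for \<open>d > 1\<close> lies over an arc of the circle, so in a contractible part of the
  cylinder. For \<open>d < 1\<close> it winds once around the cylinder: a continuous logarithm of the circle
  coordinate would have to grow by \<open>2 \<pi> \<i>\<close> along it, but along a null homologous loop it returns
  to its initial value (\<open>null_homologous_loop_log_closed\<close>).

  What connects this picture to the given geodesic is that geodesics of the disk can be written
  down: their hyperboloid coordinates solve \<open>y'' = y\<close> (\<open>disk_geodesic_hyperboloid\<close>), so \<open>\<gamma>\<close> is
  determined by its two ideal end points. A translation along \<open>\<gamma>\<close> agrees with a dilation of \<open>\<zeta>\<close>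
  on \<open>\<gamma>\<close>, hence everywhere by analytic continuation.\<close>


section \<open>Smooth maps\<close>

lemma differentiable_cong_open:
  assumes "open U" "x \<in> U" "\<And>y. y \<in> U \<Longrightarrow> f y = g y"
  shows "f differentiable (at x) \<longleftrightarrow> g differentiable (at x)"
    and "frechet_derivative f (at x) = frechet_derivative g (at x)"
proof -
  have *: "(f has_derivative D) (at x) \<longleftrightarrow> (g has_derivative D) (at x)" for D
    using assms has_derivative_transform_within_open[of f D x UNIV U g]
      has_derivative_transform_within_open[of g D x UNIV U f] by fastforce
  then show "f differentiable (at x) \<longleftrightarrow> g differentiable (at x)"
    by (simp add: differentiable_def)
  show "frechet_derivative f (at x) = frechet_derivative g (at x)"
    using * by (simp add: frechet_derivative_def)
qed

lemma Ck_on_cong: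
  assumes "open U" "\<And>x. x \<in> U \<Longrightarrow> f x = g x"
  shows "Ck_on k U f \<longleftrightarrow> Ck_on k U g"
  using assms(2)
proof (induction k arbitrary: f g)
  case 0
  then show ?case by (simp cong: continuous_on_cong)
next
  case (Suc k)
  note c = differentiable_cong_open[OF assms(1), of _ f g]
  have "Ck_on k U (\<lambda>x. frechet_derivative f (at x) v) = Ck_on k U (\<lambda>x. frechet_derivative g (at x) v)" for v
    by (rule Suc.IH) (use c Suc.prems in auto)
  then show ?case using c(1) Suc.prems by auto
qed

lemma Ck_on_SucI:
  assumes "open U" "\<And>x. x \<in> U \<Longrightarrow> (f has_derivative D x) (at x)" "\<And>v. Ck_on k U (\<lambda>x. D x v)"
  shows "Ck_on (Suc k) U f"
proof -
  have "Ck_on k U (\<lambda>x. frechet_derivative f (at x) v) = Ck_on k U (\<lambda>x. D x v)" for v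
    by (rule Ck_on_cong[OF assms(1)]) (simp add: frechet_derivative_at[OF assms(2), symmetric])
  then show ?thesis using assms(2,3) by (auto intro: differentiableI)
qed

lemma Ck_on_SucD: "Ck_on (Suc k) U f \<Longrightarrow> Ck_on k U f"
proof (induction k arbitrary: f)
  case 0
  then show ?case
    by (auto intro!: continuous_at_imp_continuous_on differentiable_imp_continuous_within)
next
  case (Suc k)
  have "Ck_on k U (\<lambda>x. frechet_derivative f (at x) v)" for v
    using Suc.prems by (intro Suc.IH) (simp del: Ck_on.simps(2) add: Ck_on.simps(2)[of "Suc k"])
  then show ?case using Suc.prems by (simp del: Ck_on.simps(2) add: Ck_on.simps(2)[of "Suc k"] Ck_on.simps(2)[of "k"])
qed

lemma Ck_on_has_derivative:
  "Ck_on (Suc k) U f \<Longrightarrow> x \<in> U \<Longrightarrow> (f has_derivative frechet_derivative f (at x)) (at x)"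
  by (simp add: frechet_derivative_works)

lemma Ck_on_frechet_derivative: "Ck_on (Suc k) U f \<Longrightarrow> Ck_on k U (\<lambda>x. frechet_derivative f (at x) v)"
  by simp

lemma Ck_on_const: "Ck_on k U (\<lambda>x. c)"
  by (induction k arbitrary: c) (auto simp: frechet_derivative_const)

lemma Ck_on_bounded_linear_compose:
  assumes L: "bounded_linear L" and U: "open U"
  shows "Ck_on k U f \<Longrightarrow> Ck_on k U (\<lambda>x. L (f x))"
proof (induction k arbitrary: f)
  case 0
  then show ?case by (simp add: bounded_linear.continuous_on[OF L])
next
  case (Suc k)
  show ?case
    by (rule Ck_on_SucI[OF U, where D = "\<lambda>x v. L (frechet_derivative f (at x) v)"])
      (intro bounded_linear.has_derivative[OF L] Ck_on_has_derivative[OF Suc.prems]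
        Suc.IH Ck_on_frechet_derivative[OF Suc.prems]; assumption)+
qed

lemma Ck_on_add:
  assumes U: "open U"
  shows "Ck_on k U f \<Longrightarrow> Ck_on k U g \<Longrightarrow> Ck_on k U (\<lambda>x. f x + g x)"
proof (induction k arbitrary: f g)
  case (Suc k)
  show ?case
    by (rule Ck_on_SucI[OF U, where D = "\<lambda>x v. frechet_derivative f (at x) v + frechet_derivative g (at x) v"])
      (intro has_derivative_add Ck_on_has_derivative[OF Suc.prems(1)] Ck_on_has_derivative[OF Suc.prems(2)]
        Suc.IH Ck_on_frechet_derivative[OF Suc.prems(1)] Ck_on_frechet_derivative[OF Suc.prems(2)]; assumption)+
qed (auto intro!: continuous_intros)

lemma Ck_on_bilinear:
  assumes B: "bounded_bilinear B" and U: "open U"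
  shows "Ck_on k U f \<Longrightarrow> Ck_on k U g \<Longrightarrow> Ck_on k U (\<lambda>x. B (f x) (g x))"
proof (induction k arbitrary: f g)
  case 0
  then show ?case by (simp add: bounded_bilinear.continuous_on[OF B])
next
  case (Suc k)
  note fg = Suc.prems[THEN Ck_on_SucD]
  show ?case
    by (rule Ck_on_SucI[OF U, where D = "\<lambda>x v. B (f x) (frechet_derivative g (at x) v) + B (frechet_derivative f (at x) v) (g x)"])
      (intro bounded_bilinear.FDERIV[OF B] Ck_on_has_derivative[OF Suc.prems(1)] Ck_on_has_derivative[OF Suc.prems(2)]
        Ck_on_add[OF U] fg
        Suc.IH Ck_on_frechet_derivative[OF Suc.prems(1)] Ck_on_frechet_derivative[OF Suc.prems(2)]; assumption)+
qed

lemma Ck_on_sum: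
  assumes U: "open U"
  shows "(\<And>i. i \<in> I \<Longrightarrow> Ck_on k U (f i)) \<Longrightarrow> Ck_on k U (\<lambda>x. \<Sum>i\<in>I. f i x)"
  by (induction I rule: infinite_finite_induct) (auto intro: Ck_on_const Ck_on_add[OF U])

text \<open>The derivative of \<open>f\<close> at \<open>g x\<close> acts on a direction that depends on \<open>x\<close>, whereas
  differentiability of order \<open>k\<close> only speaks of \<open>Df\<close> in constant directions. Expanding the
  direction in a basis of the finite-dimensional space in the middle reduces the chain rule to
  finitely many products to which the induction hypothesis applies.\<close>

lemma Ck_on_compose:
  fixes f :: "'b::euclidean_space \<Rightarrow> 'c::real_normed_vector"
  assumes U: "open U" "open V"
  shows "Ck_on k V f \<Longrightarrow> Ck_on k U g \<Longrightarrow> g ` U \<subseteq> V \<Longrightarrow> Ck_on k U (\<lambda>x. f (g x))"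
proof (induction k arbitrary: f)
  case 0
  then show ?case by (auto intro: continuous_on_compose2)
next
  case (Suc k)
  let ?D = "\<lambda>x v. \<Sum>b\<in>Basis. (frechet_derivative g (at x) v \<bullet> b) *\<^sub>R frechet_derivative f (at (g x)) b"
  have g: "Ck_on k U g" by (rule Ck_on_SucD[OF Suc.prems(2)])
  show ?case
  proof (rule Ck_on_SucI[OF U(1), where D = ?D])
    fix x assume x: "x \<in> U"
    let ?F = "frechet_derivative f (at (g x))"
    have f': "(f has_derivative ?F) (at (g x))"
      using Suc.prems(3) x by (intro Ck_on_has_derivative[OF Suc.prems(1)]) auto
    have "((\<lambda>x. f (g x)) has_derivative (\<lambda>v. ?F (frechet_derivative g (at x) v))) (at x)"
      by (rule has_derivative_compose[OF Ck_on_has_derivative[OF Suc.prems(2) x] f'])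
    also have "(\<lambda>v. ?F (frechet_derivative g (at x) v)) = ?D x"
    proof
      fix v
      have "?F w = (\<Sum>b\<in>Basis. (w \<bullet> b) *\<^sub>R ?F b)" for w
        using has_derivative_linear[OF f']
        by (subst (1) euclidean_representation[of w, symmetric]) (simp add: linear_sum linear_cmul)
      then show "?F (frechet_derivative g (at x) v) = ?D x v" .
    qed
    finally show "((\<lambda>x. f (g x)) has_derivative ?D x) (at x)" .
  next
    fix v
    show "Ck_on k U (\<lambda>x. ?D x v)"
      by (intro Ck_on_sum[OF U(1)] Ck_on_bilinear[OF bounded_bilinear_scaleR U(1)]
          Ck_on_bounded_linear_compose[OF bounded_linear_inner_left U(1)] Suc.IH g Suc.prems(3)
          Ck_on_frechet_derivative[OF Suc.prems(1)] Ck_on_frechet_derivative[OF Suc.prems(2)])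
  qed
qed

lemma Ck_on_inverse:
  fixes f :: "'a::real_normed_vector \<Rightarrow> 'b::real_normed_div_algebra"
  assumes U: "open U" and nz: "\<And>x. x \<in> U \<Longrightarrow> f x \<noteq> 0"
  shows "Ck_on k U f \<Longrightarrow> Ck_on k U (\<lambda>x. inverse (f x))"
proof (induction k)
  case 0
  then show ?case using nz by (auto intro!: continuous_intros)
next
  case (Suc k)
  have f: "Ck_on k U f" by (rule Ck_on_SucD[OF Suc.prems])
  have D: "Ck_on k U (\<lambda>x. - (inverse (f x) * frechet_derivative f (at x) v * inverse (f x)))" for v
    by (intro Ck_on_bilinear[OF bounded_bilinear_mult U] Suc.IH[OF f] Ck_on_frechet_derivative[OF Suc.prems]
        Ck_on_bounded_linear_compose[OF bounded_linear_minus[OF bounded_linear_ident] U])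
  show ?case
    by (rule Ck_on_SucI[OF U, where D = "\<lambda>x v. - (inverse (f x) * frechet_derivative f (at x) v * inverse (f x))"])
      (rule Deriv.has_derivative_inverse[OF nz Ck_on_has_derivative[OF Suc.prems]], assumption, assumption, rule D)
qed

lemma Ck_on_real_of_derivative:
  fixes f :: "real \<Rightarrow> real"
  assumes U: "open U" and "\<And>x. x \<in> U \<Longrightarrow> (f has_real_derivative f' x) (at x)" and "Ck_on k U f'"
  shows "Ck_on (Suc k) U f"
  by (rule Ck_on_SucI[OF U, where D = "\<lambda>x v. v * f' x"])
    (use assms in \<open>auto simp: has_field_derivative_def mult.commute[of _ "f' _"]
      intro!: Ck_on_bilinear[OF bounded_bilinear_mult U] Ck_on_const\<close>)

lemma smooth_on_subset: "smooth_on U f \<Longrightarrow> V \<subseteq> U \<Longrightarrow> smooth_on V f"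
proof -
  have "Ck_on k U f \<Longrightarrow> V \<subseteq> U \<Longrightarrow> Ck_on k V f" for k
    by (induction k arbitrary: f) (auto intro: continuous_on_subset)
  then show "smooth_on U f \<Longrightarrow> V \<subseteq> U \<Longrightarrow> smooth_on V f" by (auto simp: smooth_on_def)
qed

lemma smooth_on_imp_continuous_on: "smooth_on U f \<Longrightarrow> continuous_on U f"
  unfolding smooth_on_def by (metis Ck_on.simps(1))

lemma smooth_on_imp_has_derivative:
  "smooth_on U f \<Longrightarrow> x \<in> U \<Longrightarrow> (f has_derivative frechet_derivative f (at x)) (at x)"
  unfolding smooth_on_def using Ck_on_has_derivative by blast

lemma smooth_on_frechet_derivative:
  "smooth_on U f \<Longrightarrow> smooth_on U (\<lambda>x. frechet_derivative f (at x) v)"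
  unfolding smooth_on_def by (metis Ck_on.simps(2))

lemma smooth_on_const: "smooth_on U (\<lambda>x. c)"
  by (simp add: smooth_on_def Ck_on_const)

lemma smooth_on_bounded_linear:
  assumes "bounded_linear L" shows "smooth_on U L"
proof -
  have "Ck_on k UNIV L" for k
  proof (cases k)
    case 0
    then show ?thesis using assms by (simp add: linear_continuous_on)
  next
    case (Suc j)
    show ?thesis unfolding Suc
      by (rule Ck_on_SucI[where D = "\<lambda>x. L"]) (use assms in \<open>auto intro: Ck_on_const bounded_linear_imp_has_derivative\<close>)
  qed
  then show ?thesis using smooth_on_subset[of UNIV L U] by (auto simp: smooth_on_def)
qed

lemma smooth_on_id: "smooth_on U (\<lambda>x. x)"
  by (intro smooth_on_bounded_linear bounded_linear_ident)

lemma smooth_on_bounded_linear_compose: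
  "bounded_linear L \<Longrightarrow> open U \<Longrightarrow> smooth_on U f \<Longrightarrow> smooth_on U (\<lambda>x. L (f x))"
  by (simp add: smooth_on_def Ck_on_bounded_linear_compose)

lemma smooth_on_add: "open U \<Longrightarrow> smooth_on U f \<Longrightarrow> smooth_on U g \<Longrightarrow> smooth_on U (\<lambda>x. f x + g x)"
  by (simp add: smooth_on_def Ck_on_add)

lemma smooth_on_minus: "open U \<Longrightarrow> smooth_on U f \<Longrightarrow> smooth_on U (\<lambda>x. - f x)"
  by (simp add: smooth_on_bounded_linear_compose bounded_linear_minus[OF bounded_linear_ident])

lemma smooth_on_mult:
  fixes f :: "'a::real_normed_vector \<Rightarrow> 'b::real_normed_algebra"
  shows "open U \<Longrightarrow> smooth_on U f \<Longrightarrow> smooth_on U g \<Longrightarrow> smooth_on U (\<lambda>x. f x * g x)"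
  by (simp add: smooth_on_def Ck_on_bilinear[OF bounded_bilinear_mult])

lemma smooth_on_inverse:
  fixes f :: "'a::real_normed_vector \<Rightarrow> 'b::real_normed_div_algebra"
  shows "open U \<Longrightarrow> (\<And>x. x \<in> U \<Longrightarrow> f x \<noteq> 0) \<Longrightarrow> smooth_on U f \<Longrightarrow> smooth_on U (\<lambda>x. inverse (f x))"
  by (simp add: smooth_on_def Ck_on_inverse)

lemma smooth_on_compose:
  fixes f :: "'b::euclidean_space \<Rightarrow> 'c::real_normed_vector"
  shows "open U \<Longrightarrow> open V \<Longrightarrow> smooth_on V f \<Longrightarrow> smooth_on U g \<Longrightarrow> g ` U \<subseteq> V \<Longrightarrow> smooth_on U (\<lambda>x. f (g x))"
  by (simp add: smooth_on_def Ck_on_compose)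

lemma smooth_on_Pair:
  assumes "open U" "smooth_on U f" "smooth_on U g"
  shows "smooth_on U (\<lambda>x. (f x, g x))"
proof -
  have "smooth_on U (\<lambda>x. (f x, 0) + (0, g x))"
    using assms
    by (intro smooth_on_add smooth_on_bounded_linear_compose[where L = "\<lambda>y. (y, 0)"]
        smooth_on_bounded_linear_compose[where L = "\<lambda>y. (0, y)"])
      (auto intro!: bounded_linear_Pair bounded_linear_ident bounded_linear_zero)
  then show ?thesis by simp
qed

text \<open>The height of a profile is only known through its derivative; its smoothness follows in this
  way.\<close>

lemma smooth_on_of_derivative:
  fixes f :: "real \<Rightarrow> real"
  assumes U: "open U" and f: "\<And>x. x \<in> U \<Longrightarrow> (f has_real_derivative f' x) (at x)" and "smooth_on U f'"
  shows "smooth_on U f"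
  unfolding smooth_on_def
proof
  fix k show "Ck_on k U f"
    using Ck_on_real_of_derivative[OF U f, of k] Ck_on_SucD assms(3)
    by (auto simp: smooth_on_def)
qed

lemma smooth_on_exp: "smooth_on UNIV (exp :: real \<Rightarrow> real)"
  unfolding smooth_on_def
proof
  fix k show "Ck_on k UNIV (exp :: real \<Rightarrow> real)"
  proof (induction k)
    case (Suc k)
    show ?case by (rule Ck_on_real_of_derivative[OF open_UNIV DERIV_exp Suc])
  qed (auto intro!: continuous_intros)
qed

lemma smooth_on_sqrt: "smooth_on {0<..} sqrt"
  unfolding smooth_on_def
proof
  fix k show "Ck_on k {0<..} sqrt"
  proof (induction k)
    case (Suc k)
    have "Ck_on k {0<..} (\<lambda>x. inverse (sqrt x) * (1/2))"
      by (intro Ck_on_bilinear[OF bounded_bilinear_mult] Ck_on_inverse Suc Ck_on_const) auto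
    then show ?case
      by (intro Ck_on_real_of_derivative[where f' = "\<lambda>x. inverse (sqrt x) * (1/2)"])
        (auto intro!: derivative_eq_intros simp: divide_simps)
  qed (auto intro!: continuous_intros)
qed


section \<open>Lengths of paths\<close>

lemma valid_path_imp_vector_derivative:
  assumes "valid_path c"
  obtains T where "finite T" "\<And>s. s \<in> {0..1} - T \<Longrightarrow> (c has_vector_derivative vector_derivative c (at s)) (at s)"
    "continuous_on {0..1} c"
  using assms unfolding valid_path_def piecewise_C1_differentiable_on_def C1_differentiable_on_eq
  by (metis vector_derivative_works)

text \<open>A function whose differential is bounded by the metric does not increase lengths. A path is
  differentiable off a finite set with possibly unbounded speed, so the fundamental theorem of
  calculus is applied in the gauge integral, which makes the derivative of \<open>f\<close> along the path
  measurable. When the length is finite, this derivative is even absolutely integrable and its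
  integral is bounded by the length.\<close>

lemma curve_length_ge:
  fixes f :: "'a::real_normed_vector \<Rightarrow> real"
  assumes f: "\<And>x. x \<in> S \<Longrightarrow> (f has_derivative f' x) (at x)"
    and bound: "\<And>x v. x \<in> S \<Longrightarrow> \<bar>f' x v\<bar> \<le> sqrt (g x v v)"
    and c: "valid_path c" "path_image c \<subseteq> S"
  shows "ennreal \<bar>f (c 1) - f (c 0)\<bar> \<le> curve_length g c"
proof (cases "curve_length g c = \<infinity>")
  case False
  obtain T where T: "finite T" "\<And>s. s \<in> {0..1} - T \<Longrightarrow> (c has_vector_derivative vector_derivative c (at s)) (at s)"
    "continuous_on {0..1} c"
    using valid_path_imp_vector_derivative[OF c(1)] by metis
  have cS: "c s \<in> S" if "s \<in> {0..1}" for s using that c(2) by (auto simp: path_image_def)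
  define F' where "F' s = (if s \<in> T then 0 else f' (c s) (vector_derivative c (at s)))" for s
  have D: "((\<lambda>s. f (c s)) has_vector_derivative F' s) (at s)" if "s \<in> {0..1} - T" for s
  proof -
    have "(f \<circ> c has_vector_derivative f' (c s) (vector_derivative c (at s))) (at s)"
      using T(2)[OF that] f[OF cS, of s] that unfolding has_vector_derivative_def
      by (auto dest: diff_chain_at simp: o_def linear_simps(5)[OF has_derivative_bounded_linear])
    then show ?thesis using that by (simp add: F'_def o_def)
  qed
  have "continuous_on S f" using f by (intro has_derivative_continuous_on) (auto intro: has_derivative_at_withinI)
  then have "continuous_on {0..1} (\<lambda>s. f (c s))"
    using T(3) cS by (auto intro: continuous_on_compose2)
  then have int: "(F' has_integral (f (c 1) - f (c 0))) {0..1}"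
    using fundamental_theorem_of_calculus_strong[OF T(1) _ D] by simp
  then have meas: "F' \<in> borel_measurable (lebesgue_on {0..1})"
    by (intro integrable_imp_measurable) blast
  have le: "(\<integral>\<^sup>+ s\<in>{0..1}. ennreal \<bar>F' s\<bar> \<partial>lebesgue) \<le> curve_length g c"
    unfolding nn_integral_completion curve_length_def
    by (intro nn_integral_mono)
      (auto simp: F'_def indicator_def intro!: ennreal_leI bound cS order_trans[OF abs_ge_zero bound])
  have abs: "set_integrable lebesgue {0..1} F'"
    unfolding set_integrable_def
  proof (rule integrableI_bounded)
    show "(\<lambda>x. indicator {0..1} x *\<^sub>R F' x) \<in> borel_measurable lebesgue"
      using meas by (simp add: borel_measurable_restrict_space_iff mult.commute)
    have "(\<integral>\<^sup>+ x. ennreal (norm (indicator {0..1} x *\<^sub>R F' x)) \<partial>lebesgue) = (\<integral>\<^sup>+ s\<in>{0..1}. ennreal \<bar>F' s\<bar> \<partial>lebesgue)"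
      by (intro nn_integral_cong) (auto simp: indicator_def)
    then show "(\<integral>\<^sup>+ x. ennreal (norm (indicator {0..1} x *\<^sub>R F' x)) \<partial>lebesgue) < \<infinity>"
      using le False by (simp add: less_top order.strict_trans1)
  qed
  have "f (c 1) - f (c 0) = integral\<^sup>L lebesgue (\<lambda>x. indicator {0..1} x *\<^sub>R F' x)"
    using set_lebesgue_integral_eq_integral(2)[OF abs] int
    by (simp add: set_lebesgue_integral_def integral_unique)
  then have "ennreal \<bar>f (c 1) - f (c 0)\<bar> \<le> (\<integral>\<^sup>+ x. ennreal (norm (indicator {0..1} x *\<^sub>R F' x)) \<partial>lebesgue)"
    using integral_norm_bound_ennreal[OF abs[unfolded set_integrable_def]] by simp
  also have "\<dots> = (\<integral>\<^sup>+ s\<in>{0..1}. ennreal \<bar>F' s\<bar> \<partial>lebesgue)"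
    by (intro nn_integral_cong) (auto simp: indicator_def)
  finally show ?thesis using le by simp
qed simp

text \<open>Every distance estimate from below comes from this: those for the distance to a geodesic, and
  those for the completeness of the surfaces.\<close>

lemma path_dist_ge:
  fixes f :: "'a::real_normed_vector \<Rightarrow> real"
  assumes "\<And>x. x \<in> S \<Longrightarrow> (f has_derivative f' x) (at x)"
    and "\<And>x v. x \<in> S \<Longrightarrow> \<bar>f' x v\<bar> \<le> sqrt (g x v v)"
  shows "ennreal \<bar>f q - f p\<bar> \<le> path_dist g S p q"
  unfolding path_dist_def
proof (rule INF_greatest, clarify)
  fix c assume "valid_path c" "path_image c \<subseteq> S"
  then show "ennreal \<bar>f (pathfinish c) - f (pathstart c)\<bar> \<le> curve_length g c"
    unfolding pathstart_def pathfinish_def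
    by (intro curve_length_ge[where S = S and f = f and f' = f'] assms)
qed

lemma path_dist_le:
  assumes c: "c C1_differentiable_on {0..1}" "c ` {0..1} \<subseteq> S"
    and bound: "\<And>s. s \<in> {0..1} \<Longrightarrow> sqrt (g (c s) (vector_derivative c (at s)) (vector_derivative c (at s))) \<le> B"
  shows "path_dist g S (c 0) (c 1) \<le> ennreal B"
proof -
  have "curve_length g c \<le> (\<integral>\<^sup>+ s\<in>{0..1::real}. ennreal B \<partial>lborel)"
    unfolding curve_length_def
    by (intro nn_integral_mono) (auto simp: indicator_def intro!: ennreal_leI bound)
  also have "\<dots> = ennreal B"
    by (subst nn_integral_cmult_indicator) auto
  finally have "curve_length g c \<le> ennreal B" .
  moreover have "valid_path c"
    using c(1) unfolding valid_path_def by (rule C1_differentiable_imp_piecewise)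
  ultimately show ?thesis using c(2)
    unfolding path_dist_def by (intro INF_lower2[of c]) (auto simp: path_image_def pathstart_def pathfinish_def)
qed


section \<open>Loops on the cylinder\<close>

text \<open>A continuous map from a compact space to a Hausdorff space is a quotient map onto its image,
  because it is closed.\<close>

lemma continuous_on_factor_through_compact:
  fixes \<alpha> :: "'a::t2_space \<Rightarrow> 'b::t2_space" and L :: "'a \<Rightarrow> 'c::topological_space"
  assumes K: "compact K" and \<alpha>: "continuous_on K \<alpha>" and L: "continuous_on K L"
    and eq: "\<And>s t. s \<in> K \<Longrightarrow> t \<in> K \<Longrightarrow> \<alpha> s = \<alpha> t \<Longrightarrow> L s = L t"
  obtains l where "continuous_on (\<alpha> ` K) l" "\<And>s. s \<in> K \<Longrightarrow> l (\<alpha> s) = L s"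
proof -
  define l where "l x = L (SOME s. s \<in> K \<and> \<alpha> s = x)" for x
  have l: "l (\<alpha> s) = L s" if "s \<in> K" for s
    using someI[of "\<lambda>t. t \<in> K \<and> \<alpha> t = \<alpha> s" s] that eq unfolding l_def by metis
  moreover have "continuous_on (\<alpha> ` K) l"
    unfolding continuous_on_closed_invariant
  proof (intro allI impI)
    fix B :: "'c set" assume "closed B"
    then obtain A where A: "closed A" "A \<inter> K = L -` B \<inter> K"
      using L unfolding continuous_on_closed_invariant by blast
    have "compact (\<alpha> ` (A \<inter> K))"
      using A K \<alpha> by (metis Int_commute compact_Int_closed compact_continuous_image continuous_on_subset inf_le2)
    then have "closed (\<alpha> ` (A \<inter> K))" by (rule compact_imp_closed)
    moreover have "\<alpha> ` (A \<inter> K) \<inter> \<alpha> ` K = l -` B \<inter> \<alpha> ` K"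
      unfolding A using l by auto
    ultimately show "\<exists>A. closed A \<and> A \<inter> \<alpha> ` K = l -` B \<inter> \<alpha> ` K" by blast
  qed
  ultimately show ?thesis using that by blast
qed

text \<open>Two values of \<open>f\<close> differ by an integral multiple of \<open>2 \<pi> \<i>\<close>, so the range of \<open>f\<close> is discrete.\<close>

lemma exp_constant_imp_constant:
  fixes f :: "'a::topological_space \<Rightarrow> complex"
  assumes S: "connected S" and f: "continuous_on S f" and e: "\<And>x. x \<in> S \<Longrightarrow> exp (f x) = c"
    and xy: "x \<in> S" "y \<in> S"
  shows "f x = f y"
proof -
  have "f constant_on S"
  proof (rule continuous_discrete_range_constant[OF S f])
    fix x assume x: "x \<in> S"
    have "2 * pi \<le> norm (f y - f x)" if y: "y \<in> S" "f y \<noteq> f x" for y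
    proof -
      have "exp (f y) = exp (f x)" using e[OF x] e[OF y(1)] by simp
      then obtain n :: int where n: "f y = f x + (of_int (2 * n) * pi) * \<i>"
        unfolding exp_eq by blast
      have "n \<noteq> 0" using n y by auto
      then have "1 \<le> \<bar>real_of_int n\<bar>" by linarith
      then show ?thesis using n by (simp add: norm_mult abs_mult)
    qed
    then show "\<exists>e>0. \<forall>y. y \<in> S \<and> f y \<noteq> f x \<longrightarrow> e \<le> norm (f y - f x)"
      by (intro exI[of _ "2 * pi"]) auto
  qed
  then show ?thesis using xy by (auto simp: constant_on_def)
qed

text \<open>The pairing of a cochain, given by its values \<open>V\<close> on simplices, with a chain.\<close>

definition chain_sum :: "('b \<Rightarrow> complex) \<Rightarrow> ('b \<Rightarrow>\<^sub>0 int) \<Rightarrow> complex" where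
  "chain_sum V c = (\<Sum>\<sigma>\<in>Poly_Mapping.keys c. of_int (Poly_Mapping.lookup c \<sigma>) * V \<sigma>)"

lemma chain_sum_frag_of: "chain_sum V (frag_of \<sigma>) = V \<sigma>"
  by (simp add: chain_sum_def)

lemma chain_sum_diff: "chain_sum V (a - b) = chain_sum V a - chain_sum V b"
proof -
  let ?K = "Poly_Mapping.keys a \<union> Poly_Mapping.keys b"
  have "chain_sum V c = (\<Sum>\<sigma>\<in>?K. of_int (Poly_Mapping.lookup c \<sigma>) * V \<sigma>)"
    if "Poly_Mapping.keys c \<subseteq> ?K" for c
    unfolding chain_sum_def using that
    by (intro sum.mono_neutral_left) (auto simp: in_keys_iff)
  then show ?thesis
    using keys_diff[of a b] by (simp add: lookup_minus sum_subtractf left_diff_distrib)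
qed

text \<open>Coordinates on the standard simplices of dimension one and two. The plane triangle has the
  advantage of being convex in a normed space, so that continuous logarithms exist on it.\<close>

definition edge_point :: "real \<Rightarrow> nat \<Rightarrow> real" where
  "edge_point s = (\<lambda>i. if i = 0 then 1 - s else if i = 1 then s else 0)"

definition triangle_point :: "real \<times> real \<Rightarrow> nat \<Rightarrow> real" where
  "triangle_point = (\<lambda>(a, b) i. if i = 0 then 1 - a - b else if i = 1 then a else if i = 2 then b else 0)"

definition triangle :: "(real \<times> real) set" where
  "triangle = {(a, b). 0 \<le> a \<and> 0 \<le> b \<and> a + b \<le> 1}"

lemma edge_point_in_simplex: "s \<in> {0..1} \<Longrightarrow> edge_point s \<in> standard_simplex 1"
  by (auto simp: edge_point_def standard_simplex_def)

lemma triangle_point_in_simplex: "x \<in> triangle \<Longrightarrow> triangle_point x \<in> standard_simplex 2"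
  by (auto simp: triangle_point_def triangle_def standard_simplex_def numeral_2_eq_2)

lemma continuous_triangle_point:
  "continuous_map (top_of_set triangle) (subtopology (powertop_real UNIV) (standard_simplex 2)) triangle_point"
proof -
  have "continuous_on triangle (\<lambda>x. triangle_point x k)" for k
    unfolding triangle_point_def
    by (cases "k = 0"; cases "k = 1"; cases "k = 2") (auto simp: case_prod_beta intro!: continuous_intros)
  then show ?thesis
    using triangle_point_in_simplex
    by (auto simp: continuous_map_in_subtopology continuous_map_componentwise_UNIV)
qed

lemma convex_triangle: "convex triangle"
proof -
  have "triangle = {x. 0 \<le> (1, 0) \<bullet> x} \<inter> {x. 0 \<le> (0, 1) \<bullet> x} \<inter> {x. (1, 1) \<bullet> x \<le> 1}"
    by (auto simp: triangle_def)
  moreover have "convex \<dots>"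
    by (intro convex_Int convex_halfspace_le) (use convex_halfspace_ge[of 0] in auto)
  ultimately show ?thesis by simp
qed

text \<open>The winding of \<open>p\<close> along a singular 1-simplex: the integral over \<open>\<sigma>\<close> of the closed form
  \<open>dp / p\<close>. It does not depend on the choice of the logarithm, since two of them differ by a
  constant.\<close>

definition log_increment :: "('a \<Rightarrow> complex) \<Rightarrow> ((nat \<Rightarrow> real) \<Rightarrow> 'a) \<Rightarrow> complex" where
  "log_increment p \<sigma> =
     (SOME \<delta>. \<exists>l. continuous_on {0..1} l \<and> (\<forall>s\<in>{0..1}. p (\<sigma> (edge_point s)) = exp (l s)) \<and> \<delta> = l 1 - l 0)"

lemma log_increment_eq:
  assumes l: "continuous_on {0..1} l" "\<And>s. s \<in> {0..1} \<Longrightarrow> p (\<sigma> (edge_point s)) = exp (l s)"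
  shows "log_increment p \<sigma> = l 1 - l 0"
proof -
  let ?P = "\<lambda>\<delta>. \<exists>l. continuous_on {0..1} l \<and> (\<forall>s\<in>{0..1}. p (\<sigma> (edge_point s)) = exp (l s)) \<and> \<delta> = l 1 - l 0"
  have "?P (log_increment p \<sigma>)"
    unfolding log_increment_def by (rule someI[of ?P "l 1 - l 0"]) (use l in blast)
  then obtain l' where l': "continuous_on {0..1} l'" "\<And>s. s \<in> {0..1} \<Longrightarrow> p (\<sigma> (edge_point s)) = exp (l' s)"
    "log_increment p \<sigma> = l' 1 - l' 0" by blast
  have "l' 0 - l 0 = l' 1 - l 1"
  proof (rule exp_constant_imp_constant[of "{0..1}" "\<lambda>s. l' s - l s" 1])
    fix s :: real assume "s \<in> {0..1}"
    then have "exp (l' s) = exp (l s)" using l l' by metis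
    then show "exp (l' s - l s) = 1" by (simp add: exp_diff)
  qed (use l l' in \<open>auto intro!: continuous_intros\<close>)
  then have "l' 1 = (l' 0 - l 0) + l 1" by simp
  then show ?thesis using l'(3) by simp
qed

text \<open>The closed form \<open>dp / p\<close> has integral zero over a boundary. It is enough to see it for a single
  singular triangle: a logarithm of \<open>p\<close> exists on the whole triangle, and its increments along
  the three edges telescope.\<close>

lemma chain_sum_log_increment_boundary:
  assumes p: "continuous_on S p" "\<And>x. x \<in> S \<Longrightarrow> p x \<noteq> 0"
    and d: "singular_chain 2 (top_of_set S) d"
  shows "chain_sum (log_increment p) (chain_boundary 2 d) = 0"
proof -
  have "Poly_Mapping.keys d \<subseteq> Collect (singular_simplex 2 (top_of_set S))"
    using d by (simp add: singular_chain_def)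
  then show ?thesis
  proof (induction rule: frag_induction)
    case zero
    then show ?case by (simp add: chain_sum_def)
  next
    case (diff a b)
    then show ?case by (simp add: chain_boundary_diff chain_sum_diff)
  next
    case (one f)
    then have f: "continuous_map (subtopology (powertop_real UNIV) (standard_simplex 2)) (top_of_set S) f"
      by (simp add: singular_simplex_def)
    have "continuous_map (top_of_set triangle) (top_of_set S) (\<lambda>x. f (triangle_point x))"
      using continuous_map_compose[OF continuous_triangle_point f] by (simp add: o_def)
    then have g: "continuous_on triangle (\<lambda>x. f (triangle_point x))" "(\<lambda>x. f (triangle_point x)) ` triangle \<subseteq> S"
      by auto
    have "continuous_on triangle (\<lambda>x. p (f (triangle_point x)))"
      by (rule continuous_on_compose2[OF p(1) g])
    then obtain L where L: "continuous_on triangle L" "\<And>x. x \<in> triangle \<Longrightarrow> p (f (triangle_point x)) = exp (L x)"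
      using continuous_logarithm_on_contractible[of triangle "\<lambda>x. p (f (triangle_point x))"]
        convex_imp_contractible[OF convex_triangle] p(2) g(2) by (metis image_subset_iff)
    have face: "log_increment p (singular_face 2 k f) = L (e 1) - L (e 0)"
      if e: "continuous_on {0..1} e" "e ` {0..1} \<subseteq> triangle"
        "\<And>s. simplical_face k (edge_point s) = triangle_point (e s)" for k e
    proof (rule log_increment_eq)
      show "continuous_on {0..1} (\<lambda>s. L (e s))" by (rule continuous_on_compose2[OF L(1) e(1,2)])
      show "p (singular_face 2 k f (edge_point s)) = exp (L (e s))" if "s \<in> {0..1}" for s
      proof -
        have "e s \<in> triangle" using e(2) that by blast
        then show ?thesis using edge_point_in_simplex[OF that] e(3) L(2)[of "e s"] by (simp add: singular_face_def)
      qed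
    qed
    have "log_increment p (singular_face 2 0 f) = L (0, 1) - L (1, 0)"
      by (subst face[of "\<lambda>s. (1 - s, s)"])
        (auto intro!: continuous_on_Pair continuous_on_diff continuous_on_const continuous_on_id
          simp: fun_eq_iff triangle_def simplical_face_def edge_point_def triangle_point_def)
    moreover have "log_increment p (singular_face 2 1 f) = L (0, 1) - L (0, 0)"
      by (subst face[of "\<lambda>s. (0, s)"])
        (auto intro!: continuous_on_Pair continuous_on_diff continuous_on_const continuous_on_id
          simp: fun_eq_iff triangle_def simplical_face_def edge_point_def triangle_point_def)
    moreover have "log_increment p (singular_face 2 2 f) = L (1, 0) - L (0, 0)"
      by (subst face[of "\<lambda>s. (s, 0)"])
        (auto intro!: continuous_on_Pair continuous_on_diff continuous_on_const continuous_on_id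
          simp: fun_eq_iff triangle_def simplical_face_def edge_point_def triangle_point_def)
    moreover have "chain_boundary 2 (frag_of f)
        = frag_of (singular_face 2 0 f) - (frag_of (singular_face 2 1 f) - frag_of (singular_face 2 2 f))"
      by (simp add: chain_boundary_of numeral_2_eq_2)
    ultimately show ?case
      by (simp add: chain_sum_diff chain_sum_frag_of)
  qed
qed

text \<open>If the loop bounds a 2-chain, then its winding is the integral of \<open>dp / p\<close> over a boundary,
  hence zero.\<close>

lemma null_homologous_loop_log_closed:
  fixes p :: "'a::topological_space \<Rightarrow> complex"
  assumes p: "continuous_on S p" "\<And>x. x \<in> S \<Longrightarrow> p x \<noteq> 0"
    and \<alpha>: "loop_null_homologous (top_of_set S) \<alpha>"
    and L: "continuous_on {0..1} L" "\<And>s. s \<in> {0..1} \<Longrightarrow> p (\<alpha> s) = exp (L s)"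
  shows "L 0 = L 1"
proof -
  obtain d where d: "singular_chain 2 (top_of_set S) d" "chain_boundary 2 d = path_chain \<alpha>"
    using \<alpha> unfolding loop_null_homologous_def singular_boundary numeral_2_eq_2 One_nat_def by blast
  have "chain_sum (log_increment p) (path_chain \<alpha>) = L 1 - L 0"
    unfolding path_chain_def chain_sum_frag_of
    by (rule log_increment_eq[OF L(1)])
      (use L(2) edge_point_in_simplex in \<open>auto simp: edge_point_def\<close>)
  then show ?thesis using chain_sum_log_increment_boundary[OF p d(1)] d(2) by simp
qed

text \<open>A loop is a singular 1-cycle in the contractible set, whose first homology group is trivial; the
  2-chain that it bounds there also lies in the larger space.\<close>

lemma loop_null_homologous_in_contractible:
  assumes S: "contractible S" "S \<subseteq> U"
    and \<alpha>: "path \<alpha>" "path_image \<alpha> \<subseteq> S" "pathfinish \<alpha> = pathstart \<alpha>"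
  shows "loop_null_homologous (top_of_set U) \<alpha>"
proof -
  let ?X = "top_of_set S" and ?f = "restrict (\<lambda>x. \<alpha> (x 1)) (standard_simplex 1)"
  have "continuous_map (subtopology (powertop_real UNIV) (standard_simplex 1)) (top_of_set {0..1}) (\<lambda>x. x 1)"
    unfolding continuous_map_in_subtopology
    by (auto simp: standard_simplex_def intro!: continuous_map_from_subtopology continuous_map_product_projection)
  moreover have "continuous_map (top_of_set {0..1}) ?X \<alpha>"
    using \<alpha> by (auto simp: path_def path_image_def)
  ultimately have "continuous_map (subtopology (powertop_real UNIV) (standard_simplex 1)) ?X (\<lambda>x. \<alpha> (x 1))"
    using continuous_map_compose unfolding o_def by blast
  then have "singular_simplex 1 ?X ?f"
    unfolding singular_simplex_def
    by (auto intro: continuous_map_eq simp: topspace_subtopology)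
  moreover have "singular_face 1 0 ?f = singular_face 1 1 ?f"
    unfolding singular_face_def
  proof (rule restrict_ext)
    fix x assume "x \<in> standard_simplex (1 - Suc 0)"
    then have x: "x = (\<lambda>j. if j = 0 then 1 else 0)" by (auto simp: standard_simplex_0)
    have "simplical_face 0 x \<in> standard_simplex 1" "simplical_face 1 x \<in> standard_simplex 1"
      by (auto simp: x simplical_face_def standard_simplex_def)
    then show "(?f \<circ> simplical_face 0) x = (?f \<circ> simplical_face 1) x"
      using \<alpha>(3) by (simp add: x simplical_face_def pathstart_def pathfinish_def)
  qed
  then have "chain_boundary 1 (frag_of ?f) = 0" by (simp add: chain_boundary_of)
  ultimately have cyc: "singular_relcycle 1 ?X {} (path_chain \<alpha>)"
    by (simp add: singular_cycle singular_chain_of path_chain_def)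
  have "trivial_group (homology_group (int 1) ?X)"
    using trivial_reduced_homology_group_contractible_space[of ?X "int 1"] S
      un_reduced_homology_group[of "int 1" ?X] by simp
  then have "carrier (homology_group (int 1) ?X) = {singular_relboundary_set 1 ?X {}}"
    unfolding trivial_group_def one_relative_homology_group by simp
  moreover have "homologous_rel_set 1 ?X {} (path_chain \<alpha>) \<in> carrier (homology_group (int 1) ?X)"
    unfolding carrier_relative_homology_group using cyc by (intro imageI) simp
  ultimately have "homologous_rel_set 1 ?X {} (path_chain \<alpha>) = singular_relboundary_set 1 ?X {}"
    by simp
  then have "singular_relboundary 1 ?X {} (path_chain \<alpha>)"
    by (simp add: homologous_rel_set_eq_relboundary)
  then show ?thesis
    unfolding loop_null_homologous_def using S(2) singular_boundary_mono by blast
qed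

lemma Jordan_curve_of_two_arcs:
  assumes "arc A" "arc B" "pathfinish A = pathstart B" "pathfinish B = pathstart A"
    "path_image A \<inter> path_image B \<subseteq> {pathstart A, pathstart B}"
  shows "Jordan_curve (path_image A \<union> path_image B)"
  unfolding Jordan_curve_def parametrizes_Jordan_curve_def
  by (rule exI[of _ "A +++ B"]) (use assms simple_path_join_loop[OF assms] path_image_join[OF assms(3)] in auto)

lemma arc_image_Pair:
  fixes A :: "real \<Rightarrow> 'a::topological_space" and h :: "'b::topological_space"
  assumes "arc A" shows "arc (\<lambda>s. (A s, h))" "path_image (\<lambda>s. (A s, h)) = path_image A \<times> {h}"
  using assms by (auto simp: arc_def path_def path_image_def inj_on_def intro!: continuous_intros)

lemma arc_Pair_linepath:
  fixes a b :: real
  assumes "a \<noteq> b" shows "arc (\<lambda>s. (q, linepath a b s))" "path_image (\<lambda>s. (q, linepath a b s)) = {q} \<times> closed_segment a b"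
proof -
  have "arc (linepath a b)" using assms by simp
  then show "arc (\<lambda>s. (q, linepath a b s))" by (auto simp: arc_def path_def inj_on_def intro!: continuous_intros)
  show "path_image (\<lambda>s. (q, linepath a b s)) = {q} \<times> closed_segment a b"
    by (auto simp: path_image_def linepath_image_01[symmetric])
qed

text \<open>The four sides join to two arcs that only share their end points. The horizontal sides may
  project to the same arc of the base, traversed backwards, or to complementary arcs of a
  circle; this covers both kinds of asymptotic boundary.\<close>

lemma Jordan_curve_rectangle:
  assumes A: "arc A" "pathstart A = p" "pathfinish A = q"
    and B: "arc B" "pathstart B = q" "pathfinish B = p" and h: "h > 0"
  shows "Jordan_curve (path_image A \<times> {-h} \<union> path_image B \<times> {h} \<union> {p} \<times> {-h..h} \<union> {q} \<times> {-h..h::real})"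
proof -
  let ?A = "\<lambda>s. (A s, -h)" and ?B = "\<lambda>s. (B s, h)"
  let ?q = "\<lambda>s. (q, linepath (-h) h s)" and ?p = "\<lambda>s. (p, linepath h (-h) s)"
  have pq: "p \<noteq> q" using A by (metis arc_distinct_ends)
  have seg: "closed_segment (-h) h = {-h..h}" "closed_segment h (-h) = {-h..h}"
    using h by (auto simp: closed_segment_eq_real_ivl)
  have ends: "pathstart ?A = (p, -h)" "pathfinish ?A = (q, -h)" "pathstart ?B = (q, h)" "pathfinish ?B = (p, h)"
    "pathstart ?q = (q, -h)" "pathfinish ?q = (q, h)" "pathstart ?p = (p, h)" "pathfinish ?p = (p, -h)"
    using A B by (auto simp: pathstart_def pathfinish_def linepath_def)
  have im: "path_image ?A = path_image A \<times> {-h}" "path_image ?B = path_image B \<times> {h}"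
    "path_image ?q = {q} \<times> {-h..h}" "path_image ?p = {p} \<times> {-h..h}"
    using arc_image_Pair(2)[OF A(1)] arc_image_Pair(2)[OF B(1)] arc_Pair_linepath(2)[of "-h" h q]
      arc_Pair_linepath(2)[of h "-h" p] h by (simp_all add: seg)
  have arcs: "arc ?A" "arc ?B" "arc ?q" "arc ?p"
    using arc_image_Pair(1)[OF A(1)] arc_image_Pair(1)[OF B(1)] arc_Pair_linepath(1)[of "-h" h q]
      arc_Pair_linepath(1)[of h "-h" p] h by simp_all
  have 1: "arc (?A +++ ?q)" "arc (?B +++ ?p)"
    by (intro arc_join arcs; auto simp: ends im)+
  have "Jordan_curve (path_image (?A +++ ?q) \<union> path_image (?B +++ ?p))"
    by (rule Jordan_curve_of_two_arcs[OF 1]) (use h pq in \<open>auto simp: ends path_image_join im\<close>)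
  also have "path_image (?A +++ ?q) \<union> path_image (?B +++ ?p) =
     path_image A \<times> {-h} \<union> path_image B \<times> {h} \<union> {p} \<times> {-h..h} \<union> {q} \<times> {-h..h}"
    by (auto simp: ends path_image_join im)
  finally show ?thesis .
qed

lemma unit_quotient_Arg2pi:
  assumes p: "norm p = 1" "norm q = 1" "p \<noteq> q"
  shows "cis (Arg2pi (q / p)) = q / p" "0 < Arg2pi (q / p)" "Arg2pi (q / p) < 2 * pi"
proof -
  have p0: "p \<noteq> 0" using p by auto
  have n: "q / p \<noteq> 0" "norm (q / p) = 1" "q / p \<noteq> 1" using p p0 by (auto simp: norm_divide)
  show e: "cis (Arg2pi (q / p)) = q / p" using Arg2pi_eq[of "q / p"] n by (simp add: cis_conv_exp)
  have "Arg2pi (q / p) \<noteq> 0" using e n(3) by (metis cis_zero)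
  then show "0 < Arg2pi (q / p)" using Arg2pi_ge_0[of "q/p"] by simp
  show "Arg2pi (q / p) < 2 * pi" by (rule Arg2pi_lt_2pi)
qed

text \<open>The counterclockwise arc between distinct points of the circle is an embedded arc because its
  opening angle is strictly between \<open>0\<close> and \<open>2 \<pi>\<close>.\<close>

lemma arc_ccw_arc:
  assumes p: "norm p = 1" "norm q = 1" "p \<noteq> q"
  defines "A \<equiv> \<lambda>s. p * cis (s * Arg2pi (q / p))"
  shows "arc A" "pathstart A = p" "pathfinish A = q" "path_image A = ccw_arc p q"
proof -
  let ?T = "Arg2pi (q / p)"
  have p0: "p \<noteq> 0" using p by auto
  note e = unit_quotient_Arg2pi(1)[OF p] and T = unit_quotient_Arg2pi(2,3)[OF p]
  have "inj_on A {0..1}"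
  proof
    fix s t :: real assume st: "s \<in> {0..1}" "t \<in> {0..1}" "A s = A t"
    have "exp (\<i> * of_real (s * ?T)) = exp (\<i> * of_real (t * ?T))"
      using st(3) p0 by (simp add: A_def cis_conv_exp)
    moreover have "s * ?T < 2 * pi" "t * ?T < 2 * pi"
      using st T by (metis atLeastAtMost_iff le_less_trans less_eq_real_def mult_left_le_one_le)+
    ultimately have "s * ?T = t * ?T"
      using st T by (metis Arg2pi_unique atLeastAtMost_iff less_eq_real_def mult_nonneg_nonneg mult_1 of_real_1 zero_less_one)
    then show "s = t" using T by simp
  qed
  then show "arc A" by (auto simp: arc_def path_def A_def intro!: continuous_intros)
  show "pathstart A = p" "pathfinish A = q" using e p0 by (auto simp: A_def pathstart_def pathfinish_def)
  have "(\<lambda>s. s * ?T) ` {0..1} = {0..?T}"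
    using T by (auto simp: image_def divide_simps mult_left_le_one_le intro!: bexI[of _ "_ / ?T"])
  moreover have "path_image A = (\<lambda>\<theta>. p * cis \<theta>) ` ((\<lambda>s. s * ?T) ` {0..1})"
    by (simp add: path_image_def A_def image_image)
  ultimately show "path_image A = ccw_arc p q"
    by (simp add: ccw_arc_def)
qed

lemma contractible_arc_image:
  fixes A :: "real \<Rightarrow> 'a::real_normed_vector"
  shows "arc A \<Longrightarrow> contractible (path_image A)"
  using homeomorphic_arc_image_interval[of A 0 1] homeomorphic_contractible_eq[of "path_image A" "{0..1::real}"]
  by (auto simp: convex_imp_contractible)

text \<open>The whole curve lies in the product of an arc and a line, which is contractible. So the
  parametrization of the curve does not matter.\<close>

theorem rectangle_over_arc_null_homologous:
  assumes "norm p = 1" "norm q = 1" "p \<noteq> q" "h > 0"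
  shows "Jordan_curve_homologous_to_zero ideal_cylinder
     (ccw_arc p q \<times> {-h} \<union> ccw_arc p q \<times> {h} \<union> {p} \<times> {-h..h} \<union> {q} \<times> {-h..h})" (is "Jordan_curve_homologous_to_zero _ ?J")
proof -
  define A where "A = (\<lambda>s. p * cis (s * Arg2pi (q / p)))"
  note A = arc_ccw_arc[OF assms(1-3), folded A_def]
  have "Jordan_curve ?J"
    using Jordan_curve_rectangle[OF A(1-3), of "reversepath A" h] A assms
    by (simp add: arc_reversepath)
  moreover have "loop_null_homologous ideal_cylinder \<alpha>" if \<alpha>: "parametrizes_Jordan_curve \<alpha> ?J" for \<alpha>
    unfolding ideal_cylinder_def
  proof (rule loop_null_homologous_in_contractible[of "ccw_arc p q \<times> UNIV"])
    show "contractible (ccw_arc p q \<times> (UNIV::real set))"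
      using contractible_arc_image[OF A(1)] A(4) by (simp add: contractible_Times)
    show "ccw_arc p q \<times> (UNIV::real set) \<subseteq> sphere 0 1 \<times> UNIV"
      using assms by (auto simp: ccw_arc_def norm_mult)
    have "p \<in> ccw_arc p q" "q \<in> ccw_arc p q"
      using A pathstart_in_path_image[of A] pathfinish_in_path_image[of A] by auto
    then show "path_image \<alpha> \<subseteq> ccw_arc p q \<times> UNIV" using \<alpha>
      by (auto simp: parametrizes_Jordan_curve_def)
  qed (use \<alpha> in \<open>auto simp: parametrizes_Jordan_curve_def simple_path_imp_path\<close>)
  ultimately show ?thesis by (simp add: Jordan_curve_homologous_to_zero_def)
qed

lemma Arg2pi_inverse_sum:
  assumes "norm p = 1" "norm q = 1" "p \<noteq> q"
  shows "Arg2pi (q / p) + Arg2pi (p / q) = 2 * pi"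
proof -
  note T = unit_quotient_Arg2pi[OF assms]
  have pq0: "p \<noteq> 0" "q \<noteq> 0" using assms by auto
  have "p / q = cis (2 * pi - Arg2pi (q / p))"
    using T(1) pq0 by (simp add: cis_divide[symmetric])
  then have "Arg2pi (p / q) = 2 * pi - Arg2pi (q / p)"
    using T(2,3) by (intro Arg2pi_unique[of 1]) (auto simp: cis_conv_exp)
  then show ?thesis by simp
qed

text \<open>The angle function of the arc is one logarithm, up to a constant and the factor \<open>\<i>\<close>, and all
  others differ from it by a constant.\<close>

lemma log_increment_along_arc:
  fixes l :: "complex \<times> real \<Rightarrow> complex"
  assumes l: "continuous_on J l" "\<And>x. x \<in> J \<Longrightarrow> exp (l x) = fst x"
    and pq: "norm p = 1" "norm q = 1" "p \<noteq> q" and J: "ccw_arc p q \<times> {h} \<subseteq> J"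
  shows "l (q, h) = l (p, h) + \<i> * Arg2pi (q / p)"
proof -
  let ?T = "Arg2pi (q / p)"
  define A where "A = (\<lambda>s. p * cis (s * ?T))"
  note A = arc_ccw_arc[OF pq, folded A_def]
  have AJ: "(A s, h) \<in> J" if "s \<in> {0..1}" for s
    using A(4) J that by (auto simp: path_image_def)
  have p0: "p \<noteq> 0" using pq by auto
  have "l (A 0, h) - \<i> * of_real (0 * ?T) = l (A 1, h) - \<i> * of_real (1 * ?T)"
  proof (rule exp_constant_imp_constant[of "{0..1}" "\<lambda>s. l (A s, h) - \<i> * of_real (s * ?T)" p])
    show "continuous_on {0..1} (\<lambda>s. l (A s, h) - \<i> * of_real (s * ?T))"
      using AJ by (intro continuous_intros continuous_on_compose2[OF l(1)]) (auto simp: A_def intro!: continuous_intros)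
    show "exp (l (A s, h) - \<i> * of_real (s * ?T)) = p" if "s \<in> {0..1}" for s
      using l(2)[OF AJ[OF that]] by (simp add: exp_diff A_def cis_conv_exp)
  qed auto
  then show ?thesis using A(2,3) by (simp add: pathstart_def pathfinish_def)
qed

lemma log_constant_on_vertical:
  fixes l :: "complex \<times> real \<Rightarrow> complex"
  assumes l: "continuous_on J l" "\<And>x. x \<in> J \<Longrightarrow> exp (l x) = fst x"
    and J: "{q} \<times> {-h..h::real} \<subseteq> J" "h > 0"
  shows "l (q, -h) = l (q, h)"
proof (rule exp_constant_imp_constant[of "{-h..h}" "\<lambda>t. l (q, t)" q])
  show "continuous_on {-h..h} (\<lambda>t. l (q, t))"
    using J by (intro continuous_on_compose2[OF l(1)]) (auto intro!: continuous_intros)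
  show "exp (l (q, t)) = q" if "t \<in> {-h..h}" for t
    using l(2)[of "(q, t)"] subsetD[OF J(1), of "(q, t)"] that by auto
qed (use J in auto)

text \<open>Nothing is known about the parametrization except that it is simple and closed. If it is null
  homologous, then its logarithm takes the same value at both ends of the parameter interval, so
  it descends to a continuous logarithm on the curve itself. There the increments can be added
  up side by side: the vertical sides contribute nothing, the two arcs contribute \<open>\<i>\<close> times
  their opening angles, and these angles sum up to \<open>2 \<pi>\<close> instead of \<open>0\<close>.\<close>

theorem curve_around_cylinder_not_null_homologous:
  assumes pq: "norm p = 1" "norm q = 1" "p \<noteq> q" and h: "h > 0"
  shows "Jordan_curve_not_homologous_to_zero ideal_cylinder
     (ccw_arc q p \<times> {-h} \<union> ccw_arc p q \<times> {h} \<union> {p} \<times> {-h..h} \<union> {q} \<times> {-h..h})" (is "Jordan_curve_not_homologous_to_zero _ ?J")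
proof -
  define A where "A = (\<lambda>s. p * cis (s * Arg2pi (q / p)))"
  define B where "B = (\<lambda>s. q * cis (s * Arg2pi (p / q)))"
  note A = arc_ccw_arc[OF pq, folded A_def]
  note B = arc_ccw_arc[OF pq(2,1) pq(3)[symmetric], folded B_def]
  have "Jordan_curve ?J"
    using Jordan_curve_rectangle[OF B(1-3) A(1-3) h] A(4) B(4) by (simp add: Un_ac)
  moreover have False if \<alpha>: "parametrizes_Jordan_curve \<alpha> ?J" and null: "loop_null_homologous ideal_cylinder \<alpha>" for \<alpha>
  proof -
    have \<alpha>': "simple_path \<alpha>" "path_image \<alpha> = ?J" using \<alpha> by (auto simp: parametrizes_Jordan_curve_def)
    have \<alpha>c: "continuous_on {0..1} \<alpha>" using simple_path_imp_path[OF \<alpha>'(1)] by (simp add: path_def)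
    have J: "?J \<subseteq> sphere 0 1 \<times> UNIV" using pq by (auto simp: ccw_arc_def norm_mult)
    have \<alpha>J: "\<alpha> s \<in> ?J" if "s \<in> {0..1}" for s
      using imageI[OF that, of \<alpha>] \<alpha>'(2) unfolding path_image_def by simp
    then have nz: "fst (\<alpha> s) \<noteq> 0" if "s \<in> {0..1}" for s using J that by fastforce
    obtain L where L: "continuous_on {0..1} L" "\<And>s. s \<in> {0..1} \<Longrightarrow> fst (\<alpha> s) = exp (L s)"
      using continuous_logarithm_on_contractible[of "{0..1}" "\<lambda>s. fst (\<alpha> s)"] nz \<alpha>c
      by (metis continuous_on_fst convex_imp_contractible convex_real_interval(5))
    have L01: "L 0 = L 1"
      by (rule null_homologous_loop_log_closed[of "sphere 0 1 \<times> UNIV" fst \<alpha>])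
        (use null L in \<open>auto simp: ideal_cylinder_def intro!: continuous_intros\<close>)
    have "L s = L t" if "s \<in> {0..1}" "t \<in> {0..1}" "\<alpha> s = \<alpha> t" for s t
      using \<alpha>'(1) that L01 unfolding simple_path_def loop_free_def by metis
    then obtain l where l: "continuous_on (\<alpha> ` {0..1}) l" "\<And>s. s \<in> {0..1} \<Longrightarrow> l (\<alpha> s) = L s"
      using continuous_on_factor_through_compact[OF _ \<alpha>c L(1)] by (metis compact_Icc)
    have im: "\<alpha> ` {0..1} = ?J" using \<alpha>'(2) by (simp add: path_image_def)
    have l': "exp (l x) = fst x" if "x \<in> ?J" for x
    proof -
      have "x \<in> \<alpha> ` {0..1}" unfolding im by (rule that)
      then show ?thesis using l(2) L(2) by auto
    qed
    have lc: "continuous_on ?J l" using l(1) im by simp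
    have "l (q, h) = l (p, h) + \<i> * Arg2pi (q / p)"
      by (rule log_increment_along_arc[OF lc l' pq]) auto
    moreover have "l (p, -h) = l (q, -h) + \<i> * Arg2pi (p / q)"
      by (rule log_increment_along_arc[OF lc l' pq(2,1) pq(3)[symmetric]]) auto
    moreover have "l (p, -h) = l (p, h)" "l (q, -h) = l (q, h)"
      by (rule log_constant_on_vertical[OF lc l']; use h in auto)+
    ultimately have "\<i> * (Arg2pi (q / p) + Arg2pi (p / q)) = 0"
      by (simp add: algebra_simps)
    then show False using Arg2pi_inverse_sum[OF pq]
      by (metis complex_i_not_zero mult_eq_0_iff of_real_add of_real_eq_0_iff pi_neq_zero zero_neq_numeral)
  qed
  ultimately show ?thesis by (auto simp: Jordan_curve_not_homologous_to_zero_def)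
qed


section \<open>Conformal metrics on plane domains\<close>

text \<open>For a conformal metric \<open>\<rho>\<close> times the Euclidean one, \<open>\<Lambda>\<close> is the complex derivative \<open>\<partial>\<^sub>z (ln \<rho>)\<close>.
  With complex multiplication the Levi-Civita connection is simply \<open>D\<^sub>V W + \<Lambda> V W\<close>, which turns
  all curvature computations into complex algebra.\<close>

locale conformal_metric =
  fixes S :: "complex set" and g :: "complex metric_tensor"
    and \<rho> :: "complex \<Rightarrow> real" and \<Lambda> :: "complex \<Rightarrow> complex"
  assumes open_domain: "open S"
    and metric: "g z v w = \<rho> z * (v \<bullet> w)"
    and factor_pos: "z \<in> S \<Longrightarrow> 0 < \<rho> z"
    and factor_derivative: "z \<in> S \<Longrightarrow> (\<rho> has_derivative (\<lambda>v. 2 * \<rho> z * Re (\<Lambda> z * v))) (at z)"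
begin

text \<open>The three terms of the Koszul formula are the real part of a product of complex numbers, taken
  three ways; they combine into a single complex product.\<close>

lemma christoffel_conformal_identity:
  "r * Re (l * v) * (w \<bullet> u) + r * Re (l * w) * (v \<bullet> u) - r * Re (l * u) * (v \<bullet> w) = r * ((l * v * w) \<bullet> u)"
  by (simp add: inner_complex_def algebra_simps)

lemma christoffel_eq:
  assumes z: "z \<in> S"
  shows "christoffel g z v w u = \<rho> z * ((\<Lambda> z * v * w) \<bullet> u)"
proof -
  have "((\<lambda>q. g q v w) has_derivative (\<lambda>u. 2 * \<rho> z * Re (\<Lambda> z * u) * (v \<bullet> w))) (at z)" for v w
    unfolding metric by (rule has_derivative_mult_left[OF factor_derivative[OF z]])
  from frechet_derivative_at[OF this, symmetric]
  have "christoffel g z v w u = \<rho> z * Re (\<Lambda> z * v) * (w \<bullet> u) + \<rho> z * Re (\<Lambda> z * w) * (v \<bullet> u)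
      - \<rho> z * Re (\<Lambda> z * u) * (v \<bullet> w)"
    by (simp add: christoffel_def)
  then show ?thesis unfolding christoffel_conformal_identity .
qed

lemma christoffel_times_R:
  assumes p: "fst p \<in> S"
  shows "christoffel (times_R g) p v w u = \<rho> (fst p) * ((\<Lambda> (fst p) * fst v * fst w) \<bullet> fst u)"
proof -
  have "((\<lambda>q. times_R g q v w) has_derivative (\<lambda>u. 2 * \<rho> (fst p) * Re (\<Lambda> (fst p) * fst u) * (fst v \<bullet> fst w))) (at p)" for v w
  proof -
    have "((\<lambda>q. \<rho> (fst q)) has_derivative (\<lambda>u. 2 * \<rho> (fst p) * Re (\<Lambda> (fst p) * fst u))) (at p)"
      using has_derivative_compose[OF has_derivative_fst[OF has_derivative_ident] factor_derivative[OF p]] by simp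
    then show ?thesis unfolding times_R_def metric
      using has_derivative_add[OF has_derivative_mult_left has_derivative_const] by fastforce
  qed
  from frechet_derivative_at[OF this, symmetric]
  have "christoffel (times_R g) p v w u = \<rho> (fst p) * Re (\<Lambda> (fst p) * fst v) * (fst w \<bullet> fst u)
      + \<rho> (fst p) * Re (\<Lambda> (fst p) * fst w) * (fst v \<bullet> fst u) - \<rho> (fst p) * Re (\<Lambda> (fst p) * fst u) * (fst v \<bullet> fst w)"
    by (simp add: christoffel_def)
  then show ?thesis unfolding christoffel_conformal_identity .
qed

end

interpretation half_plane: conformal_metric half_plane half_plane_metric
  "\<lambda>z. 1 / (Im z)\<^sup>2" "\<lambda>z. \<i> / of_real (Im z)"
proof
  show "open half_plane" unfolding half_plane_def by (rule open_halfspace_Im_gt)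
  fix z assume "z \<in> half_plane"
  then have z: "Im z > 0" by (simp add: half_plane_def)
  have "((\<lambda>y. 1 / y\<^sup>2) has_real_derivative - 2 / Im z ^ 3) (at (Im z))"
    using z by (auto intro!: derivative_eq_intros simp: field_simps power2_eq_square power3_eq_cube)
  from has_derivative_compose[OF bounded_linear_imp_has_derivative[OF bounded_linear_Im] this[unfolded has_field_derivative_def]]
  have D: "((\<lambda>z. 1 / (Im z)\<^sup>2) has_derivative (\<lambda>v. - 2 / Im z ^ 3 * Im v)) (at z)" .
  have "- 2 / Im z ^ 3 * Im v = 2 * (1 / (Im z)\<^sup>2) * Re (\<i> / of_real (Im z) * v)" for v
    using z by (simp add: field_simps power2_eq_square power3_eq_cube complex_div_gt_0 Re_divide)
  then show "((\<lambda>z. 1 / (Im z)\<^sup>2) has_derivative (\<lambda>v. 2 * (1 / (Im z)\<^sup>2) * Re (\<i> / of_real (Im z) * v))) (at z)"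
    using D by (simp only:)
qed (auto simp: half_plane_def half_plane_metric_def)

lemma disk_iff: "z \<in> disk \<longleftrightarrow> (norm z)\<^sup>2 < 1"
  by (simp add: disk_def abs_square_less_1)

interpretation disk: conformal_metric disk disk_metric
  "\<lambda>z. 4 / (1 - (norm z)\<^sup>2)\<^sup>2" "\<lambda>z. 2 * cnj z / of_real (1 - (norm z)\<^sup>2)"
proof
  show "open disk" by (simp add: disk_def)
  fix z assume "z \<in> disk"
  then have z: "(norm z)\<^sup>2 < 1" by (simp add: disk_iff)
  have "((\<lambda>s. 4 / (1 - s)\<^sup>2) has_real_derivative 8 / (1 - z \<bullet> z) ^ 3) (at (z \<bullet> z))"
  proof -
    have "((\<lambda>s. 4 * (inverse (1 - s))\<^sup>2) has_real_derivative 8 * inverse (1 - z \<bullet> z) ^ 3) (at (z \<bullet> z))"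
      using z unfolding power2_norm_eq_inner
      by (auto intro!: derivative_eq_intros simp: power3_eq_cube)
    then show ?thesis by (simp add: divide_inverse power_inverse)
  qed
  from has_derivative_compose[OF has_derivative_inner[OF has_derivative_ident has_derivative_ident] this[unfolded has_field_derivative_def]]
  have D: "((\<lambda>z. 4 / (1 - (norm z)\<^sup>2)\<^sup>2) has_derivative (\<lambda>v. 8 / (1 - (norm z)\<^sup>2) ^ 3 * (z \<bullet> v + v \<bullet> z))) (at z)"
    by (simp add: power2_norm_eq_inner)
  have "8 / (1 - (norm z)\<^sup>2) ^ 3 * (z \<bullet> v + v \<bullet> z) = 2 * (4 / (1 - (norm z)\<^sup>2)\<^sup>2) * Re (2 * cnj z / of_real (1 - (norm z)\<^sup>2) * v)" for v
  proof -
    have "Re (2 * cnj z / of_real (1 - (norm z)\<^sup>2) * v) = Re (2 * cnj z * v) / (1 - (norm z)\<^sup>2)"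
      by (metis Re_divide_of_real times_divide_eq_left)
    then have "Re (2 * cnj z / of_real (1 - (norm z)\<^sup>2) * v) = 2 * (z \<bullet> v) / (1 - (norm z)\<^sup>2)"
      by (simp add: inner_complex_def)
    then show ?thesis by (simp add: power2_eq_square power3_eq_cube inner_complex_def field_simps)
  qed
  then show "((\<lambda>z. 4 / (1 - (norm z)\<^sup>2)\<^sup>2) has_derivative
      (\<lambda>v. 2 * (4 / (1 - (norm z)\<^sup>2)\<^sup>2) * Re (2 * cnj z / of_real (1 - (norm z)\<^sup>2) * v))) (at z)"
    using D by (simp only:)
  show "0 < 4 / (1 - (norm z)\<^sup>2)\<^sup>2" using z by simp
qed (simp add: disk_metric_def)


section \<open>Profiles\<close>

text \<open>The profile curve in the quotient of \<open>H2xR\<close> by the translations: \<open>\<phi>\<close> is the hyperbolic sine of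
  the signed distance to the geodesic and \<open>\<tau>\<close> the height. The equation for \<open>\<tau>\<close> says that the
  vertical flux is \<open>d\<close>, and the relation between \<open>\<phi>'\<close>, \<open>d\<close> and \<open>\<phi>\<close> then says that the parameter
  is the arc length.\<close>

locale profile =
  fixes d :: real and \<phi> \<phi>' \<tau> :: "real \<Rightarrow> real"
  assumes d_pos: "0 < d"
    and \<phi>: "(\<phi> has_real_derivative \<phi>' w) (at w)"
    and \<phi>': "(\<phi>' has_real_derivative \<phi> w) (at w)"
    and energy: "(\<phi>' w)\<^sup>2 + d\<^sup>2 = 1 + (\<phi> w)\<^sup>2"
    and \<tau>: "(\<tau> has_real_derivative d / sqrt (1 + (\<phi> w)\<^sup>2)) (at w)"
    and closed_profile: "closed (range (\<lambda>w. (\<phi> w, \<tau> w)))"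
begin

text \<open>The points of the half plane with \<open>Re \<zeta> / Im \<zeta> = \<phi> w\<close> form a ray; \<open>E w\<close> is its unit vector and
  \<open>r w\<close> the imaginary part of that vector. Along the profile \<open>E\<close> rotates with angular velocity
  \<open>- \<beta>\<close>.\<close>

definition r where "r w = 1 / sqrt (1 + (\<phi> w)\<^sup>2)"

definition \<beta> where "\<beta> w = \<phi>' w * (r w)\<^sup>2"

definition E :: "real \<Rightarrow> complex" where "E w = of_real (r w) * (of_real (\<phi> w) + \<i>)"

lemma r_pos: "0 < r w" by (simp add: r_def add_pos_nonneg)

lemma r_squared: "(r w)\<^sup>2 * (1 + (\<phi> w)\<^sup>2) = 1"
proof -
  have "1 + (\<phi> w)\<^sup>2 > 0" by (simp add: add_pos_nonneg)
  then show ?thesis by (simp add: r_def power_divide)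
qed

lemma r_derivative: "(r has_real_derivative - \<phi> w * \<phi>' w * (r w)^3) (at w)"
proof -
  have pos: "1 + (\<phi> w)\<^sup>2 > 0" by (simp add: add_pos_nonneg)
  have "((\<lambda>w. 1 + (\<phi> w)\<^sup>2) has_real_derivative 2 * \<phi> w * \<phi>' w) (at w)"
    by (rule DERIV_cong, (rule derivative_intros \<phi>)+) simp
  from DERIV_chain2[OF DERIV_real_sqrt[OF pos] this]
  have "((\<lambda>w. sqrt (1 + (\<phi> w)\<^sup>2)) has_real_derivative \<phi> w * \<phi>' w * r w) (at w)"
    by (rule DERIV_cong) (simp add: r_def field_simps)
  moreover have r_inverse: "r = (\<lambda>w. inverse (sqrt (1 + (\<phi> w)\<^sup>2)))"
    by (simp add: r_def[abs_def] inverse_eq_divide)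
  ultimately have "(r has_real_derivative - (r w * (\<phi> w * \<phi>' w * r w) * r w)) (at w)"
    using DERIV_inverse'[where f = "\<lambda>w. sqrt (1 + (\<phi> w)\<^sup>2)" and x = w and s = UNIV] pos by simp
  then show ?thesis by (rule DERIV_cong) (simp add: power3_eq_cube)
qed

lemma \<beta>_derivative: "(\<beta> has_real_derivative \<phi> w * (r w)\<^sup>2 - 2 * \<phi> w * (\<phi>' w)\<^sup>2 * (r w)^4) (at w)"
proof -
  have "((\<lambda>w. \<phi>' w * (r w * r w)) has_real_derivative \<phi> w * (r w * r w)
      + (- \<phi> w * \<phi>' w * (r w)^3 * r w + - \<phi> w * \<phi>' w * (r w)^3 * r w) * \<phi>' w) (at w)"
    by (rule DERIV_mult[OF \<phi>' DERIV_mult[OF r_derivative r_derivative]])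
  then show ?thesis
    by (simp add: \<beta>_def[abs_def] power2_eq_square power3_eq_cube power4_eq_xxxx algebra_simps)
qed

lemma E_derivative: "(E has_vector_derivative - \<i> * of_real (\<beta> w) * E w) (at w)"
proof -
  have "(E has_vector_derivative of_real (r w) * (of_real (\<phi>' w) + 0) + of_real (- \<phi> w * \<phi>' w * (r w)^3) * (of_real (\<phi> w) + \<i>)) (at w)"
    unfolding E_def[abs_def]
    by (intro has_vector_derivative_mult has_vector_derivative_add has_vector_derivative_const
        has_vector_derivative_of_real has_real_derivative_iff_has_vector_derivative[THEN iffD1] r_derivative \<phi>)
  also have "of_real (r w) * (of_real (\<phi>' w) + 0) + of_real (- \<phi> w * \<phi>' w * (r w)^3) * (of_real (\<phi> w) + \<i>)
    = of_real (\<phi>' w * r w * ((r w)\<^sup>2 * (1 + (\<phi> w)\<^sup>2))) + of_real (- \<phi> w * \<phi>' w * (r w)^3) * (of_real (\<phi> w) + \<i>)"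
    by (simp add: r_squared)
  also have "\<dots> = - \<i> * of_real (\<beta> w) * E w"
    by (simp add: complex_eq_iff \<beta>_def E_def power2_eq_square power3_eq_cube algebra_simps)
  finally show ?thesis .
qed

lemma norm_E: "norm (E w) = 1"
proof -
  have "(norm (E w))\<^sup>2 = (r w)\<^sup>2 * (1 + (\<phi> w)\<^sup>2)"
    by (simp add: E_def norm_mult power_mult_distrib cmod_def algebra_simps)
  then have "(norm (E w))\<^sup>2 = 1" by (simp add: r_squared)
  then show ?thesis by (metis abs_norm_cancel abs_square_eq_1)
qed

lemma Im_E: "Im (E w) = r w" and Re_E: "Re (E w) = r w * \<phi> w"
  by (simp_all add: E_def)

text \<open>Unit speed of the profile, in the form in which the coefficient of \<open>dw\<^sup>2\<close> in the induced metric
  arises.\<close>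

lemma vertical_speed: "(r w)\<^sup>2 * d\<^sup>2 + (1 + (\<phi> w)\<^sup>2) * (\<beta> w)\<^sup>2 = 1"
proof -
  have "(r w)\<^sup>2 * d\<^sup>2 + (1 + (\<phi> w)\<^sup>2) * (\<beta> w)\<^sup>2 = (r w)\<^sup>2 * (d\<^sup>2 + ((r w)\<^sup>2 * (1 + (\<phi> w)\<^sup>2)) * (\<phi>' w)\<^sup>2)"
    by (simp add: \<beta>_def power2_eq_square algebra_simps)
  also have "\<dots> = (r w)\<^sup>2 * ((\<phi>' w)\<^sup>2 + d\<^sup>2)" by (simp only: r_squared mult_1 add.commute)
  finally show ?thesis by (simp only: energy r_squared)
qed

lemma \<tau>_derivative: "(\<tau> has_real_derivative d * r w) (at w)"
  using \<tau> by (simp add: r_def)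

lemma strict_mono_\<tau>: "strict_mono \<tau>"
proof (rule strict_monoI)
  fix a b :: real assume "a < b"
  then show "\<tau> a < \<tau> b"
    using DERIV_pos_imp_increasing[of a b \<tau>] \<tau>_derivative mult_pos_pos[OF d_pos r_pos] by metis
qed

lemma smooth_\<phi>: "smooth_on UNIV \<phi>"
proof -
  have "Ck_on k UNIV \<phi> \<and> Ck_on k UNIV \<phi>'" for k
  proof (induction k)
    case 0
    then show ?case using \<phi> \<phi>' by (auto intro!: continuous_at_imp_continuous_on DERIV_isCont)
  next
    case (Suc k)
    then show ?case using \<phi> \<phi>'
      by (meson Ck_on_real_of_derivative open_UNIV)
  qed
  then show ?thesis by (auto simp: smooth_on_def)
qed

lemma smooth_r: "smooth_on UNIV r"
proof -
  have "smooth_on UNIV (\<lambda>w. inverse (sqrt (1 + \<phi> w * \<phi> w)))"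
    by (intro smooth_on_inverse smooth_on_compose[OF _ _ smooth_on_sqrt] smooth_on_add smooth_on_mult smooth_\<phi> smooth_on_const)
      (auto simp: add_pos_nonneg intro!: less_imp_neq[THEN not_sym] real_sqrt_gt_zero)
  then show ?thesis by (simp add: r_def[abs_def] power2_eq_square divide_inverse)
qed

lemma smooth_\<tau>: "smooth_on UNIV \<tau>"
  by (rule smooth_on_of_derivative[OF open_UNIV \<tau>_derivative])
    (rule smooth_on_mult[OF open_UNIV smooth_on_const smooth_r])

text \<open>The height increases strictly along the profile, so that it can serve as a coordinate; its
  inverse is continuous on the range of \<open>\<tau>\<close>, which need not be all of \<open>\<real>\<close>.\<close>

lemma inverse_\<tau>:
  obtains T where "\<And>w. T (\<tau> w) = w" "continuous_on (range \<tau>) T"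
proof -
  have "continuous_on UNIV \<tau>" using smooth_\<tau> by (rule smooth_on_imp_continuous_on)
  moreover have "inj \<tau>" using strict_mono_\<tau> by (rule strict_mono_imp_inj_on)
  ultimately obtain T where "homeomorphism UNIV (range \<tau>) \<tau> T"
    using invariance_of_domain_homeomorphism[of UNIV \<tau>] by auto
  then show ?thesis using that[of T] by (auto simp: homeomorphism_def)
qed

end

section \<open>Translation invariant minimal surfaces\<close>

text \<open>An isometry \<open>h\<close> from the half plane onto a conformal model, holomorphic and with inverse \<open>k\<close>.
  The transformation law for the connection is the logarithmic \<open>\<partial>\<^sub>\<zeta>\<close>-derivative of the isometry
  equation; \<open>\<i> / Im \<zeta>\<close> is the coefficient \<open>\<Lambda>\<close> of the half plane. Both the identity and the map
  onto the disk are used.\<close>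

locale half_plane_chart = conformal_metric S g \<rho> \<Lambda>
  for S :: "complex set" and g \<rho> \<Lambda> +
  fixes h h' h'' k :: "complex \<Rightarrow> complex"
  assumes smooth_h: "smooth_on half_plane h"
    and h: "\<zeta> \<in> half_plane \<Longrightarrow> (h has_field_derivative h' \<zeta>) (at \<zeta>)"
    and h': "\<zeta> \<in> half_plane \<Longrightarrow> (h' has_field_derivative h'' \<zeta>) (at \<zeta>)"
    and h_in: "\<zeta> \<in> half_plane \<Longrightarrow> h \<zeta> \<in> S"
    and k_in: "z \<in> S \<Longrightarrow> k z \<in> half_plane"
    and k_h: "\<zeta> \<in> half_plane \<Longrightarrow> k (h \<zeta>) = \<zeta>"
    and h_k: "z \<in> S \<Longrightarrow> h (k z) = z"
    and continuous_k: "continuous_on S k"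
    and isometry: "\<zeta> \<in> half_plane \<Longrightarrow> \<rho> (h \<zeta>) * (norm (h' \<zeta>))\<^sup>2 = 1 / (Im \<zeta>)\<^sup>2"
    and connection: "\<zeta> \<in> half_plane \<Longrightarrow> h'' \<zeta> + \<Lambda> (h \<zeta>) * (h' \<zeta>)\<^sup>2 = h' \<zeta> * (\<i> / of_real (Im \<zeta>))"
begin

text \<open>The imaginary axis is the geodesic, and \<open>f\<close> is the hyperbolic sine of the signed distance to it.\<close>

definition f :: "complex \<Rightarrow> real" where "f z = Re (k z) / Im (k z)"

lemma continuous_f: "continuous_on S f"
  unfolding f_def[abs_def]
proof (rule continuous_on_divide[OF continuous_on_Re[OF continuous_k] continuous_on_Im[OF continuous_k]], rule ballI)
  fix z assume "z \<in> S"
  then show "Im (k z) \<noteq> 0" using k_in[of z] by (simp add: half_plane_def)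
qed

end

text \<open>The sign \<open>\<sigma>\<close> allows for a reflection in the slice of height \<open>0\<close>: the explicit graph in the half
  plane is the mirror image of the surface with \<open>d = 1\<close>.\<close>

locale translation_surface = half_plane_chart S g \<rho> \<Lambda> h h' h'' k + profile d \<phi> \<phi>' \<tau>
  for S g \<rho> \<Lambda> h h' h'' k d \<phi> \<phi>' \<tau> +
  fixes \<sigma> :: real
  assumes \<sigma>: "\<sigma> * \<sigma> = 1"
begin

text \<open>The set \<open>M\<close> is given by an equation, the map \<open>X\<close> is its chart; \<open>Z\<close> is the half plane coordinate
  of the first component in polar form, and \<open>A x v\<close> is the logarithmic derivative of \<open>Z\<close> in the
  direction \<open>v\<close>.\<close>

definition M :: "(complex \<times> real) set" where
  "M = {(z, t). z \<in> S \<and> (f z, \<sigma> * t) \<in> range (\<lambda>w. (\<phi> w, \<tau> w))}"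

definition Z :: "real \<times> real \<Rightarrow> complex" where "Z x = of_real (exp (fst x)) * E (snd x)"

definition X :: "real \<times> real \<Rightarrow> complex \<times> real" where "X x = (h (Z x), \<sigma> * \<tau> (snd x))"

definition A :: "real \<times> real \<Rightarrow> real \<times> real \<Rightarrow> complex" where
  "A x v = of_real (fst v) - \<i> * of_real (\<beta> (snd x) * snd v)"

definition DX :: "real \<times> real \<Rightarrow> real \<times> real \<Rightarrow> complex \<times> real" where
  "DX x v = (h' (Z x) * (Z x * A x v), \<sigma> * (d * r (snd x)) * snd v)"

lemma Im_Z: "Im (Z x) = exp (fst x) * r (snd x)" and Re_Z: "Re (Z x) = exp (fst x) * (r (snd x) * \<phi> (snd x))"
  by (simp_all add: Z_def Im_E Re_E)

lemma norm_Z: "norm (Z x) = exp (fst x)"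
  by (simp add: Z_def norm_mult norm_E)

lemma Z_in: "Z x \<in> half_plane"
  by (simp add: half_plane_def Im_Z r_pos)

lemma Z_derivative: "(Z has_derivative (\<lambda>v. Z x * A x v)) (at x)"
proof -
  have 1: "((\<lambda>x. of_real (exp (fst x)) :: complex) has_derivative (\<lambda>v. of_real (exp (fst x) * fst v))) (at x)"
    using has_derivative_compose[OF has_derivative_fst[OF has_derivative_ident] DERIV_exp[unfolded has_field_derivative_def], of x]
    by (rule has_derivative_of_real)
  have 2: "((\<lambda>x. E (snd x)) has_derivative (\<lambda>v. snd v *\<^sub>R (- \<i> * of_real (\<beta> (snd x)) * E (snd x)))) (at x)"
    using has_derivative_compose[OF has_derivative_snd[OF has_derivative_ident] E_derivative[unfolded has_vector_derivative_def], of x]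
    by simp
  show ?thesis
    unfolding Z_def[abs_def]
    by (rule has_derivative_eq_rhs[OF has_derivative_mult[OF 1 2]])
      (simp add: fun_eq_iff A_def Z_def scaleR_conv_of_real algebra_simps)
qed

lemma X_derivative: "(X has_derivative DX x) (at x)"
proof -
  have "((\<lambda>x. h (Z x)) has_derivative (\<lambda>v. h' (Z x) * (Z x * A x v))) (at x)"
    using has_derivative_compose[OF Z_derivative h[OF Z_in, unfolded has_field_derivative_def]] by simp
  moreover have "((\<lambda>x. \<tau> (snd x)) has_derivative (\<lambda>v. d * r (snd x) * snd v)) (at x)"
    using has_derivative_compose[OF has_derivative_snd[OF has_derivative_ident] \<tau>_derivative[unfolded has_field_derivative_def], of x]
    by simp
  ultimately show ?thesis
    unfolding X_def[abs_def] DX_def[abs_def] mult.assoc by (intro has_derivative_Pair has_derivative_mult_right)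
qed

lemma frechet_X: "frechet_derivative X (at x) = DX x"
  using frechet_derivative_at[OF X_derivative] by simp

lemma DX_derivative:
  "((\<lambda>y. DX y w) has_derivative (\<lambda>v.
      (h'' (Z x) * (Z x * A x v) * (Z x * A x w)
        + h' (Z x) * (Z x * A x v * A x w - Z x * \<i> * of_real ((\<phi> (snd x) * (r (snd x))\<^sup>2 - 2 * \<phi> (snd x) * (\<phi>' (snd x))\<^sup>2 * (r (snd x))^4) * snd v * snd w)),
       \<sigma> * (d * (- \<phi> (snd x) * \<phi>' (snd x) * (r (snd x))^3)) * snd v * snd w))) (at x)"
proof -
  let ?b = "\<phi> (snd x) * (r (snd x))\<^sup>2 - 2 * \<phi> (snd x) * (\<phi>' (snd x))\<^sup>2 * (r (snd x))^4"
  have 1: "((\<lambda>y. h' (Z y)) has_derivative (\<lambda>v. h'' (Z x) * (Z x * A x v))) (at x)"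
    using has_derivative_compose[OF Z_derivative h'[OF Z_in, unfolded has_field_derivative_def]] by simp
  have "((\<lambda>y. \<beta> (snd y)) has_derivative (\<lambda>v. ?b * snd v)) (at x)"
    using has_derivative_compose[OF has_derivative_snd[OF has_derivative_ident] \<beta>_derivative[unfolded has_field_derivative_def], of x]
    by simp
  from has_derivative_diff[OF has_derivative_const has_derivative_mult_right[OF has_derivative_of_real[OF has_derivative_mult_left[OF this]]]]
  have 2: "((\<lambda>y. A y w) has_derivative (\<lambda>v. - (\<i> * of_real (?b * snd v * snd w)))) (at x)"
    unfolding A_def by simp
  have 3: "((\<lambda>y. r (snd y)) has_derivative (\<lambda>v. - \<phi> (snd x) * \<phi>' (snd x) * (r (snd x))^3 * snd v)) (at x)"
    using has_derivative_compose[OF has_derivative_snd[OF has_derivative_ident] r_derivative[unfolded has_field_derivative_def], of x]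
    by simp
  show ?thesis
    unfolding DX_def
    by (rule has_derivative_eq_rhs[OF has_derivative_Pair[OF has_derivative_mult[OF 1 has_derivative_mult[OF Z_derivative 2]]
          has_derivative_mult_left[OF has_derivative_mult_right[OF has_derivative_mult_right[OF 3]]]]])
      (simp add: fun_eq_iff algebra_simps)
qed

end


lemma inner_complex_mult_left: "(c * a) \<bullet> (c * b) = (norm c)\<^sup>2 * (a \<bullet> (b::complex))"
  by (simp add: inner_complex_def cmod_power2) (simp add: power2_eq_square algebra_simps)

context translation_surface
begin

lemma Z_eq: "Z x = of_real (Im (Z x)) * (of_real (\<phi> (snd x)) + \<i>)"
  by (simp add: complex_eq_iff Im_Z Re_Z)

lemma f_X: "f (h (Z x)) = \<phi> (snd x)"
  using r_pos[of "snd x"] by (simp add: f_def k_h[OF Z_in] Im_Z Re_Z)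

text \<open>The factor \<open>1 + \<phi>\<^sup>2\<close> is the square of the hyperbolic cosine of the distance to the geodesic,
  which is the speed of the translations; the other coefficient is \<open>1\<close> because the profile has
  unit speed.\<close>

lemma first_fundamental_form:
  "times_R g (X x) (DX x v) (DX x w) = (1 + (\<phi> (snd x))\<^sup>2) * (fst v * fst w) + snd v * snd w"
proof -
  let ?r = "r (snd x)" and ?p = "\<phi> (snd x)" and ?b = "\<beta> (snd x)"
  have scale: "\<rho> (h (Z x)) * (norm (h' (Z x)))\<^sup>2 * (norm (Z x))\<^sup>2 = 1 + ?p\<^sup>2"
  proof -
    have "exp (fst x) * ?r \<noteq> 0" using r_pos[of "snd x"] by simp
    then have "\<rho> (h (Z x)) * (norm (h' (Z x)))\<^sup>2 * (norm (Z x))\<^sup>2 = (?r\<^sup>2 * (1 + ?p\<^sup>2)) * (norm (Z x))\<^sup>2 / (Im (Z x))\<^sup>2"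
      by (simp add: isometry[OF Z_in] r_squared)
    also have "\<dots> = 1 + ?p\<^sup>2"
      using r_pos[of "snd x"] by (simp add: norm_Z Im_Z power_mult_distrib)
    finally show ?thesis .
  qed
  have A: "A x v \<bullet> A x w = fst v * fst w + ?b\<^sup>2 * (snd v * snd w)"
    by (simp add: A_def inner_complex_def power2_eq_square algebra_simps)
  have "times_R g (X x) (DX x v) (DX x w)
      = (\<rho> (h (Z x)) * (norm (h' (Z x)))\<^sup>2 * (norm (Z x))\<^sup>2) * (A x v \<bullet> A x w) + (\<sigma> * \<sigma>) * (?r\<^sup>2 * d\<^sup>2) * (snd v * snd w)"
    by (simp add: times_R_def metric DX_def X_def inner_complex_mult_left power2_eq_square mult_ac)
  also have "\<dots> = (1 + ?p\<^sup>2) * (fst v * fst w) + (?r\<^sup>2 * d\<^sup>2 + (1 + ?p\<^sup>2) * ?b\<^sup>2) * (snd v * snd w)"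
    unfolding scale A \<sigma> by (simp add: algebra_simps)
  finally show ?thesis unfolding vertical_speed by simp
qed

text \<open>By the transformation law of the connection the chart \<open>h\<close> only enters through the factor \<open>h' Z\<close>,
  so that the computation takes place in the half plane. The polynomial in \<open>\<phi>\<close>, \<open>\<phi>'\<close> and \<open>r\<close> is
  the derivative of \<open>\<beta>\<close>.\<close>

lemma second_fundamental_form_eq:
  "second_fundamental_form (times_R g) X x N v w
    = \<rho> (h (Z x)) * ((h' (Z x) * Z x * (\<i> * (of_real (\<phi> (snd x)) * A x v * A x w
          - of_real ((\<phi> (snd x) * (r (snd x))\<^sup>2 - 2 * \<phi> (snd x) * (\<phi>' (snd x))\<^sup>2 * (r (snd x))^4) * snd v * snd w)))) \<bullet> fst N)
      - \<sigma> * d * (\<phi> (snd x) * \<phi>' (snd x) * (r (snd x))^3) * snd v * snd w * snd N"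
proof -
  let ?b = "\<phi> (snd x) * (r (snd x))\<^sup>2 - 2 * \<phi> (snd x) * (\<phi>' (snd x))\<^sup>2 * (r (snd x))^4"
  let ?D = "h'' (Z x) * (Z x * A x v) * (Z x * A x w) + h' (Z x) * (Z x * A x v * A x w - Z x * \<i> * of_real (?b * snd v * snd w))"
  let ?C = "\<Lambda> (h (Z x)) * (h' (Z x) * (Z x * A x v)) * (h' (Z x) * (Z x * A x w))"
  \<comment> \<open>the \<open>- 1\<close> cancels the second derivative of the exponential in the polar form of \<open>Z\<close>\<close>
  have iZ: "\<i> / of_real (Im (Z x)) * Z x = \<i> * of_real (\<phi> (snd x)) - 1"
    using r_pos[of "snd x"] by (subst (2) Z_eq) (simp add: Im_Z algebra_simps)
  have "?D + ?C = (h'' (Z x) + \<Lambda> (h (Z x)) * (h' (Z x))\<^sup>2) * Z x * Z x * A x v * A x w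
      + h' (Z x) * Z x * (A x v * A x w - \<i> * of_real (?b * snd v * snd w))"
    by (simp add: power2_eq_square algebra_simps)
  also have "\<dots> = h' (Z x) * Z x * ((\<i> / of_real (Im (Z x)) * Z x) * A x v * A x w + A x v * A x w - \<i> * of_real (?b * snd v * snd w))"
    unfolding connection[OF Z_in] by (simp add: algebra_simps)
  also have "\<dots> = h' (Z x) * Z x * (\<i> * (of_real (\<phi> (snd x)) * A x v * A x w - of_real (?b * snd v * snd w)))"
    unfolding iZ by (simp add: algebra_simps)
  finally have DC: "?D + ?C = h' (Z x) * Z x * (\<i> * (of_real (\<phi> (snd x)) * A x v * A x w - of_real (?b * snd v * snd w)))" .
  have "second_fundamental_form (times_R g) X x N v w
    = \<rho> (h (Z x)) * ((?D + ?C) \<bullet> fst N) - \<sigma> * d * (\<phi> (snd x) * \<phi>' (snd x) * (r (snd x))^3) * snd v * snd w * snd N"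
    unfolding second_fundamental_form_def frechet_X frechet_derivative_at[OF DX_derivative, symmetric]
    by (subst christoffel_times_R)
      (simp_all add: X_def h_in[OF Z_in] DX_def times_R_def metric inner_add_left distrib_left mult_ac)
  then show ?thesis unfolding DC .
qed

text \<open>In the orthogonal frame of the chart the trace of the covariant second derivative of \<open>X\<close> is
  \<open>- \<phi> \<phi>' / (1 + \<phi>\<^sup>2)\<close> times the tangent vector \<open>\<partial>\<^sub>w X\<close>, so it has no normal component.\<close>

lemma mean_curvature_zero:
  assumes N: "times_R g (X x) N (DX x (0, 1)) = 0"
  shows "mean_curvature (times_R g) X x N = 0"
proof -
  let ?p = "\<phi> (snd x)" and ?p' = "\<phi>' (snd x)" and ?r = "r (snd x)" and ?b = "\<beta> (snd x)"
  let ?b' = "?p * ?r\<^sup>2 - 2 * ?p * ?p'\<^sup>2 * ?r^4" and ?c = "h' (Z x) * Z x" and ?R = "\<rho> (h (Z x))"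
  have rr: "?r\<^sup>2 * (1 + ?p\<^sup>2) = 1" by (rule r_squared)
  have real_factor: "(?c * (\<i> * of_real s)) \<bullet> u = s * ((?c * \<i>) \<bullet> u)" for s u
    by (simp add: inner_complex_def algebra_simps)
  have II11: "second_fundamental_form (times_R g) X x N (1, 0) (1, 0) = ?R * (?p * ((?c * \<i>) \<bullet> fst N))"
    using real_factor[of ?p] by (simp add: second_fundamental_form_eq A_def)
  have "of_real ?p * A x (0, 1) * A x (0, 1) - of_real (?b' * snd (0::real, 1::real) * snd (0::real, 1::real)) = (of_real (- (?p * ?b\<^sup>2 + ?b')) :: complex)"
    by (simp add: A_def complex_eq_iff power2_eq_square)
  then have II22: "second_fundamental_form (times_R g) X x N (0, 1) (0, 1)
      = ?R * (- (?p * ?b\<^sup>2 + ?b') * ((?c * \<i>) \<bullet> fst N)) - \<sigma> * d * (?p * ?p' * ?r^3) * snd N"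
    unfolding second_fundamental_form_eq real_factor by (simp only: real_factor) simp
  have coeff: "?p - (1 + ?p\<^sup>2) * (?p * ?b\<^sup>2 + ?b') = ?p * ?p' * ?b"
  proof -
    have "?p - (1 + ?p\<^sup>2) * (?p * ?b\<^sup>2 + ?b')
      = ?p - (?r\<^sup>2 * (1 + ?p\<^sup>2)) * (?p * ?p'\<^sup>2 * ?r\<^sup>2 + ?p - 2 * ?p * ?p'\<^sup>2 * ?r\<^sup>2)"
      by (simp add: \<beta>_def power2_eq_square power4_eq_xxxx algebra_simps)
    then show ?thesis by (simp only: rr) (simp add: \<beta>_def power2_eq_square)
  qed
  have N': "?R * (- ?b * ((?c * \<i>) \<bullet> fst N)) + \<sigma> * d * ?r * snd N = 0"
  proof -
    have "times_R g (X x) N (DX x (0, 1)) = ?R * ((?c * (\<i> * of_real (- ?b))) \<bullet> fst N) + \<sigma> * d * ?r * snd N"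
      by (simp add: times_R_def metric DX_def X_def A_def inner_commute mult_ac)
    then show ?thesis using N unfolding real_factor by simp
  qed
  have r3: "(1 + ?p\<^sup>2) * ?r^3 = ?r"
    using arg_cong[OF rr, of "\<lambda>y. ?r * y"] by (simp add: power2_eq_square power3_eq_cube algebra_simps)
  have "second_fundamental_form (times_R g) X x N (1, 0) (1, 0) * 1 + second_fundamental_form (times_R g) X x N (0, 1) (0, 1) * (1 + ?p\<^sup>2)
      = ?R * ((?p - (1 + ?p\<^sup>2) * (?p * ?b\<^sup>2 + ?b')) * ((?c * \<i>) \<bullet> fst N)) - \<sigma> * d * (?p * ?p' * ((1 + ?p\<^sup>2) * ?r^3)) * snd N"
    unfolding II11 II22 by (simp add: algebra_simps)
  also have "\<dots> = - (?p * ?p') * (?R * (- ?b * ((?c * \<i>) \<bullet> fst N)) + \<sigma> * d * ?r * snd N)"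
    unfolding coeff r3 by (simp add: algebra_simps)
  finally show ?thesis
    unfolding mean_curvature_def Let_def frechet_X first_fundamental_form N' by simp
qed

lemma smooth_Z: "smooth_on UNIV Z"
proof -
  have 1: "smooth_on UNIV (\<lambda>x::real \<times> real. exp (fst x))"
    by (rule smooth_on_compose[OF open_UNIV open_UNIV smooth_on_exp smooth_on_bounded_linear[OF bounded_linear_fst]]) simp
  have 2: "smooth_on UNIV (\<lambda>x::real \<times> real. F (snd x))" if "smooth_on UNIV F" for F :: "real \<Rightarrow> real"
    by (rule smooth_on_compose[OF open_UNIV open_UNIV that smooth_on_bounded_linear[OF bounded_linear_snd]]) simp
  show ?thesis unfolding Z_def[abs_def] E_def
    by (intro smooth_on_mult smooth_on_add smooth_on_const open_UNIV 1 2[OF smooth_r] 2[OF smooth_\<phi>]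
        smooth_on_bounded_linear_compose[OF bounded_linear_of_real])
qed

lemma smooth_X: "smooth_on UNIV X"
  unfolding X_def[abs_def]
  by (intro smooth_on_Pair open_UNIV smooth_on_compose[OF open_UNIV half_plane.open_domain smooth_h smooth_Z]
      smooth_on_mult smooth_on_const smooth_on_compose[OF open_UNIV open_UNIV smooth_\<tau> smooth_on_bounded_linear[OF bounded_linear_snd]])
    (use Z_in in auto)

lemma DX_injective: "inj (DX x)"
proof -
  have "linear (DX x)" using X_derivative by (rule has_derivative_linear)
  moreover have "v = 0" if "DX x v = 0" for v
  proof -
    have "times_R g (X x) (DX x v) (DX x v) = 0" using that by (simp add: times_R_def metric)
    then have "(1 + (\<phi> (snd x))\<^sup>2) * (fst v * fst v) + snd v * snd v = 0" by (simp add: first_fundamental_form)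
    moreover have "(1 + (\<phi> (snd x))\<^sup>2) * (fst v * fst v) \<ge> 0" by (simp add: add_nonneg_nonneg)
    moreover have "1 + (\<phi> (snd x))\<^sup>2 > 0" by (simp add: add_pos_nonneg)
    ultimately show "v = 0"
      by (simp add: prod_eq_iff add_nonneg_eq_0_iff)
  qed
  ultimately show ?thesis by (simp add: linear_injective_0)
qed

text \<open>The parameters are recovered from a point as the logarithm of \<open>\<bar>\<zeta>\<bar>\<close> and the profile parameter
  with the given height.\<close>

lemma chart_homeomorphism:
  obtains Y where "homeomorphism UNIV M X Y"
proof -
  obtain T where T: "\<And>w. T (\<tau> w) = w" "continuous_on (range \<tau>) T" using inverse_\<tau> by metis
  define Y where "Y p = (ln (norm (k (fst p))), T (\<sigma> * snd p))" for p
  have X_M: "X x \<in> M" for x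
    using h_in[OF Z_in] f_X \<sigma> by (auto simp: M_def X_def mult.assoc[symmetric])
  have Y_X: "Y (X x) = x" for x
    using \<sigma> by (simp add: Y_def X_def k_h[OF Z_in] norm_Z mult.assoc[symmetric] T(1))
  have X_Y: "X (Y p) = p" if pM: "p \<in> M" for p
  proof -
    obtain w where p: "fst p \<in> S" "f (fst p) = \<phi> w" "\<sigma> * snd p = \<tau> w"
      using pM by (auto simp: M_def)
    let ?\<zeta> = "k (fst p)"
    have Im: "Im ?\<zeta> > 0" using k_in[OF p(1)] by (simp add: half_plane_def)
    have \<zeta>: "?\<zeta> = of_real (Im ?\<zeta>) * (of_real (\<phi> w) + \<i>)"
      using p(2) Im by (simp add: complex_eq_iff f_def field_simps)
    have "norm (of_real (r w) * (of_real (\<phi> w) + \<i>)) = 1" using norm_E[of w] by (simp add: E_def)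
    then have "r w * norm (of_real (\<phi> w) + \<i>) = 1" using r_pos[of w] by (simp add: norm_mult)
    moreover have "norm ?\<zeta> = Im ?\<zeta> * norm (of_real (\<phi> w) + \<i>)"
      using Im by (subst \<zeta>) (simp add: norm_mult)
    ultimately have "norm ?\<zeta> * r w = Im ?\<zeta>" by (simp add: mult_ac)
    moreover have "of_real (norm ?\<zeta>) * E w = of_real (norm ?\<zeta> * r w) * (of_real (\<phi> w) + \<i>)"
      by (simp add: E_def)
    ultimately have "of_real (norm ?\<zeta>) * E w = ?\<zeta>" using \<zeta> by simp
    moreover have "norm ?\<zeta> > 0" using Im by auto
    ultimately have "Z (Y p) = ?\<zeta>" by (simp add: Z_def Y_def p(3) T(1))
    moreover have "\<sigma> * \<tau> (snd (Y p)) = snd p"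
    proof -
      have "\<sigma> * \<tau> (snd (Y p)) = \<sigma> * (\<sigma> * snd p)" by (simp only: Y_def snd_conv p(3) T(1))
      then show ?thesis by (simp add: mult.assoc[symmetric] \<sigma>)
    qed
    ultimately show "X (Y p) = p" by (simp add: X_def h_k[OF p(1)])
  qed
  have "continuous_on M Y"
    unfolding Y_def
  proof (intro continuous_on_Pair)
    have c: "continuous_on M (\<lambda>p. k (fst p))"
      by (rule continuous_on_compose2[OF continuous_k continuous_on_fst[OF continuous_on_id]]) (auto simp: M_def)
    show "continuous_on M (\<lambda>p. ln (norm (k (fst p))))"
    proof (rule continuous_on_ln[OF continuous_on_norm[OF c]], rule ballI)
      fix p assume "p \<in> M"
      then have "Im (k (fst p)) > 0" using k_in by (force simp: M_def half_plane_def)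
      then show "norm (k (fst p)) \<noteq> 0" by auto
    qed
    show "continuous_on M (\<lambda>p. T (\<sigma> * snd p))"
      by (rule continuous_on_compose2[OF T(2)]) (auto simp: M_def intro!: continuous_intros)
  qed
  moreover have "continuous_on UNIV X" by (rule smooth_on_imp_continuous_on[OF smooth_X])
  moreover have "X ` UNIV = M"
  proof (intro equalityI subsetI)
    fix p assume "p \<in> M"
    then show "p \<in> range X" using X_Y[of p] rangeI[of X "Y p"] by simp
  qed (use X_M in auto)
  moreover have "Y ` M = UNIV"
  proof (intro equalityI subsetI)
    fix x show "x \<in> Y ` M" using imageI[OF X_M[of x], of Y] by (simp add: Y_X)
  qed simp
  ultimately have "homeomorphism UNIV M X Y" using X_Y Y_X by (simp add: homeomorphism_def)
  then show ?thesis by (rule that)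
qed

lemma range_X: "range X = M"
  using chart_homeomorphism by (metis homeomorphism_image1)

lemma local_parametrization_X: "local_parametrization M p UNIV X"
proof -
  obtain Y where "homeomorphism UNIV M X Y" by (rule chart_homeomorphism)
  then have "\<exists>V Y. open V \<and> p \<in> V \<and> homeomorphism UNIV (M \<inter> V) X Y"
    by (intro exI[of _ UNIV] exI[of _ Y]) auto
  then show ?thesis unfolding local_parametrization_def
    using smooth_X DX_injective by (simp add: frechet_X)
qed

theorem embedded: "embedded_surface (S \<times> UNIV) M"
proof -
  have "connected (range X)"
    by (intro connected_continuous_image smooth_on_imp_continuous_on[OF smooth_X] convex_connected convex_UNIV)
  moreover have "M \<subseteq> S \<times> UNIV" by (auto simp: M_def)
  moreover have "M \<noteq> {}" using range_X by (metis UNIV_not_empty image_is_empty)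
  ultimately show ?thesis
    unfolding embedded_surface_def
    by (intro conjI ballI exI, simp_all only: range_X) (rule local_parametrization_X)
qed

theorem minimal: "minimal_surface (S \<times> UNIV) (times_R g) M"
  unfolding minimal_surface_def
proof (intro conjI ballI)
  fix p assume "p \<in> M"
  show "\<exists>U X. local_parametrization M p U X \<and>
        (\<forall>x\<in>U. \<forall>N. times_R g (X x) N N = 1 \<and> (\<forall>v. times_R g (X x) N (frechet_derivative X (at x) v) = 0)
                \<longrightarrow> mean_curvature (times_R g) X x N = 0)"
    using local_parametrization_X mean_curvature_zero by (intro exI[of _ UNIV] exI[of _ X]) (simp add: frechet_X)
qed (rule embedded)

text \<open>The surface is the preimage of the closed profile under a continuous map.\<close>

theorem properly_embedded: "properly_embedded_surface (S \<times> UNIV) M"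
  unfolding properly_embedded_surface_def
proof (intro conjI allI impI)
  fix K :: "(complex \<times> real) set" assume K: "compact K \<and> K \<subseteq> S \<times> UNIV"
  let ?P = "\<lambda>p. (f (fst p), \<sigma> * snd p)"
  have "continuous_on K ?P"
    using K by (intro continuous_on_Pair continuous_on_mult continuous_on_const continuous_on_snd continuous_on_id
        continuous_on_compose2[OF continuous_f continuous_on_fst[OF continuous_on_id]]) auto
  then have "closed (K \<inter> ?P -` range (\<lambda>w. (\<phi> w, \<tau> w)))"
    using K by (intro continuous_closed_preimage[OF _ compact_imp_closed closed_profile]) auto
  then have "compact (K \<inter> (K \<inter> ?P -` range (\<lambda>w. (\<phi> w, \<tau> w))))"
    using K by (intro compact_Int_closed) auto
  also have "K \<inter> (K \<inter> ?P -` range (\<lambda>w. (\<phi> w, \<tau> w))) = M \<inter> K"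
    using K by (auto simp: M_def)
  finally show "compact (M \<inter> K)" .
qed (rule embedded)

text \<open>The intrinsic distance is continuous for the topology of the ambient space: the image under the
  chart of the segment between the parameters is a path in \<open>M\<close>, and its speed is bounded by the
  first fundamental form as long as \<open>w\<close> stays in a compact interval.\<close>

theorem path_dist_tendsto_zero:
  assumes p: "\<And>n. p n \<in> M" "l \<in> M" "p \<longlonglongrightarrow> l"
  shows "(\<lambda>n. path_dist (times_R g) M (p n) l) \<longlonglongrightarrow> 0"
proof -
  obtain Y where Y: "homeomorphism UNIV M X Y" by (rule chart_homeomorphism)
  have XY: "X (Y q) = q" if "q \<in> M" for q using Y that by (auto simp: homeomorphism_def)
  have "continuous_on M Y" using Y by (simp add: homeomorphism_def)
  then have lim: "(\<lambda>n. Y (p n)) \<longlonglongrightarrow> Y l"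
    using p by (intro continuous_on_tendsto_compose[of M Y]) auto
  let ?I = "{snd (Y l) - 1..snd (Y l) + 1}"
  have "bounded ((\<lambda>w. sqrt (1 + (\<phi> w)\<^sup>2)) ` ?I)"
    by (intro compact_imp_bounded compact_continuous_image continuous_intros
        continuous_on_subset[OF smooth_on_imp_continuous_on[OF smooth_\<phi>]]) auto
  then obtain K where K: "\<And>w. w \<in> ?I \<Longrightarrow> \<bar>sqrt (1 + (\<phi> w)\<^sup>2)\<bar> \<le> K"
    unfolding bounded_iff by (metis imageI real_norm_def)
  define B where "B n = K * \<bar>fst (Y l) - fst (Y (p n))\<bar> + \<bar>snd (Y l) - snd (Y (p n))\<bar>" for n
  have le: "path_dist (times_R g) M (p n) l \<le> ennreal (B n)" if close: "\<bar>snd (Y (p n)) - snd (Y l)\<bar> < 1" for n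
  proof -
    let ?L = "linepath (Y (p n)) (Y l)" and ?v = "Y l - Y (p n)"
    have vd: "((\<lambda>s. X (?L s)) has_vector_derivative DX (?L s) ?v) (at s)" for s
    proof -
      have "((\<lambda>s. X (?L s)) has_derivative (\<lambda>t. DX (?L s) (t *\<^sub>R ?v))) (at s)"
        using has_derivative_compose[OF has_vector_derivative_linepath_within[unfolded has_vector_derivative_def] X_derivative] .
      moreover have "linear (DX (?L s))" using X_derivative by (rule has_derivative_linear)
      ultimately show ?thesis unfolding has_vector_derivative_def by (simp add: linear_cmul)
    qed
    have "path_dist (times_R g) M (X (?L 0)) (X (?L 1)) \<le> ennreal (B n)"
    proof (rule path_dist_le)
      have "continuous_on UNIV (\<lambda>x. DX x ?v)"
        using smooth_on_imp_continuous_on[OF smooth_on_frechet_derivative[OF smooth_X]] unfolding frechet_X .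
      then have "continuous_on {0..1} (\<lambda>s. DX (?L s) ?v)"
        by (rule continuous_on_compose2) (auto intro: continuous_on_linepath)
      then show "(\<lambda>s. X (?L s)) C1_differentiable_on {0..1}"
        unfolding C1_differentiable_on_def using vd by (intro exI[of _ "\<lambda>s. DX (?L s) ?v"]) simp
      show "(\<lambda>s. X (?L s)) ` {0..1} \<subseteq> M" using range_X by auto
      fix s :: real assume s: "s \<in> {0..1}"
      have "snd (?L s) \<in> closed_segment (snd (Y (p n))) (snd (Y l))"
        using s by (auto simp: closed_segment_def linepath_def)
      then have "snd (?L s) \<in> ?I" using close by (auto simp: closed_segment_eq_real_ivl split: if_splits)
      note k = K[OF this]
      have "sqrt (times_R g (X (?L s)) (DX (?L s) ?v) (DX (?L s) ?v))
         = sqrt ((sqrt (1 + (\<phi> (snd (?L s)))\<^sup>2) * fst ?v)\<^sup>2 + (snd ?v)\<^sup>2)"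
        by (simp add: first_fundamental_form power_mult_distrib power2_eq_square)
      also have "\<dots> \<le> \<bar>sqrt (1 + (\<phi> (snd (?L s)))\<^sup>2) * fst ?v\<bar> + \<bar>snd ?v\<bar>" by (rule sqrt_sum_squares_le_sum_abs)
      also have "\<dots> \<le> B n" unfolding B_def abs_mult by (intro add_mono mult_mono k) (use order_trans[OF abs_ge_zero k] in auto)
      finally show "sqrt (times_R g (X (?L s)) (vector_derivative (\<lambda>s. X (?L s)) (at s))
          (vector_derivative (\<lambda>s. X (?L s)) (at s))) \<le> B n"
        using vector_derivative_at[OF vd] by simp
    qed
    then show ?thesis using XY p by (simp add: linepath_def)
  qed
  have "(\<lambda>n. \<bar>snd (Y (p n)) - snd (Y l)\<bar>) \<longlonglongrightarrow> \<bar>snd (Y l) - snd (Y l)\<bar>"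
    using lim by (intro tendsto_intros)
  then have "eventually (\<lambda>n. \<bar>snd (Y (p n)) - snd (Y l)\<bar> < 1) sequentially"
    by (rule order_tendstoD) simp
  then have ev: "eventually (\<lambda>n. path_dist (times_R g) M (p n) l \<le> ennreal (B n)) sequentially"
    by (rule eventually_mono) (rule le)
  have "B \<longlonglongrightarrow> K * \<bar>fst (Y l) - fst (Y l)\<bar> + \<bar>snd (Y l) - snd (Y l)\<bar>"
    unfolding B_def[abs_def] using lim by (intro tendsto_intros)
  then have "(\<lambda>n. ennreal (B n)) \<longlonglongrightarrow> ennreal 0" by (intro tendsto_ennrealI) simp
  then show ?thesis
    by (intro tendsto_sandwich[OF _ ev tendsto_const]) auto
qed

end


section \<open>The disk model adapted to two ideal points\<close>

interpretation half_plane: half_plane_chart half_plane half_plane_metric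
  "\<lambda>z. 1 / (Im z)\<^sup>2" "\<lambda>z. \<i> / of_real (Im z)" "\<lambda>z. z" "\<lambda>z. 1" "\<lambda>z. 0" "\<lambda>z. z"
  by unfold_locales (auto intro!: smooth_on_id continuous_on_id derivative_eq_intros)

text \<open>A pair of ideal points is described by the midpoint \<open>m\<close> of the arc \<open>c1\<close> and half its opening
  angle \<open>\<alpha>\<close>; the points are \<open>m (cnj \<eta>)\<close> and \<open>m \<eta>\<close>. The Moebius transformation \<open>h\<close> maps the half
  plane onto the disk and sends \<open>0\<close>, \<open>1\<close>, \<open>\<infinity>\<close> to \<open>q1\<close>, \<open>m\<close>, \<open>q2\<close>; so \<open>c1\<close> corresponds to the
  nonnegative reals together with \<open>\<infinity>\<close>.\<close>

locale ideal_pair =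
  fixes m :: complex and \<alpha> :: real
  assumes norm_m: "norm m = 1" and \<alpha>: "0 < \<alpha>" "\<alpha> < pi"
begin

definition \<eta> where "\<eta> = cis \<alpha>"

definition h where "h \<zeta> = m * (\<eta> * \<zeta> + 1) / (\<zeta> + \<eta>)"
definition h' where "h' \<zeta> = m * (\<eta>\<^sup>2 - 1) / (\<zeta> + \<eta>)\<^sup>2"
definition h'' where "h'' \<zeta> = - 2 * (m * (\<eta>\<^sup>2 - 1)) / (\<zeta> + \<eta>)^3"
definition k where "k z = (m - \<eta> * z) / (z - m * \<eta>)"

lemma m_nonzero: "m \<noteq> 0" using norm_m by auto

lemma Im_\<eta>: "Im \<eta> > 0" using \<alpha> by (simp add: \<eta>_def sin_gt_zero)

lemma norm_\<eta>: "norm \<eta> = 1" by (simp add: \<eta>_def)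

lemma \<eta>_cnj: "\<eta> * cnj \<eta> = 1" by (simp add: \<eta>_def cis_cnj cis_mult)

lemma \<eta>_squared: "\<eta>\<^sup>2 - 1 = 2 * \<i> * of_real (Im \<eta>) * \<eta>"
proof -
  have "\<eta> - cnj \<eta> = 2 * \<i> * of_real (Im \<eta>)" by (simp add: complex_eq_iff)
  then have "(\<eta> - cnj \<eta>) * \<eta> = 2 * \<i> * of_real (Im \<eta>) * \<eta>" by simp
  then show ?thesis using \<eta>_cnj by (simp add: power2_eq_square algebra_simps)
qed

lemma \<eta>_squared_nonzero: "\<eta>\<^sup>2 - 1 \<noteq> 0"
  using Im_\<eta> norm_\<eta> by (auto simp: \<eta>_squared)

lemma denominator_nonzero: "Im \<zeta> \<ge> 0 \<Longrightarrow> \<zeta> + \<eta> \<noteq> 0"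
proof
  assume "Im \<zeta> \<ge> 0" "\<zeta> + \<eta> = 0"
  then have "Im (\<zeta> + \<eta>) = 0" "Im \<zeta> + Im \<eta> > 0" using Im_\<eta> by auto
  then show False by simp
qed

lemma k_h: assumes "\<zeta> + \<eta> \<noteq> 0" shows "h \<zeta> \<noteq> m * \<eta>" "k (h \<zeta>) = \<zeta>"
proof -
  have 1: "h \<zeta> - m * \<eta> = m * (1 - \<eta>\<^sup>2) / (\<zeta> + \<eta>)"
    using assms by (simp add: h_def field_simps power2_eq_square)
  have 2: "m - \<eta> * h \<zeta> = \<zeta> * (m * (1 - \<eta>\<^sup>2) / (\<zeta> + \<eta>))"
    using assms by (simp add: h_def field_simps power2_eq_square)
  have nz: "m * (1 - \<eta>\<^sup>2) / (\<zeta> + \<eta>) \<noteq> 0" using assms m_nonzero \<eta>_squared_nonzero by simp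
  show "h \<zeta> \<noteq> m * \<eta>" using 1 nz by auto
  show "k (h \<zeta>) = \<zeta>" unfolding k_def 1 2 using nz by simp
qed

lemma h_k: assumes "z \<noteq> m * \<eta>" shows "k z + \<eta> \<noteq> 0" "h (k z) = z"
proof -
  have d: "z - m * \<eta> \<noteq> 0" using assms by simp
  have 1: "k z + \<eta> = m * (1 - \<eta>\<^sup>2) / (z - m * \<eta>)"
    using d by (simp add: k_def field_simps power2_eq_square)
  have 2: "m * (\<eta> * k z + 1) = z * (m * (1 - \<eta>\<^sup>2) / (z - m * \<eta>))"
    using d by (simp add: k_def field_simps power2_eq_square)
  have nz: "m * (1 - \<eta>\<^sup>2) / (z - m * \<eta>) \<noteq> 0" using d m_nonzero \<eta>_squared_nonzero by simp
  show "k z + \<eta> \<noteq> 0" using 1 nz by auto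
  show "h (k z) = z" unfolding h_def 1 2 using nz by simp
qed

text \<open>The pullback of the defining function of the circle; it yields both that \<open>h\<close> maps into the disk
  and that \<open>h\<close> is an isometry.\<close>

lemma one_minus_norm_h:
  assumes "\<zeta> + \<eta> \<noteq> 0"
  shows "1 - (norm (h \<zeta>))\<^sup>2 = 4 * Im \<eta> * Im \<zeta> / (norm (\<zeta> + \<eta>))\<^sup>2"
proof -
  have "(Re \<eta>)\<^sup>2 + (Im \<eta>)\<^sup>2 = 1" using norm_\<eta> by (simp add: cmod_def)
  moreover have "(norm (\<zeta> + \<eta>))\<^sup>2 - (norm (\<eta> * \<zeta> + 1))\<^sup>2
     = 4 * Im \<eta> * Im \<zeta> + (1 - ((Re \<eta>)\<^sup>2 + (Im \<eta>)\<^sup>2)) * ((norm \<zeta>)\<^sup>2 - 1)"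
    by (simp add: cmod_power2) (simp add: power2_eq_square algebra_simps)
  ultimately have "(norm (\<zeta> + \<eta>))\<^sup>2 - (norm (\<eta> * \<zeta> + 1))\<^sup>2 = 4 * Im \<eta> * Im \<zeta>" by simp
  then show ?thesis using assms norm_m
    by (simp add: h_def norm_mult norm_divide power_divide diff_divide_eq_iff)
qed

lemma h_in_disk: "\<zeta> \<in> half_plane \<Longrightarrow> h \<zeta> \<in> disk"
proof -
  assume "\<zeta> \<in> half_plane"
  then have "Im \<zeta> > 0" "\<zeta> + \<eta> \<noteq> 0" using denominator_nonzero[of \<zeta>] by (auto simp: half_plane_def)
  then have "1 - (norm (h \<zeta>))\<^sup>2 > 0" using one_minus_norm_h[of \<zeta>] Im_\<eta> by simp
  then show ?thesis by (simp add: disk_iff)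
qed

lemma disk_nonideal: "z \<in> disk \<Longrightarrow> z \<noteq> m * \<eta>"
  using norm_m norm_\<eta> by (auto simp: disk_iff norm_mult)

lemma Im_k:
  assumes "z \<noteq> m * \<eta>" shows "4 * Im \<eta> * Im (k z) = (1 - (norm z)\<^sup>2) * (norm (k z + \<eta>))\<^sup>2"
  using one_minus_norm_h[OF h_k(1)[OF assms]] h_k[OF assms] by (simp add: field_simps)

lemma k_in_half_plane: "z \<in> disk \<Longrightarrow> k z \<in> half_plane"
proof -
  assume z: "z \<in> disk"
  then have "(1 - (norm z)\<^sup>2) * (norm (k z + \<eta>))\<^sup>2 > 0"
    using h_k(1)[OF disk_nonideal[OF z]] by (simp add: disk_iff)
  then have "4 * Im \<eta> * Im (k z) > 0" by (simp only: Im_k[OF disk_nonideal[OF z]])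
  then show ?thesis using Im_\<eta> by (simp add: half_plane_def zero_less_mult_iff)
qed

lemma h_derivative: "\<zeta> + \<eta> \<noteq> 0 \<Longrightarrow> (h has_field_derivative h' \<zeta>) (at \<zeta>)"
  unfolding h_def[abs_def] h'_def
  by (rule DERIV_cong, (rule DERIV_divide DERIV_cmult DERIV_add DERIV_const DERIV_ident | assumption)+)
    (simp add: power2_eq_square field_simps)

lemma h'_derivative:
  assumes nz: "\<zeta> + \<eta> \<noteq> 0" shows "(h' has_field_derivative h'' \<zeta>) (at \<zeta>)"
proof -
  have "((\<lambda>\<zeta>. (\<zeta> + \<eta>)\<^sup>2) has_field_derivative 2 * (\<zeta> + \<eta>)) (at \<zeta>)"
    by (auto intro!: derivative_eq_intros)
  from DERIV_divide[OF DERIV_const this, of "m * (\<eta>\<^sup>2 - 1)"] nz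
  have "(h' has_field_derivative (0 * (\<zeta> + \<eta>)\<^sup>2 - m * (\<eta>\<^sup>2 - 1) * (2 * (\<zeta> + \<eta>))) / ((\<zeta> + \<eta>)\<^sup>2 * (\<zeta> + \<eta>)\<^sup>2)) (at \<zeta>)"
    by (simp add: h'_def[abs_def])
  then show ?thesis
  proof (rule DERIV_cong)
    have "(0 * D\<^sup>2 - a * (2 * D)) / (D\<^sup>2 * D\<^sup>2) = - 2 * a / D^3" if "D \<noteq> 0" for a D :: complex
      using that by (simp add: field_simps power2_eq_square power3_eq_cube)
    from this[OF nz] show "(0 * (\<zeta> + \<eta>)\<^sup>2 - m * (\<eta>\<^sup>2 - 1) * (2 * (\<zeta> + \<eta>))) / ((\<zeta> + \<eta>)\<^sup>2 * (\<zeta> + \<eta>)\<^sup>2) = h'' \<zeta>"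
      by (simp only: h''_def)
  qed
qed

lemma norm_h': "(norm (h' \<zeta>))\<^sup>2 = 4 * (Im \<eta>)\<^sup>2 / (norm (\<zeta> + \<eta>))^4"
  using norm_m norm_\<eta>
  by (simp add: h'_def \<eta>_squared norm_mult norm_divide norm_power power_divide power_mult_distrib flip: power_mult)

lemma connection_h:
  assumes \<zeta>: "\<zeta> \<in> half_plane"
  shows "h'' \<zeta> + 2 * cnj (h \<zeta>) / of_real (1 - (norm (h \<zeta>))\<^sup>2) * (h' \<zeta>)\<^sup>2 = h' \<zeta> * (\<i> / of_real (Im \<zeta>))"
proof -
  have Im: "Im \<zeta> > 0" using \<zeta> by (simp add: half_plane_def)
  define D where "D = \<zeta> + \<eta>"
  have D: "D \<noteq> 0" using denominator_nonzero[of \<zeta>] Im by (simp add: D_def)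
  have cD: "cnj D \<noteq> 0" using D by simp
  have y: "complex_of_real (Im \<eta>) \<noteq> 0" "complex_of_real (Im \<zeta>) \<noteq> 0" using Im_\<eta> Im by auto
  have mm: "cnj m * m = 1" using norm_m by (simp add: mult.commute flip: complex_norm_square)
  have 1: "of_real (1 - (norm (h \<zeta>))\<^sup>2) = 4 * of_real (Im \<eta>) * of_real (Im \<zeta>) / (D * cnj D)"
    using one_minus_norm_h[of \<zeta>] D complex_norm_square[of D] by (simp add: D_def del: of_real_diff)
  have 2: "cnj (h \<zeta>) = cnj m * (cnj \<eta> * cnj \<zeta> + 1) / cnj D" by (simp add: h_def D_def)
  have 3: "h' \<zeta> = m * (2 * \<i> * of_real (Im \<eta>) * \<eta>) / D\<^sup>2" by (simp add: h'_def D_def \<eta>_squared)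
  have 4: "h'' \<zeta> = - 2 * h' \<zeta> / D" using D by (simp add: h''_def h'_def D_def power2_eq_square power3_eq_cube)
  have "2 * cnj (h \<zeta>) / of_real (1 - (norm (h \<zeta>))\<^sup>2) * h' \<zeta>
     = (cnj m * m) * \<i> * (\<eta> * cnj \<eta> * cnj \<zeta> + \<eta>) / (of_real (Im \<zeta>) * D)"
    unfolding 1 2 3 using y D cD by (simp add: field_simps power2_eq_square)
  also have "\<dots> = \<i> * (cnj \<zeta> + \<eta>) / (of_real (Im \<zeta>) * D)" by (simp add: mm \<eta>_cnj)
  finally have 5: "2 * cnj (h \<zeta>) / of_real (1 - (norm (h \<zeta>))\<^sup>2) * h' \<zeta> = \<i> * (cnj \<zeta> + \<eta>) / (of_real (Im \<zeta>) * D)" .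
  have "- 2 / D + \<i> * (cnj \<zeta> + \<eta>) / (of_real (Im \<zeta>) * D) = (- 2 * of_real (Im \<zeta>) + \<i> * (cnj \<zeta> + \<eta>)) / (of_real (Im \<zeta>) * D)"
    using y D by (simp add: field_simps)
  also have "- 2 * of_real (Im \<zeta>) + \<i> * (cnj \<zeta> + \<eta>) = \<i> * D" by (simp add: D_def complex_eq_iff)
  finally have 6: "- 2 / D + \<i> * (cnj \<zeta> + \<eta>) / (of_real (Im \<zeta>) * D) = \<i> / of_real (Im \<zeta>)" using D by simp
  have "h'' \<zeta> + 2 * cnj (h \<zeta>) / of_real (1 - (norm (h \<zeta>))\<^sup>2) * (h' \<zeta>)\<^sup>2
     = h' \<zeta> * (- 2 / D + 2 * cnj (h \<zeta>) / of_real (1 - (norm (h \<zeta>))\<^sup>2) * h' \<zeta>)"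
    unfolding 4 by (simp add: power2_eq_square algebra_simps)
  then show ?thesis unfolding 5 6 .
qed

lemma smooth_h: "smooth_on half_plane h"
proof -
  have "smooth_on half_plane (\<lambda>\<zeta>. m * (\<eta> * \<zeta> + 1) * inverse (\<zeta> + \<eta>))"
    by (intro smooth_on_mult smooth_on_inverse smooth_on_add smooth_on_const smooth_on_id half_plane.open_domain)
      (auto simp: half_plane_def intro!: denominator_nonzero)
  then show ?thesis by (simp add: h_def[abs_def] divide_inverse)
qed

lemma continuous_k: "continuous_on (- {m * \<eta>}) k"
  unfolding k_def by (intro continuous_intros) auto

sublocale half_plane_chart disk disk_metric
  "\<lambda>z. 4 / (1 - (norm z)\<^sup>2)\<^sup>2" "\<lambda>z. 2 * cnj z / of_real (1 - (norm z)\<^sup>2)" h h' h'' k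
proof unfold_locales
  show "continuous_on disk k"
    by (rule continuous_on_subset[OF continuous_k]) (use disk_nonideal in auto)
  fix \<zeta> assume \<zeta>: "\<zeta> \<in> half_plane"
  then have nz: "\<zeta> + \<eta> \<noteq> 0" and Im: "Im \<zeta> > 0" using denominator_nonzero[of \<zeta>] by (auto simp: half_plane_def)
  show "(h has_field_derivative h' \<zeta>) (at \<zeta>)" "(h' has_field_derivative h'' \<zeta>) (at \<zeta>)" "k (h \<zeta>) = \<zeta>"
    using nz by (rule h_derivative h'_derivative k_h)+
  show "4 / (1 - (norm (h \<zeta>))\<^sup>2)\<^sup>2 * (norm (h' \<zeta>))\<^sup>2 = 1 / (Im \<zeta>)\<^sup>2"
    unfolding one_minus_norm_h[OF nz] norm_h' using nz Im Im_\<eta>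
    by (simp add: power_divide power_mult_distrib flip: power_mult)
qed (use smooth_h h_in_disk k_in_half_plane h_k disk_nonideal connection_h in \<open>simp_all\<close>)

end

section \<open>Geodesics of the disk\<close>

text \<open>For \<open>c = \<plusminus>1\<close> the function \<open>y' + c y\<close> solves a linear equation of first order.\<close>

lemma second_order_linear_solution:
  fixes y y' :: "real \<Rightarrow> 'a::real_normed_vector"
  assumes y: "\<And>s. (y has_vector_derivative y' s) (at s)" "\<And>s. (y' has_vector_derivative y s) (at s)"
  obtains A B where "\<And>s. y s = exp s *\<^sub>R A + exp (- s) *\<^sub>R B"
proof -
  have *: "exp (- c * s) *\<^sub>R (y' s + c *\<^sub>R y s) = y' 0 + c *\<^sub>R y 0" if c: "c * c = 1" for c s
  proof -
    have "((\<lambda>s. exp (- c * s) *\<^sub>R (y' s + c *\<^sub>R y s)) has_vector_derivative 0) (at s within UNIV)" for s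
    proof -
      have e: "((\<lambda>s. exp (- c * s)) has_real_derivative exp (- c * s) * (- c)) (at s)"
        by (auto intro!: derivative_eq_intros)
      have "((\<lambda>s. exp (- c * s) *\<^sub>R (y' s + c *\<^sub>R y s)) has_vector_derivative
          exp (- c * s) *\<^sub>R (y s + c *\<^sub>R y' s) + (exp (- c * s) * (- c)) *\<^sub>R (y' s + c *\<^sub>R y s)) (at s)"
        by (rule has_vector_derivative_scaleR[OF e has_vector_derivative_add[OF y(2)
              bounded_linear.has_vector_derivative[OF bounded_linear_scaleR_right y(1)]]])
      moreover have "exp (- c * s) *\<^sub>R (y s + c *\<^sub>R y' s) + (exp (- c * s) * (- c)) *\<^sub>R (y' s + c *\<^sub>R y s) = 0"
        using c by (simp add: scaleR_add_right mult.assoc)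
      ultimately show ?thesis by simp
    qed
    then obtain C where "\<And>s. exp (- c * s) *\<^sub>R (y' s + c *\<^sub>R y s) = C"
      using has_vector_derivative_zero_constant[of UNIV "\<lambda>s. exp (- c * s) *\<^sub>R (y' s + c *\<^sub>R y s)"] by auto
    from this[of s] this[of 0] show ?thesis by simp
  qed
  have "y s = exp s *\<^sub>R ((1/2) *\<^sub>R (y' 0 + y 0)) + exp (- s) *\<^sub>R ((1/2) *\<^sub>R (y 0 - y' 0))" for s
  proof -
    have "exp s *\<^sub>R (y' 0 + y 0) = y' s + y s"
      using arg_cong[OF *[of 1 s], of "\<lambda>x. exp s *\<^sub>R x"] by (simp add: exp_minus)
    moreover have "exp (- s) *\<^sub>R (y' 0 - y 0) = y' s - y s"
      using arg_cong[OF *[of "-1" s], of "\<lambda>x. exp (- s) *\<^sub>R x"] by (simp add: exp_minus)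
    ultimately have "exp s *\<^sub>R (y' 0 + y 0) + exp (- s) *\<^sub>R (y 0 - y' 0) = 2 *\<^sub>R y s"
      by (simp add: algebra_simps scaleR_2)
    from arg_cong[OF this, of "\<lambda>x. (1/2) *\<^sub>R x"] show ?thesis by (simp add: scaleR_add_right scaleR_left_commute)
  qed
  then show ?thesis by (rule that)
qed


text \<open>The geodesic equation tested against all vectors is a vector equation, since the metric is
  nondegenerate.\<close>

lemma unit_speed_geodesic_disk:
  assumes c: "unit_speed_geodesic disk disk_metric c"
  obtains c' c'' where "\<And>s. (c has_vector_derivative c' s) (at s)" "\<And>s. (c' has_vector_derivative c'' s) (at s)"
    "\<And>s. 4 * (norm (c' s))\<^sup>2 = (1 - (norm (c s))\<^sup>2)\<^sup>2"
    "\<And>s. c'' s = - (2 * cnj (c s) / of_real (1 - (norm (c s))\<^sup>2) * (c' s)\<^sup>2)"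
    "\<And>s. c s \<in> disk"
proof -
  define c' where "c' = (\<lambda>s. vector_derivative c (at s))"
  define c'' where "c'' = (\<lambda>s. vector_derivative c' (at s))"
  have smooth: "smooth_on UNIV c" and disk: "c s \<in> disk"
    and geo: "disk_metric (c s) (c' s) (c' s) = 1"
      "disk_metric (c s) (c'' s) u + christoffel disk_metric (c s) (c' s) (c' s) u = 0" for s u
    using c by (auto simp: unit_speed_geodesic_def Let_def c'_def c''_def)
  have vd: "(y has_vector_derivative vector_derivative y (at s)) (at s)"
    "vector_derivative y (at s) = frechet_derivative y (at s) 1" if "smooth_on UNIV y" for y :: "real \<Rightarrow> complex" and s
  proof -
    have "y differentiable (at s)" using smooth_on_imp_has_derivative[OF that] by (auto simp: differentiable_def)
    then show v: "(y has_vector_derivative vector_derivative y (at s)) (at s)" by (simp add: vector_derivative_works)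
    then show "vector_derivative y (at s) = frechet_derivative y (at s) 1"
      using frechet_derivative_at[of y _ s] unfolding has_vector_derivative_def by force
  qed
  have "c' = (\<lambda>s. frechet_derivative c (at s) 1)" using vd(2)[OF smooth] by (auto simp: c'_def)
  then have smooth': "smooth_on UNIV c'" using smooth_on_frechet_derivative[OF smooth] by simp
  have d: "(norm (c s))\<^sup>2 < 1" for s using disk[of s] by (simp add: disk_iff)
  show ?thesis
  proof (rule that)
    fix s
    show "(c has_vector_derivative c' s) (at s)" "(c' has_vector_derivative c'' s) (at s)"
      using vd(1)[OF smooth] vd(1)[OF smooth'] by (auto simp: c'_def c''_def)
    show "4 * (norm (c' s))\<^sup>2 = (1 - (norm (c s))\<^sup>2)\<^sup>2"
      using geo(1)[of s] d[of s] by (simp add: disk_metric_def power2_norm_eq_inner)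
    show "c s \<in> disk" by (rule disk)
    let ?l = "2 * cnj (c s) / of_real (1 - (norm (c s))\<^sup>2)"
    have "4 / (1 - (norm (c s))\<^sup>2)\<^sup>2 * ((c'' s + ?l * c' s * c' s) \<bullet> u) = 0" for u
      using geo(2)[of s u] unfolding disk.christoffel_eq[OF disk] disk.metric inner_add_left distrib_left .
    then have "(c'' s + ?l * c' s * c' s) \<bullet> u = 0" for u using d[of s] by (simp add: less_imp_neq)
    then have "c'' s + ?l * c' s * c' s = 0" using inner_eq_zero_iff by blast
    then show "c'' s = - (?l * (c' s)\<^sup>2)" by (simp add: power2_eq_square add_eq_0_iff2 mult.assoc)
  qed
qed

text \<open>A point of the disk has the hyperboloid coordinates \<open>F = (1 + \<bar>z\<bar>\<^sup>2) / (1 - \<bar>z\<bar>\<^sup>2)\<close> and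
  \<open>2 z / (1 - \<bar>z\<bar>\<^sup>2)\<close>, on which \<open>F\<^sup>2 - \<bar>2 z / (1 - \<bar>z\<bar>\<^sup>2)\<bar>\<^sup>2 = 1\<close>. Along a unit speed geodesic
  these coordinates satisfy \<open>y'' = y\<close> (a geodesic of the hyperboloid is a plane section), so
  they are combinations of \<open>exp s\<close> and \<open>exp (- s)\<close>. The equation of the hyperboloid makes the
  coefficient vectors lightlike, and their directions \<open>u\<close>, \<open>v\<close> are the two ideal end points.\<close>

lemma disk_geodesic_hyperboloid:
  assumes c: "unit_speed_geodesic disk disk_metric c"
  obtains a b u v where "0 < a" "0 < b" "norm u = 1" "norm v = 1" "2 * a * b * (1 - u \<bullet> v) = 1"
    "\<And>s. c s = (of_real (a * exp s) * u + of_real (b * exp (- s)) * v) / of_real (1 + a * exp s + b * exp (- s))"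
proof -
  obtain c' c'' where c: "\<And>s. (c has_vector_derivative c' s) (at s)" "\<And>s. (c' has_vector_derivative c'' s) (at s)"
    and speed: "\<And>s. 4 * (norm (c' s))\<^sup>2 = (1 - (norm (c s))\<^sup>2)\<^sup>2"
    and geo: "\<And>s. c'' s = - (2 * cnj (c s) / of_real (1 - (norm (c s))\<^sup>2) * (c' s)\<^sup>2)"
    and disk: "\<And>s. c s \<in> disk"
    using unit_speed_geodesic_disk[OF c] by metis
  \<comment> \<open>\<open>2 / \<mu>\<close> is the length factor of the metric, and \<open>- 2 D\<close> is the derivative of \<open>\<mu>\<close>\<close>
  define \<mu> where "\<mu> s = 1 - (norm (c s))\<^sup>2" for s
  define D where "D s = c s \<bullet> c' s" for s
  have \<mu>_pos: "\<mu> s > 0" for s using disk[of s] by (simp add: disk_iff \<mu>_def)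
  have norm2: "(norm (c s))\<^sup>2 = 1 - \<mu> s" for s by (simp add: \<mu>_def)
  have speed': "(norm (c' s))\<^sup>2 = (\<mu> s)\<^sup>2 / 4" for s using speed[of s] by (simp add: \<mu>_def)
  have acc: "c'' s = (\<mu> s / 2) *\<^sub>R c s - (4 * D s / \<mu> s) *\<^sub>R c' s" for s
  proof -
    have eq: "cnj (c s) * (c' s)\<^sup>2 = of_real (2 * D s) * c' s - of_real ((norm (c' s))\<^sup>2) * c s"
      by (simp add: complex_eq_iff D_def inner_complex_def cmod_power2) (simp add: power2_eq_square algebra_simps)
    have "2 * cnj (c s) / of_real (\<mu> s) * (c' s)\<^sup>2 = (cnj (c s) * (c' s)\<^sup>2) * (2 / of_real (\<mu> s))" by simp
    also have "\<dots> = of_real (4 * D s / \<mu> s) * c' s - of_real (2 * (norm (c' s))\<^sup>2 / \<mu> s) * c s"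
      unfolding eq by (simp add: left_diff_distrib diff_divide_distrib mult_ac)
    finally have "2 * cnj (c s) / of_real (\<mu> s) * (c' s)\<^sup>2
      = of_real (4 * D s / \<mu> s) * c' s - of_real (2 * (norm (c' s))\<^sup>2 / \<mu> s) * c s" .
    moreover have "2 * (norm (c' s))\<^sup>2 / \<mu> s = \<mu> s / 2"
      unfolding speed' using \<mu>_pos[of s] by (simp add: power2_eq_square)
    ultimately show ?thesis unfolding geo[of s] \<mu>_def[symmetric] by (simp add: scaleR_conv_of_real)
  qed
  have D': "(D has_real_derivative \<mu> s / 2 * (1 - \<mu> s) + (\<mu> s)\<^sup>2 / 4 - 4 * (D s)\<^sup>2 / \<mu> s) (at s)" for s
  proof -
    let ?T = "\<mu> s / 2 * (1 - \<mu> s) + (\<mu> s)\<^sup>2 / 4 - 4 * (D s)\<^sup>2 / \<mu> s"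
    have D: "(D has_derivative (\<lambda>t. c s \<bullet> (t *\<^sub>R c'' s) + (t *\<^sub>R c' s) \<bullet> c' s)) (at s)"
      unfolding D_def[abs_def] using has_derivative_inner c[unfolded has_vector_derivative_def] by blast
    have "c s \<bullet> c s = 1 - \<mu> s" by (simp add: norm2[symmetric] power2_norm_eq_inner)
    then have cc'': "c s \<bullet> c'' s = \<mu> s / 2 * (1 - \<mu> s) - 4 * (D s)\<^sup>2 / \<mu> s"
      unfolding acc by (simp add: inner_diff_right D_def power2_eq_square)
    have cc': "c' s \<bullet> c' s = (\<mu> s)\<^sup>2 / 4" using speed'[of s] by (simp add: power2_norm_eq_inner)
    have "c s \<bullet> (t *\<^sub>R c'' s) + (t *\<^sub>R c' s) \<bullet> c' s = ?T * t" for t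
      unfolding inner_scaleR_left inner_scaleR_right cc' cc'' by (simp add: algebra_simps)
    then show ?thesis using D by (simp only: has_field_derivative_def)
  qed
  have \<mu>': "(\<mu> has_real_derivative - 2 * D s) (at s)" for s
  proof -
    have "((\<lambda>s. 1 - c s \<bullet> c s) has_derivative (\<lambda>t. 0 - (c s \<bullet> (t *\<^sub>R c' s) + (t *\<^sub>R c' s) \<bullet> c s))) (at s)"
      using has_derivative_diff[OF has_derivative_const has_derivative_inner] c(1)[unfolded has_vector_derivative_def] by blast
    moreover have "0 - (c s \<bullet> (t *\<^sub>R c' s) + (t *\<^sub>R c' s) \<bullet> c s) = (- 2 * D s) * t" for t
      by (simp add: D_def inner_commute)
    ultimately show ?thesis by (simp only: \<mu>_def[abs_def] power2_norm_eq_inner has_field_derivative_def)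
  qed
  define P P' where "P s = 1 / \<mu> s" and "P' s = 2 * D s / (\<mu> s)\<^sup>2" for s
  have dP: "(P has_real_derivative P' s) (at s)" for s
    unfolding P_def[abs_def]
    by (rule DERIV_cong[OF DERIV_divide[OF DERIV_const \<mu>']]) (use \<mu>_pos[of s] in \<open>auto simp: P'_def power2_eq_square\<close>)
  have dP': "(P' has_real_derivative P s - 1/2) (at s)" for s
  proof -
    have "((\<lambda>s. (\<mu> s)\<^sup>2) has_real_derivative 2 * \<mu> s * (- 2 * D s)) (at s)"
      by (rule DERIV_cong[OF DERIV_power[OF \<mu>', of 2]]) simp
    from DERIV_divide[OF DERIV_cmult[OF D', of 2] this] \<mu>_pos[of s]
    have "(P' has_real_derivative (2 * (\<mu> s / 2 * (1 - \<mu> s) + (\<mu> s)\<^sup>2 / 4 - 4 * (D s)\<^sup>2 / \<mu> s) * (\<mu> s)\<^sup>2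
        - 2 * D s * (2 * \<mu> s * (- 2 * D s))) / ((\<mu> s)\<^sup>2 * (\<mu> s)\<^sup>2)) (at s)"
      by (simp add: P'_def[abs_def])
    moreover have "(2 * (\<mu> s / 2 * (1 - \<mu> s) + (\<mu> s)\<^sup>2 / 4 - 4 * (D s)\<^sup>2 / \<mu> s) * (\<mu> s)\<^sup>2
        - 2 * D s * (2 * \<mu> s * (- 2 * D s))) / ((\<mu> s)\<^sup>2 * (\<mu> s)\<^sup>2) = P s - 1/2"
      using \<mu>_pos[of s] by (simp add: P_def field_simps power2_eq_square)
    ultimately show ?thesis by simp
  qed
  define F F' where "F s = 2 * P s - 1" and "F' s = 2 * P' s" for s
  have "(F has_vector_derivative F' s) (at s)" "(F' has_vector_derivative F s) (at s)" for s
    unfolding F_def[abs_def] F'_def[abs_def] has_real_derivative_iff_has_vector_derivative[symmetric]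
    by (rule DERIV_cong[OF DERIV_diff[OF DERIV_cmult[OF dP] DERIV_const]] DERIV_cong[OF DERIV_cmult[OF dP']]; simp)+
  then obtain a b where F: "\<And>s. F s = exp s *\<^sub>R a + exp (- s) *\<^sub>R b"
    using second_order_linear_solution[of F F'] by metis
  define Q Q' where "Q s = P s *\<^sub>R c s" and "Q' s = P s *\<^sub>R c' s + P' s *\<^sub>R c s" for s
  have "(Q has_vector_derivative Q' s) (at s)" for s
    unfolding Q_def[abs_def] Q'_def by (rule has_vector_derivative_scaleR[OF dP c(1)])
  moreover have "(Q' has_vector_derivative Q s) (at s)" for s
  proof -
    have "(Q' has_vector_derivative (P s *\<^sub>R c'' s + P' s *\<^sub>R c' s) + (P' s *\<^sub>R c' s + (P s - 1/2) *\<^sub>R c s)) (at s)"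
      unfolding Q'_def[abs_def]
      by (rule has_vector_derivative_add[OF has_vector_derivative_scaleR[OF dP c(2)] has_vector_derivative_scaleR[OF dP' c(1)]])
    moreover have "(P s *\<^sub>R c'' s + P' s *\<^sub>R c' s) + (P' s *\<^sub>R c' s + (P s - 1/2) *\<^sub>R c s)
       = (P s * (\<mu> s / 2) + P s - 1/2) *\<^sub>R c s + (2 * P' s - P s * (4 * D s / \<mu> s)) *\<^sub>R c' s"
      unfolding acc by (simp add: scaleR_conv_of_real algebra_simps)
    moreover have "P s * (\<mu> s / 2) + P s - 1/2 = P s" "2 * P' s - P s * (4 * D s / \<mu> s) = 0"
      using \<mu>_pos[of s] by (auto simp: P_def P'_def power2_eq_square)
    ultimately show ?thesis by (simp add: Q_def)
  qed
  ultimately obtain A B where Q: "\<And>s. Q s = exp s *\<^sub>R A + exp (- s) *\<^sub>R B"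
    using second_order_linear_solution[of Q Q'] by metis
  define U V where "U = 2 *\<^sub>R A" and "V = 2 *\<^sub>R B"
  have Q2: "2 *\<^sub>R Q s = exp s *\<^sub>R U + exp (- s) *\<^sub>R V" for s
    unfolding U_def V_def Q by (simp add: scaleR_add_right mult.commute)
  have hyper: "(F s)\<^sup>2 - (norm (2 *\<^sub>R Q s))\<^sup>2 = 1" for s
  proof -
    have "(norm (2 *\<^sub>R Q s))\<^sup>2 = 4 * (P s)\<^sup>2 * (1 - \<mu> s)"
      unfolding norm2[symmetric] by (simp add: Q_def power_mult_distrib)
    then show ?thesis using \<mu>_pos[of s] by (simp add: F_def P_def field_simps power2_eq_square)
  qed
  have expand: "(a\<^sup>2 - (norm U)\<^sup>2) * (exp s * exp s) + (b\<^sup>2 - (norm V)\<^sup>2) * (exp (- s) * exp (- s)) + 2 * (a * b - U \<bullet> V) = 1" for s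
  proof -
    have e: "exp s * exp (- s) = 1" for s :: real by (simp add: exp_minus)
    have "(F s)\<^sup>2 - (norm (2 *\<^sub>R Q s))\<^sup>2 = (a\<^sup>2 - (norm U)\<^sup>2) * (exp s * exp s) + (b\<^sup>2 - (norm V)\<^sup>2) * (exp (- s) * exp (- s))
        + 2 * (exp s * exp (- s)) * (a * b - U \<bullet> V)"
      unfolding Q2 F power2_norm_eq_inner
      by (simp add: inner_add_left inner_add_right inner_commute power2_eq_square algebra_simps)
    then show ?thesis using hyper[of s] by (simp add: e)
  qed
  \<comment> \<open>the functions \<open>exp (2 s)\<close>, \<open>exp (- 2 s)\<close> and \<open>1\<close> are linearly independent: three values of
    \<open>s\<close> separate the coefficients\<close>
  have three: "a\<^sup>2 = (norm U)\<^sup>2 \<and> b\<^sup>2 = (norm V)\<^sup>2 \<and> 2 * (a * b - U \<bullet> V) = 1"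
  proof -
    define p q r where "p = a\<^sup>2 - (norm U)\<^sup>2" and "q = b\<^sup>2 - (norm V)\<^sup>2" and "r = 2 * (a * b - U \<bullet> V)"
    note e = expand[folded p_def q_def r_def]
    have "p + q + r = 1" "4 * p + q / 4 + r = 1" "p / 4 + 4 * q + r = 1"
      using e[of 0] e[of "ln 2"] e[of "- ln 2"] by (simp_all add: exp_minus)
    then have "p = 0" "q = 0" "r = 1" by linarith+
    then show ?thesis by (simp add: p_def q_def r_def)
  qed
  have F_pos: "F s > 0" for s
  proof -
    have "\<mu> s \<le> 1" by (simp add: \<mu>_def)
    then show ?thesis using \<mu>_pos[of s] by (simp add: F_def P_def field_simps)
  qed
  \<comment> \<open>\<open>F > 0\<close> for all \<open>s\<close> excludes negative coefficients\<close>
  have nonneg: "0 \<le> a" "0 \<le> b"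
  proof -
    have pos: "a * x + b > 0" if "x > 0" for x
    proof -
      define s where "s = ln x / 2"
      have "exp s * F s = a * (exp s * exp s) + b" by (simp add: F algebra_simps exp_minus)
      moreover have "exp s * exp s = x" using that by (simp add: s_def flip: exp_add)
      ultimately show ?thesis using F_pos[of s] by (metis exp_gt_zero mult_pos_pos)
    qed
    show a: "0 \<le> a"
    proof (rule ccontr)
      assume neg: "\<not> 0 \<le> a"
      then have "(\<bar>b\<bar> + 1) / (- a) > 0" by (intro divide_pos_pos) auto
      moreover have "a * ((\<bar>b\<bar> + 1) / (- a)) = - (\<bar>b\<bar> + 1)" using neg by (simp add: field_simps)
      ultimately show False using pos[of "(\<bar>b\<bar> + 1) / (- a)"] by linarith
    qed
    show "0 \<le> b"
    proof (rule ccontr)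
      assume neg: "\<not> 0 \<le> b"
      then have "- b / (a + 1) > 0" using a by (intro divide_pos_pos) auto
      moreover have "a * (- b / (a + 1)) + b = b / (a + 1)" using a by (simp add: field_simps)
      moreover have "b / (a + 1) < 0" using a neg by (intro divide_neg_pos) auto
      ultimately show False using pos[of "- b / (a + 1)"] by linarith
    qed
  qed
  have norms: "norm U = a" "norm V = b" using three nonneg by (metis norm_ge_zero power2_eq_imp_eq)+
  have "a \<noteq> 0" "b \<noteq> 0" using three norms by auto
  then have ab: "0 < a" "0 < b" using nonneg by auto
  show ?thesis
  proof (rule that[of a b "U / of_real a" "V / of_real b"])
    show "0 < a" "0 < b" by (fact ab)+
    show "norm (U / of_real a) = 1" "norm (V / of_real b) = 1" using norms ab by (auto simp: norm_divide)
    have "(U / of_real a) \<bullet> (V / of_real b) = ((1 / a) *\<^sub>R U) \<bullet> ((1 / b) *\<^sub>R V)"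
      by (simp add: scaleR_conv_of_real)
    then have "(U / of_real a) \<bullet> (V / of_real b) = (U \<bullet> V) / (a * b)" by simp
    then have "2 * a * b * (1 - (U / of_real a) \<bullet> (V / of_real b)) = 2 * (a * b - U \<bullet> V)"
      using ab by (simp only:) (simp add: field_simps)
    then show "2 * a * b * (1 - (U / of_real a) \<bullet> (V / of_real b)) = 1" using three by simp
    fix s
    have "of_real (1 + F s) * c s = 2 *\<^sub>R Q s" by (simp add: F_def Q_def scaleR_conv_of_real)
    moreover have "complex_of_real (1 + F s) \<noteq> 0" using F_pos[of s] by (metis add_pos_pos of_real_eq_0_iff order_less_irrefl zero_less_one)
    ultimately have "c s = 2 *\<^sub>R Q s / of_real (1 + F s)" by (simp add: field_simps)
    also have "2 *\<^sub>R Q s = of_real (a * exp s) * (U / of_real a) + of_real (b * exp (- s)) * (V / of_real b)"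
      unfolding Q2 using ab by (simp add: scaleR_conv_of_real)
    also have "1 + F s = 1 + a * exp s + b * exp (- s)" by (simp add: F)
    finally show "c s = (of_real (a * exp s) * (U / of_real a) + of_real (b * exp (- s)) * (V / of_real b)) / of_real (1 + a * exp s + b * exp (- s))" .
  qed
qed


context ideal_pair
begin

definition q1 where "q1 = m * cnj \<eta>"
definition q2 where "q2 = m * \<eta>"

lemma norm_q: "norm q1 = 1" "norm q2 = 1"
  by (simp_all add: q1_def q2_def norm_mult norm_m norm_\<eta>)

text \<open>The geodesic with ideal end points \<open>q1\<close>, \<open>q2\<close>, in the form of \<open>disk_geodesic_hyperboloid\<close>, is
  the image of the imaginary axis; the assumption on \<open>a b\<close> is the normalisation of the two
  lightlike vectors, since \<open>1 - q1 \<bullet> q2 = 2 (Im \<eta>)\<^sup>2\<close>.\<close>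

lemma h_imaginary_axis:
  assumes a: "0 < a" "0 < b" and ab: "4 * (Im \<eta>)\<^sup>2 * (a * b) = 1"
  shows "h (\<i> * of_real (2 * Im \<eta> * a)) = (of_real a * q2 + of_real b * q1) / of_real (1 + a + b)"
proof -
  let ?y = "of_real (Im \<eta>) :: complex" and ?a = "of_real a :: complex" and ?b = "of_real b :: complex"
  have ab': "4 * ?y\<^sup>2 * (?a * ?b) = 1" using arg_cong[OF ab, of complex_of_real] by simp
  have \<eta>2: "\<eta> * \<eta> = 1 + 2 * \<i> * ?y * \<eta>" using \<eta>_squared by (simp add: power2_eq_square algebra_simps)
  have c: "cnj \<eta> = \<eta> - 2 * \<i> * ?y" by (simp add: complex_eq_iff)
  have nz: "\<i> * of_real (2 * Im \<eta> * a) + \<eta> \<noteq> 0" "complex_of_real (1 + a + b) \<noteq> 0"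
    using a Im_\<eta> by (auto intro!: denominator_nonzero simp del: of_real_add)
  have "(\<eta> * (\<i> * (2 * ?y * ?a)) + 1) * (1 + ?a + ?b) - (?a * \<eta> + ?b * cnj \<eta>) * (\<i> * (2 * ?y * ?a) + \<eta>)
     = 1 - 4 * ?y\<^sup>2 * (?a * ?b) + (1 + 2 * \<i> * ?y * \<eta> - \<eta> * \<eta>) * ?a + (1 + 2 * \<i> * ?y * \<eta> - \<eta> * \<eta>) * ?b"
    unfolding c by (simp add: power2_eq_square algebra_simps)
  then have "(\<eta> * (\<i> * (2 * ?y * ?a)) + 1) * (1 + ?a + ?b) = (?a * \<eta> + ?b * cnj \<eta>) * (\<i> * (2 * ?y * ?a) + \<eta>)"
    unfolding ab' \<eta>2 by simp
  from arg_cong[OF this, of "\<lambda>x. m * x"]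
  have "m * (\<eta> * (\<i> * of_real (2 * Im \<eta> * a)) + 1) * of_real (1 + a + b)
      = (of_real a * q2 + of_real b * q1) * (\<i> * of_real (2 * Im \<eta> * a) + \<eta>)"
    by (simp add: q1_def q2_def algebra_simps)
  then show ?thesis unfolding h_def using nz by (simp add: frac_eq_eq)
qed

text \<open>The ends of the explicit form of a geodesic are its ideal points, so they are \<open>q1\<close> and \<open>q2\<close> in
  one order or the other; the sign \<open>e\<close> is the order.\<close>

lemma geodesic_imaginary_axis:
  assumes c: "unit_speed_geodesic disk disk_metric c" and ends: "ideal_boundary (range c) = {q1, q2}"
  obtains P e where "0 < P" "e = 1 \<or> e = -1" "\<And>s. c s = h (\<i> * of_real (P * exp (e * s)))"
proof -
  obtain a b u v where ab: "0 < a" "0 < b" "norm u = 1" "norm v = 1" "2 * a * b * (1 - u \<bullet> v) = 1"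
    and cs: "\<And>s. c s = (of_real (a * exp s) * u + of_real (b * exp (- s)) * v) / of_real (1 + a * exp s + b * exp (- s))"
    using disk_geodesic_hyperboloid[OF c] by metis
  have limit: "w \<in> ideal_boundary (range c)"
    if "0 < a" "norm w = 1" "\<sigma> = 1 \<or> \<sigma> = -1" and c_eq: "\<And>s. c (\<sigma> * s) = (of_real (a * exp s) * w + of_real (b * exp (- s)) * w') / of_real (1 + a * exp s + b * exp (- s))"
    for a b w w' \<sigma>
  proof -
    have "c (\<sigma> * real n) = (of_real a * w + of_real (b * exp (- real n) ^ 2) * w') / of_real (exp (- real n) + a + b * exp (- real n) ^ 2)" for n
    proof -
      let ?x = "exp (real n)"
      have "(of_real a * w + of_real (b * exp (- real n) ^ 2) * w') / of_real (exp (- real n) + a + b * exp (- real n) ^ 2)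
        = (of_real ?x * (of_real a * w + of_real (b * exp (- real n) ^ 2) * w')) / (of_real ?x * of_real (exp (- real n) + a + b * exp (- real n) ^ 2))"
        by simp
      also have "of_real ?x * (of_real a * w + of_real (b * exp (- real n) ^ 2) * w') = of_real (a * ?x) * w + of_real (b * exp (- real n)) * w'"
        by (simp add: exp_minus power2_eq_square algebra_simps)
      also have "complex_of_real ?x * of_real (exp (- real n) + a + b * exp (- real n) ^ 2) = of_real (1 + a * ?x + b * exp (- real n))"
        unfolding of_real_mult[symmetric] by (simp add: exp_minus power2_eq_square field_simps)
      finally show ?thesis using c_eq[of "real n"] by simp
    qed
    moreover have e: "(\<lambda>n. exp (- real n)) \<longlonglongrightarrow> 0"
      by (rule filterlim_compose[OF exp_at_bot]) (rule filterlim_compose[OF filterlim_uminus_at_bot_at_top filterlim_real_sequentially])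
    have "(\<lambda>n. (of_real a * w + of_real (b * exp (- real n) ^ 2) * w') / of_real (exp (- real n) + a + b * exp (- real n) ^ 2))
       \<longlonglongrightarrow> (of_real a * w + of_real (b * 0 ^ 2) * w') / of_real (0 + a + b * 0 ^ 2)"
      using \<open>0 < a\<close> by (intro tendsto_intros e) auto
    ultimately have "(\<lambda>n. c (\<sigma> * real n)) \<longlonglongrightarrow> w" using \<open>0 < a\<close> by simp
    then show ?thesis using \<open>norm w = 1\<close> unfolding ideal_boundary_def by (auto intro!: exI[of _ "\<lambda>n. c (\<sigma> * real n)"])
  qed
  have u: "u \<in> {q1, q2}" using limit[of a u 1 b v] ab cs ends by simp
  have v: "v \<in> {q1, q2}" using limit[of b v "-1" a u] ab cs ends by (simp add: add_ac)
  have "u \<noteq> v"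
  proof
    assume "u = v"
    then have "u \<bullet> v = 1" using ab(3) by (simp add: dot_square_norm)
    then show False using ab(5) by simp
  qed
  have qq: "q1 \<bullet> q2 = 1 - 2 * (Im \<eta>)\<^sup>2"
  proof -
    have "q1 \<bullet> q2 = cnj \<eta> \<bullet> \<eta>" unfolding q1_def q2_def inner_complex_mult_left norm_m by simp
    also have "\<dots> = (Re \<eta>)\<^sup>2 + (Im \<eta>)\<^sup>2 - 2 * (Im \<eta>)\<^sup>2" by (simp add: inner_complex_def power2_eq_square)
    also have "(Re \<eta>)\<^sup>2 + (Im \<eta>)\<^sup>2 = 1" using norm_\<eta> by (simp add: cmod_def)
    finally show ?thesis .
  qed
  have "u \<bullet> v = q1 \<bullet> q2" using u v \<open>u \<noteq> v\<close> by (auto simp: inner_commute)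
  then have "1 - u \<bullet> v = 2 * (Im \<eta>)\<^sup>2" using qq by simp
  then have y: "4 * (Im \<eta>)\<^sup>2 * (a * b) = 1" using ab(5) by (simp add: mult_ac)
  have prod: "4 * (Im \<eta>)\<^sup>2 * ((a * exp s) * (b * exp (- s))) = 1" for s
  proof -
    have "(a * exp s) * (b * exp (- s)) = a * b" by (simp add: exp_minus field_simps)
    then show ?thesis using y by (simp only:)
  qed
  show ?thesis
  proof (cases "u = q2")
    case True
    then have v': "v = q1" using v \<open>u \<noteq> v\<close> by auto
    show ?thesis
    proof (rule that[of "2 * Im \<eta> * a" 1])
      show "c s = h (\<i> * of_real (2 * Im \<eta> * a * exp (1 * s)))" for s
        using h_imaginary_axis[of "a * exp s" "b * exp (- s)", OF _ _ prod] ab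
        by (simp add: cs True v' mult.assoc)
    qed (use ab Im_\<eta> in auto)
  next
    case False
    then have u': "u = q1" and v': "v = q2" using u v \<open>u \<noteq> v\<close> by auto
    show ?thesis
    proof (rule that[of "2 * Im \<eta> * b" "-1"])
      have "4 * (Im \<eta>)\<^sup>2 * ((b * exp (- s)) * (a * exp s)) = 1" for s
        using prod[of s] by (simp only: mult.commute[of "b * exp (- s)"])
      then show "c s = h (\<i> * of_real (2 * Im \<eta> * b * exp (-1 * s)))" for s
        using h_imaginary_axis[of "b * exp (- s)" "a * exp s"] ab
        by (simp add: cs u' v' mult.assoc add_ac)
    qed (use ab Im_\<eta> in auto)
  qed
qed

end


section \<open>The profile curves and their heights\<close>

text \<open>The solutions of \<open>\<phi>'' = \<phi>\<close>, \<open>\<phi>'\<^sup>2 + d\<^sup>2 = 1 + \<phi>\<^sup>2\<close>. For \<open>d > 1\<close> the profile stays at distance at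
  least \<open>arcosh d\<close> from the geodesic and turns there; for \<open>d < 1\<close> it crosses the geodesic.\<close>

definition profile_radius :: "real \<Rightarrow> real \<Rightarrow> real" where
  "profile_radius d w = (if d > 1 then sqrt (d\<^sup>2 - 1) * cosh w else if d = 1 then exp w else sqrt (1 - d\<^sup>2) * sinh w)"

definition profile_radius' :: "real \<Rightarrow> real \<Rightarrow> real" where
  "profile_radius' d w = (if d > 1 then sqrt (d\<^sup>2 - 1) * sinh w else if d = 1 then exp w else sqrt (1 - d\<^sup>2) * cosh w)"

text \<open>The height is normalised to be \<open>0\<close> at the symmetric point of the profile. For \<open>d = 1\<close> there is
  no such point: then the height is elementary and normalised to tend to \<open>0\<close> far from the
  geodesic.\<close>

definition profile_height :: "real \<Rightarrow> real \<Rightarrow> real" where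
  "profile_height d = (if d = 1 then (\<lambda>w. - arsinh (exp (- w)))
     else (SOME F. F 0 = 0 \<and> (\<forall>w. (F has_real_derivative d / sqrt (1 + (profile_radius d w)\<^sup>2)) (at w))))"

lemma profile_radius_derivative:
  "(profile_radius d has_real_derivative profile_radius' d w) (at w)"
  "(profile_radius' d has_real_derivative profile_radius d w) (at w)"
  by (cases "d > 1"; cases "d = 1"; auto simp: profile_radius_def[abs_def] profile_radius'_def[abs_def] intro!: derivative_eq_intros)+

lemma sqrt_one_plus_square_pos: "0 < sqrt (1 + (x::real)\<^sup>2)"
  by (simp add: add_pos_nonneg)

lemma continuous_profile_radius: "continuous_on A (profile_radius d)"
  using profile_radius_derivative(1) by (intro continuous_at_imp_continuous_on) (auto intro: DERIV_isCont)

lemma profile_height_antiderivative: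
  assumes "d \<noteq> 1"
  shows "profile_height d 0 = 0" "(profile_height d has_real_derivative d / sqrt (1 + (profile_radius d w)\<^sup>2)) (at w)"
proof -
  let ?f = "\<lambda>w. d / sqrt (1 + (profile_radius d w)\<^sup>2)"
  have "isCont ?f w" for w
    using sqrt_one_plus_square_pos[of "profile_radius d w"]
    by (intro continuous_intros DERIV_isCont[OF profile_radius_derivative(1)]) auto
  then obtain F where F: "\<And>w. (F has_real_derivative ?f w) (at w)"
    using einterval_antiderivative[of "-\<infinity>" \<infinity> ?f] by (auto simp: has_real_derivative_iff_has_vector_derivative)
  have "((\<lambda>w. F w - F 0) has_real_derivative ?f w) (at w)" for w
    using DERIV_diff[OF F DERIV_const] by simp
  then have "\<exists>F. F 0 = 0 \<and> (\<forall>w. (F has_real_derivative ?f w) (at w))"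
    by (intro exI[of _ "\<lambda>w. F w - F 0"]) simp
  from someI_ex[OF this] assms
  show "profile_height d 0 = 0" "(profile_height d has_real_derivative d / sqrt (1 + (profile_radius d w)\<^sup>2)) (at w)"
    by (auto simp: profile_height_def)
qed

lemma profile_height_derivative:
  "(profile_height d has_real_derivative d / sqrt (1 + (profile_radius d w)\<^sup>2)) (at w)"
proof (cases "d = 1")
  case True
  have "((\<lambda>w. - arsinh (exp (- w))) has_real_derivative exp (- w) / sqrt ((exp (- w))\<^sup>2 + 1)) (at w)"
  proof -
    have "((\<lambda>w. exp (- w)) has_real_derivative - exp (- w)) (at w)" by (auto intro!: derivative_eq_intros)
    from DERIV_minus[OF DERIV_chain2[OF arsinh_real_has_field_derivative this]] show ?thesis by simp
  qed
  moreover have "exp (- w) / sqrt ((exp (- w))\<^sup>2 + 1) = 1 / sqrt (1 + (exp w)\<^sup>2)"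
  proof -
    have "sqrt (1 + (exp w)\<^sup>2) = sqrt ((exp w)\<^sup>2 * ((exp (- w))\<^sup>2 + 1))"
      by (simp add: exp_minus power2_eq_square field_simps)
    also have "\<dots> = exp w * sqrt ((exp (- w))\<^sup>2 + 1)" by (simp add: real_sqrt_mult)
    finally show ?thesis by (simp add: exp_minus field_simps)
  qed
  ultimately show ?thesis using True by (simp add: profile_height_def profile_radius_def)
qed (rule profile_height_antiderivative)

lemma profile_height_odd:
  assumes "d \<noteq> 1" shows "profile_height d (- w) = - profile_height d w"
proof -
  have sym: "(profile_radius d (- w))\<^sup>2 = (profile_radius d w)\<^sup>2" for w
    using assms by (simp add: profile_radius_def)
  have "((\<lambda>w. profile_height d w + profile_height d (- w)) has_real_derivative 0) (at w)" for w
    using DERIV_add[OF profile_height_derivative[of d w] DERIV_mirror[THEN iffD1, OF profile_height_derivative[of d "- w"]]]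
    by (simp add: sym)
  then have "profile_height d w + profile_height d (- w) = profile_height d 0 + profile_height d (- 0)"
    using DERIV_isconst_all[of "\<lambda>w. profile_height d w + profile_height d (- w)"] by blast
  then show ?thesis using profile_height_antiderivative(1)[OF assms] by simp
qed

lemma abs_le_exp_abs: "\<bar>w\<bar> \<le> exp \<bar>w\<bar>" for w :: real
  using exp_ge_add_one_self[of "\<bar>w\<bar>"] by linarith

lemma abs_le_two_cosh: "\<bar>w\<bar> \<le> 2 * cosh w" for w :: real
proof -
  have "exp \<bar>w\<bar> \<le> exp w + exp (- w)" by (cases "w \<ge> 0") auto
  then show ?thesis using abs_le_exp_abs[of w] by (simp add: cosh_def)
qed

lemma abs_le_two_abs_sinh: "\<bar>w\<bar> \<le> 2 * \<bar>sinh w\<bar>" for w :: real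
proof -
  have "u \<le> 2 * sinh u" if "u \<ge> 0" for u :: real
  proof -
    have "1 + u \<le> exp u" "exp (- u) \<le> 1" using that by auto
    moreover have "2 * sinh u = exp u - exp (- u)" by (simp add: sinh_def)
    ultimately show ?thesis by linarith
  qed
  from this[of "\<bar>w\<bar>"] show ?thesis by (cases "w \<ge> 0") auto
qed

text \<open>A proper curve has a closed range.\<close>

lemma closed_range_of_bounded_preimages:
  fixes g :: "real \<Rightarrow> 'a::real_normed_vector"
  assumes g: "continuous_on UNIV g" and bd: "\<And>R. \<exists>B. \<forall>w. norm (g w) \<le> R \<longrightarrow> \<bar>w\<bar> \<le> B"
  shows "closed (range g)"
  unfolding closed_sequential_limits
proof (intro allI impI)
  fix x l assume x: "(\<forall>n. x n \<in> range g) \<and> x \<longlonglongrightarrow> l"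
  then have "Bseq x" by (auto intro: convergent_imp_Bseq convergentI)
  then obtain R where R: "\<And>n. norm (x n) \<le> R" by (auto simp: Bseq_def)
  obtain B where B: "\<And>w. norm (g w) \<le> R \<Longrightarrow> \<bar>w\<bar> \<le> B" using bd[of R] by auto
  have "x n \<in> g ` {-B..B}" for n
  proof -
    obtain w where w: "x n = g w" using x by auto
    have "\<bar>w\<bar> \<le> B" using B R[of n] w by simp
    then show ?thesis unfolding w by (intro imageI) auto
  qed
  moreover have "closed (g ` {-B..B})"
    by (intro compact_imp_closed compact_continuous_image continuous_on_subset[OF g]) auto
  ultimately have "l \<in> g ` {-B..B}" using x by (metis closed_sequential_limits)
  then show "l \<in> range g" by auto
qed

lemma profile_radius_height: "0 < d \<Longrightarrow> profile d (profile_radius d) (profile_radius' d) (profile_height d)"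
proof
  assume d: "0 < d"
  show "0 < d" by (rule d)
  fix w
  show "(profile_radius d has_real_derivative profile_radius' d w) (at w)"
    "(profile_radius' d has_real_derivative profile_radius d w) (at w)"
    "(profile_height d has_real_derivative d / sqrt (1 + (profile_radius d w)\<^sup>2)) (at w)"
    by (rule profile_radius_derivative profile_height_derivative)+
  have "d \<noteq> 1 \<Longrightarrow> d > 1 \<or> d < 1" by auto
  then show "(profile_radius' d w)\<^sup>2 + d\<^sup>2 = 1 + (profile_radius d w)\<^sup>2"
    using d by (auto simp: profile_radius_def profile_radius'_def power_mult_distrib cosh_square_eq abs_square_le_1 one_le_power algebra_simps)
next
  assume d: "0 < d"
  have cont: "continuous_on UNIV (\<lambda>w. (profile_radius d w, profile_height d w))"
    by (intro continuous_intros continuous_profile_radius continuous_at_imp_continuous_on ballI DERIV_isCont[OF profile_height_derivative])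
  show "closed (range (\<lambda>w. (profile_radius d w, profile_height d w)))"
  proof (rule closed_range_of_bounded_preimages[OF cont])
    fix R
    have fst_le: "\<bar>profile_radius d w\<bar> \<le> R" and snd_le: "\<bar>profile_height d w\<bar> \<le> R"
      if "norm (profile_radius d w, profile_height d w) \<le> R" for w
      using order_trans[OF norm_fst_le that] order_trans[OF norm_snd_le that] by auto
    consider "d > 1" | "d = 1" | "d < 1" by linarith
    then show "\<exists>B. \<forall>w. norm (profile_radius d w, profile_height d w) \<le> R \<longrightarrow> \<bar>w\<bar> \<le> B"
    proof cases
      case 1
      have k: "0 < sqrt (d\<^sup>2 - 1)" using 1 by (simp add: one_less_power)
      have "\<bar>w\<bar> \<le> 2 * R / sqrt (d\<^sup>2 - 1)" if "norm (profile_radius d w, profile_height d w) \<le> R" for w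
      proof -
        have "sqrt (d\<^sup>2 - 1) * cosh w \<le> R" using fst_le[OF that] 1 k by (simp add: profile_radius_def abs_mult)
        moreover have "sqrt (d\<^sup>2 - 1) * \<bar>w\<bar> \<le> sqrt (d\<^sup>2 - 1) * (2 * cosh w)" using k by (intro mult_left_mono abs_le_two_cosh) simp
        ultimately have "\<bar>w\<bar> * sqrt (d\<^sup>2 - 1) \<le> 2 * R" by (simp add: mult_ac)
        then show ?thesis using k by (simp add: pos_le_divide_eq)
      qed
      then show ?thesis by blast
    next
      case 2
      \<comment> \<open>for \<open>d = 1\<close> the radius \<open>exp w\<close> only bounds \<open>w\<close> from above; the lower bound comes from
        the height\<close>
      have "\<bar>w\<bar> \<le> max R (sinh R)" if "norm (profile_radius d w, profile_height d w) \<le> R" for w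
      proof -
        have 1: "exp w \<le> R" "arsinh (exp (- w)) \<le> R"
          using fst_le[OF that] snd_le[OF that] 2 by (auto simp: profile_radius_def profile_height_def)
        then have "sinh (arsinh (exp (- w))) \<le> sinh R" by (simp only: sinh_real_le_iff)
        then have "exp (- w) \<le> sinh R" by simp
        then show ?thesis using 1 exp_ge_add_one_self[of w] exp_ge_add_one_self[of "-w"] by linarith
      qed
      then show ?thesis by blast
    next
      case 3
      have k: "0 < sqrt (1 - d\<^sup>2)" using 3 d by (simp add: abs_square_less_1)
      have "\<bar>w\<bar> \<le> 2 * R / sqrt (1 - d\<^sup>2)" if "norm (profile_radius d w, profile_height d w) \<le> R" for w
      proof -
        have "sqrt (1 - d\<^sup>2) * \<bar>sinh w\<bar> \<le> R" using fst_le[OF that] 3 d k by (simp add: profile_radius_def abs_mult)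
        moreover have "sqrt (1 - d\<^sup>2) * \<bar>w\<bar> \<le> sqrt (1 - d\<^sup>2) * (2 * \<bar>sinh w\<bar>)" using k by (intro mult_left_mono abs_le_two_abs_sinh) simp
        ultimately have "\<bar>w\<bar> * sqrt (1 - d\<^sup>2) \<le> 2 * R" by (simp add: mult_ac)
        then show ?thesis using k by (simp add: pos_le_divide_eq)
      qed
      then show ?thesis by blast
    qed
  qed
qed

lemma DERIV_comparison:
  fixes F G :: "real \<Rightarrow> real"
  assumes "\<And>x. (F has_real_derivative F' x) (at x)" "\<And>x. (G has_real_derivative G' x) (at x)"
    and "\<And>x. 0 \<le> x \<Longrightarrow> F' x \<le> G' x" "F 0 = 0" "G 0 = 0" "0 \<le> w"
  shows "F w \<le> G w"
proof -
  have "G 0 - F 0 \<le> G w - F w"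
    using DERIV_nonneg_imp_nondecreasing[of 0 w "\<lambda>x. G x - F x"] DERIV_diff[OF assms(2,1)] assms(3,6)
    by (metis diff_ge_0_iff_ge)
  then show ?thesis using assms by simp
qed

lemma arctan_sinh_derivative: "((\<lambda>w. arctan (sinh w)) has_real_derivative 1 / cosh w) (at (w::real))"
proof -
  have "1 + (sinh w)\<^sup>2 = (cosh w)\<^sup>2" by (simp add: cosh_square_eq)
  moreover have "((\<lambda>w. arctan (sinh w)) has_real_derivative cosh w / (1 + (sinh w)\<^sup>2)) (at w)"
    by (auto intro!: derivative_eq_intros simp: divide_inverse)
  ultimately show ?thesis by (simp add: power2_eq_square)
qed

lemma arctan_sinh_at_top: "((\<lambda>w::real. arctan (sinh w)) \<longlongrightarrow> pi / 2) at_top"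
  by (rule filterlim_compose[OF tendsto_arctan_at_top sinh_real_at_top])

text \<open>The total height above the symmetric point of the profile, as the height increases to its
  supremum.\<close>

definition profile_limit :: "real \<Rightarrow> real" where
  "profile_limit d = (SUP w. profile_height d w)"

text \<open>\<open>arctan (sinh w)\<close> is the primitive of \<open>1 / cosh w\<close>, and \<open>sqrt (1 + \<phi>\<^sup>2)\<close> is at least
  \<open>sqrt \<bar>d\<^sup>2 - 1\<bar> cosh w\<close>. The bound \<open>\<pi> / 2 \<cdot> d / sqrt \<bar>d\<^sup>2 - 1\<bar>\<close> for the total height that
  results gives the limits for \<open>d \<rightarrow> 0\<close> and, from above, for \<open>d \<rightarrow> \<infinity>\<close>.\<close>

lemma profile_height_upper_bound:
  assumes d: "0 < d" "d \<noteq> 1" and w: "0 \<le> w"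
  shows "profile_height d w \<le> d / sqrt \<bar>d\<^sup>2 - 1\<bar> * arctan (sinh w)"
proof -
  let ?k = "sqrt \<bar>d\<^sup>2 - 1\<bar>"
  have d2: "d\<^sup>2 \<noteq> 1" using d by (simp add: power2_eq_1_iff)
  then have k: "?k > 0" by simp
  have "d / sqrt (1 + (profile_radius d w)\<^sup>2) \<le> d / ?k * (1 / cosh w)" for w
  proof -
    have "(?k * cosh w)\<^sup>2 \<le> 1 + (profile_radius d w)\<^sup>2"
    proof (cases "d > 1")
      case True
      then have "\<bar>d\<^sup>2 - 1\<bar> = d\<^sup>2 - 1" by (simp add: one_le_power)
      then show ?thesis using True by (simp add: profile_radius_def)
    next
      case False
      then have "d\<^sup>2 \<le> 1" using d by (simp add: abs_square_le_1)
      then have "\<bar>d\<^sup>2 - 1\<bar> = 1 - d\<^sup>2" "(1 - d\<^sup>2) \<ge> 0" "(1 - d\<^sup>2) \<le> 1" by auto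
      then show ?thesis using False d by (simp add: profile_radius_def power_mult_distrib cosh_square_eq algebra_simps)
    qed
    then have "?k * cosh w \<le> sqrt (1 + (profile_radius d w)\<^sup>2)" by (rule real_le_rsqrt)
    then have "d / sqrt (1 + (profile_radius d w)\<^sup>2) \<le> d / (?k * cosh w)"
      using d k by (intro divide_left_mono mult_pos_pos sqrt_one_plus_square_pos) auto
    then show ?thesis by simp
  qed
  then show ?thesis
    using DERIV_comparison[OF profile_height_derivative[of d] DERIV_cmult[OF arctan_sinh_derivative, of "d / ?k"]]
      profile_height_antiderivative(1)[OF d(2)] w by simp
qed

lemma strict_mono_profile_height: "0 < d \<Longrightarrow> strict_mono (profile_height d)"
  by (rule profile.strict_mono_\<tau>[OF profile_radius_height])

lemma profile_height_le_bound:
  assumes d: "0 < d" "d \<noteq> 1" shows "profile_height d w \<le> d / sqrt \<bar>d\<^sup>2 - 1\<bar> * (pi / 2)"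
proof -
  have "profile_height d w \<le> profile_height d \<bar>w\<bar>"
    using strict_mono_profile_height[OF d(1)] by (simp add: strict_mono_less_eq)
  also have "\<dots> \<le> d / sqrt \<bar>d\<^sup>2 - 1\<bar> * arctan (sinh \<bar>w\<bar>)" by (rule profile_height_upper_bound[OF d]) simp
  also have "\<dots> \<le> d / sqrt \<bar>d\<^sup>2 - 1\<bar> * (pi / 2)"
    using d arctan_ubound[of "sinh \<bar>w\<bar>"] by (intro mult_left_mono) auto
  finally show ?thesis .
qed

lemma profile_limit_le:
  assumes d: "0 < d" "d \<noteq> 1" shows "profile_limit d \<le> d / sqrt \<bar>d\<^sup>2 - 1\<bar> * (pi / 2)"
  unfolding profile_limit_def by (rule cSUP_least) (use profile_height_le_bound[OF d] in auto)

lemma profile_height_le_limit: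
  assumes d: "0 < d" "d \<noteq> 1" shows "profile_height d w \<le> profile_limit d"
  unfolding profile_limit_def
  by (rule cSUP_upper) (use profile_height_le_bound[OF d] in \<open>auto simp: bdd_above_def\<close>)

lemma profile_height_less_limit:
  assumes d: "0 < d" "d \<noteq> 1" shows "profile_height d w < profile_limit d" "- profile_limit d < profile_height d w"
proof -
  have *: "profile_height d w < profile_limit d" for w
    using strict_monoD[OF strict_mono_profile_height[OF d(1)], of w "w + 1"] profile_height_le_limit[OF d, of "w + 1"] by simp
  show "profile_height d w < profile_limit d" by (rule *)
  show "- profile_limit d < profile_height d w" using *[of "- w"] by (simp add: profile_height_odd[OF d(2)])
qed

lemma profile_limit_pos: "0 < d \<Longrightarrow> d \<noteq> 1 \<Longrightarrow> 0 < profile_limit d"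
  using profile_height_less_limit(1)[of d 0] profile_height_antiderivative(1)[of d] by simp

lemma profile_height_at_top:
  assumes d: "0 < d" "d \<noteq> 1" shows "(profile_height d \<longlongrightarrow> profile_limit d) at_top"
proof (rule increasing_tendsto)
  show "\<forall>\<^sub>F w in at_top. profile_height d w \<le> profile_limit d" by (simp add: profile_height_le_limit[OF d])
  fix x assume "x < profile_limit d"
  then obtain w where "x < profile_height d w"
    unfolding profile_limit_def using profile_height_le_bound[OF d] by (subst (asm) less_cSUP_iff) (auto simp: bdd_above_def)
  then show "\<forall>\<^sub>F w in at_top. x < profile_height d w"
    using strict_mono_less_eq[OF strict_mono_profile_height[OF d(1)]]
    by (intro eventually_at_top_linorderI[of w]) (meson less_le_trans)
qed

text \<open>The slope of the height decreases for \<open>w \<ge> 0\<close>. As \<open>d \<rightarrow> 1\<close> with \<open>w\<close> fixed, the right slope tends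
  to \<open>1\<close>, so that the total height exceeds every bound.\<close>

lemma profile_height_lower_bound:
  assumes d: "0 < d" "d \<noteq> 1" and w: "0 \<le> w"
  shows "w * (d / sqrt (1 + (profile_radius d w)\<^sup>2)) \<le> profile_height d w"
proof -
  have mono: "(profile_radius d x)\<^sup>2 \<le> (profile_radius d w)\<^sup>2" if "0 \<le> x" "x \<le> w" for x
    using that d by (auto simp: profile_radius_def power_mult_distrib cosh_square_eq intro!: mult_left_mono power_mono one_le_power)
  have "profile_height d 0 - 0 * (d / sqrt (1 + (profile_radius d w)\<^sup>2)) \<le> profile_height d w - w * (d / sqrt (1 + (profile_radius d w)\<^sup>2))"
  proof (rule DERIV_nonneg_imp_nondecreasing[OF w])
    fix x assume x: "0 \<le> x" "x \<le> w"
    have "d / sqrt (1 + (profile_radius d w)\<^sup>2) \<le> d / sqrt (1 + (profile_radius d x)\<^sup>2)"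
      using d mono[OF x] by (intro divide_left_mono mult_pos_pos sqrt_one_plus_square_pos) auto
    then show "\<exists>y. ((\<lambda>x. profile_height d x - x * (d / sqrt (1 + (profile_radius d w)\<^sup>2))) has_real_derivative y) (at x) \<and> 0 \<le> y"
      by (intro exI[of _ "d / sqrt (1 + (profile_radius d x)\<^sup>2) - 1 * (d / sqrt (1 + (profile_radius d w)\<^sup>2))"] conjI
          DERIV_diff profile_height_derivative DERIV_cmult_right DERIV_ident) simp
  qed
  then show ?thesis using profile_height_antiderivative(1)[OF d(2)] by simp
qed

text \<open>Since the profiles for different \<open>d\<close> have the same parameter interval, the heights can be
  compared through the slopes; the domain of the integral that defines \<open>H_height\<close>, on the other
  hand, depends on \<open>d\<close>.\<close>

lemma profile_limit_mono:
  assumes "0 < d" "d \<noteq> 1" "0 < e" "e \<noteq> 1"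
    and "\<And>w. d / sqrt (1 + (profile_radius d w)\<^sup>2) \<le> e / sqrt (1 + (profile_radius e w)\<^sup>2)"
  shows "profile_limit d \<le> profile_limit e"
proof (rule tendsto_le[OF _ profile_height_at_top profile_height_at_top])
  show "\<forall>\<^sub>F w in at_top. profile_height d w \<le> profile_height e w"
    using DERIV_comparison[OF profile_height_derivative[of d] profile_height_derivative[of e]] assms
      profile_height_antiderivative(1)[of d] profile_height_antiderivative(1)[of e]
    by (intro eventually_at_top_linorderI[of 0]) auto
qed (use assms in auto)

text \<open>An improper integral of a nonnegative function with a singularity at the left end point.\<close>

lemma integral_atLeast_FTC:
  fixes F f :: "real \<Rightarrow> real"
  assumes F: "\<And>x. a < x \<Longrightarrow> (F has_real_derivative f x) (at x)"
    and f: "\<And>x. a < x \<Longrightarrow> isCont f x" "\<And>x. a < x \<Longrightarrow> 0 \<le> f x"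
    and lim: "(F \<longlongrightarrow> A) (at_right a)" "(F \<longlongrightarrow> B) at_top"
  shows "integral {a..} f = B - A"
proof -
  have "set_integrable lborel (einterval (ereal a) \<infinity>) f" "(LBINT x=ereal a..\<infinity>. f x) = B - A"
    by (rule interval_integral_FTC_nonneg; use assms in \<open>simp add: ereal_tendsto_simps1\<close>)+
  then have "integral (einterval (ereal a) \<infinity>) f = B - A"
    by (simp add: interval_integral_eq_integral')
  moreover have "einterval (ereal a) \<infinity> = {a<..}" by (auto simp: einterval_def)
  moreover have "integral {a<..} f = integral {a..} f"
    by (rule integral_spike_set) (auto intro: negligible_subset[of "{a}"])
  ultimately show ?thesis by simp
qed

text \<open>Along the profile \<open>sinh u = \<phi> w = sqrt (d\<^sup>2 - 1) cosh w\<close>, where \<open>u\<close> is the distance to the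
  geodesic; as a function of \<open>u\<close> the height has the derivative \<open>d / sqrt (cosh\<^sup>2 u - d\<^sup>2)\<close>.\<close>

lemma H_height_eq: assumes d: "d > 1" shows "H_height d = profile_limit d"
proof -
  let ?k = "sqrt (d\<^sup>2 - 1)" and ?F = "\<lambda>u. profile_height d (arcosh (sinh u / sqrt (d\<^sup>2 - 1)))"
  have k: "0 < ?k" using d by (simp add: one_less_power)
  have cancel: "?k * (x / ?k) = x" for x
  proof -
    have "c * (x / c) = x" if "c \<noteq> 0" for c x :: real using that by simp
    then show ?thesis by this (use k in linarith)
  qed
  have s: "sinh u / ?k > 1" if "u > arcosh d" for u
  proof -
    have "sinh (arcosh d) < sinh u" using that by simp
    then show ?thesis using k d by (simp add: sinh_arcosh_real)
  qed
  have "integral {arcosh d..} (\<lambda>u. d / sqrt ((cosh u)\<^sup>2 - d\<^sup>2)) = profile_limit d - 0"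
  proof (rule integral_atLeast_FTC)
    fix u assume u: "arcosh d < u"
    have "0 \<le> arcosh d" using d by simp
    then have c: "d < cosh u" using u d by (metis arcosh_cosh_real arcosh_less_iff_real cosh_real_ge_1 less_eq_real_def order_trans)
    then have c2: "d\<^sup>2 < (cosh u)\<^sup>2" using d by (intro power_strict_mono) auto
    show "0 \<le> d / sqrt ((cosh u)\<^sup>2 - d\<^sup>2)" using c c2 d by (intro divide_nonneg_nonneg) auto
    show "isCont (\<lambda>u. d / sqrt ((cosh u)\<^sup>2 - d\<^sup>2)) u" using c2 by (intro continuous_intros) auto
    let ?w = "arcosh (sinh u / ?k)"
    have sd: "((\<lambda>u. sinh u / ?k) has_real_derivative cosh u / ?k) (at u)"
      by (rule DERIV_cdivide) (auto intro!: derivative_eq_intros)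
    have "((\<lambda>u. arcosh (sinh u / ?k)) has_real_derivative (1 / sqrt ((sinh u / ?k)\<^sup>2 - 1)) * (cosh u / ?k)) (at u)"
      by (rule DERIV_cong[OF DERIV_chain2[OF arcosh_real_has_field_derivative[OF s[OF u]] sd]]) simp
    from DERIV_chain2[OF profile_height_derivative[of d ?w] this]
    have "(?F has_real_derivative d / sqrt (1 + (profile_radius d ?w)\<^sup>2) * ((1 / sqrt ((sinh u / ?k)\<^sup>2 - 1)) * (cosh u / ?k))) (at u)" .
    moreover have "profile_radius d ?w = sinh u"
    proof -
      have "profile_radius d ?w = ?k * (sinh u / ?k)" using d s[OF u] by (simp add: profile_radius_def)
      also have "\<dots> = sinh u" by (rule cancel)
      finally show ?thesis .
    qed
    moreover have "sqrt (1 + (sinh u)\<^sup>2) = cosh u"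
    proof -
      have "1 + (sinh u)\<^sup>2 = (cosh u)\<^sup>2" by (simp add: cosh_square_eq)
      then show ?thesis by simp
    qed
    moreover have "sqrt ((sinh u / ?k)\<^sup>2 - 1) * ?k = sqrt ((cosh u)\<^sup>2 - d\<^sup>2)"
    proof -
      have k2: "?k\<^sup>2 = d\<^sup>2 - 1" using k by simp
      have "?k\<^sup>2 * ((sinh u / ?k)\<^sup>2 - 1) = (cosh u)\<^sup>2 - d\<^sup>2"
        using k unfolding right_diff_distrib power_divide by (simp add: k2 cosh_square_eq)
      then show ?thesis using k by (metis abs_of_pos mult.commute real_sqrt_abs real_sqrt_mult)
    qed
    ultimately show "(?F has_real_derivative d / sqrt ((cosh u)\<^sup>2 - d\<^sup>2)) (at u)"
      by (simp add: cosh_real_pos[THEN less_imp_neq, THEN not_sym])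
  next
    have cont: "isCont (profile_height d) w" for w by (rule DERIV_isCont[OF profile_height_derivative])
    have "((\<lambda>u. sinh u / ?k) \<longlongrightarrow> sinh (arcosh d) / ?k) (at_right (arcosh d))"
      by (intro tendsto_intros) (use k in auto)
    moreover have "sinh (arcosh d) / ?k = 1"
    proof -
      have "sinh (arcosh d) = ?k" using d by (simp add: sinh_arcosh_real)
      moreover have "?k / ?k = 1" by (rule divide_self) (use k in linarith)
      ultimately show ?thesis by (simp only:)
    qed
    ultimately have "((\<lambda>u. sinh u / ?k) \<longlongrightarrow> 1) (at_right (arcosh d))" by (simp only:)
    then have "((\<lambda>u. arcosh (sinh u / ?k)) \<longlongrightarrow> arcosh 1) (at_right (arcosh d))"
      by (rule tendsto_arcosh_strong)
        (use s in \<open>auto simp: eventually_at_filter intro!: always_eventually less_imp_le\<close>)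
    from isCont_tendsto_compose[OF cont this]
    show "(?F \<longlongrightarrow> 0) (at_right (arcosh d))" using d by (simp add: profile_height_antiderivative(1))
    have "filterlim (\<lambda>u. sinh u / ?k) at_top at_top"
      using filterlim_at_top_mult_tendsto_pos[OF tendsto_const _ sinh_real_at_top, of "1 / ?k"] k by simp
    then show "(?F \<longlongrightarrow> profile_limit d) at_top"
      by (intro filterlim_compose[OF profile_height_at_top] filterlim_compose[OF arcosh_real_at_top]) (use d in auto)
  qed
  then show ?thesis by (simp add: H_height_def)
qed

text \<open>The same substitution with \<open>sinh u = \<phi> w = sqrt (1 - d\<^sup>2) sinh w\<close>.\<close>

lemma G_height_eq: assumes d: "0 < d" "d < 1" shows "G_height d = profile_limit d"
proof -
  let ?k = "sqrt (1 - d\<^sup>2)" and ?F = "\<lambda>u. profile_height d (arsinh (sinh u / sqrt (1 - d\<^sup>2)))"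
  have k: "0 < ?k" using d by (simp add: abs_square_less_1)
  have cancel: "?k * (x / ?k) = x" for x
  proof -
    have "c * (x / c) = x" if "c \<noteq> 0" for c x :: real using that by simp
    then show ?thesis by this (use k in linarith)
  qed
  have "integral {0..} (\<lambda>u. d / sqrt ((cosh u)\<^sup>2 - d\<^sup>2)) = profile_limit d - 0"
  proof (rule integral_atLeast_FTC)
    fix u :: real
    have c: "d < cosh u" using d cosh_real_ge_1[of u] by linarith
    then have c2: "d\<^sup>2 < (cosh u)\<^sup>2" using d by (intro power_strict_mono) auto
    show "0 \<le> d / sqrt ((cosh u)\<^sup>2 - d\<^sup>2)" using c c2 d by (intro divide_nonneg_nonneg) auto
    show "isCont (\<lambda>u. d / sqrt ((cosh u)\<^sup>2 - d\<^sup>2)) u" using c2 by (intro continuous_intros) auto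
    let ?w = "arsinh (sinh u / ?k)"
    have sd: "((\<lambda>u. sinh u / ?k) has_real_derivative cosh u / ?k) (at u)"
      by (rule DERIV_cdivide) (auto intro!: derivative_eq_intros)
    have "((\<lambda>u. arsinh (sinh u / ?k)) has_real_derivative (1 / sqrt ((sinh u / ?k)\<^sup>2 + 1)) * (cosh u / ?k)) (at u)"
      by (rule DERIV_cong[OF DERIV_chain2[OF arsinh_real_has_field_derivative sd]]) simp
    from DERIV_chain2[OF profile_height_derivative[of d ?w] this]
    have "(?F has_real_derivative d / sqrt (1 + (profile_radius d ?w)\<^sup>2) * ((1 / sqrt ((sinh u / ?k)\<^sup>2 + 1)) * (cosh u / ?k))) (at u)" .
    moreover have "profile_radius d ?w = sinh u"
    proof -
      have "profile_radius d ?w = ?k * (sinh u / ?k)" using d by (simp add: profile_radius_def)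
      also have "\<dots> = sinh u" by (rule cancel)
      finally show ?thesis .
    qed
    moreover have "sqrt (1 + (sinh u)\<^sup>2) = cosh u"
    proof -
      have "1 + (sinh u)\<^sup>2 = (cosh u)\<^sup>2" by (simp add: cosh_square_eq)
      then show ?thesis by simp
    qed
    moreover have "sqrt ((sinh u / ?k)\<^sup>2 + 1) * ?k = sqrt ((cosh u)\<^sup>2 - d\<^sup>2)"
    proof -
      have k2: "?k\<^sup>2 = 1 - d\<^sup>2" using k by simp
      have "?k\<^sup>2 * ((sinh u / ?k)\<^sup>2 + 1) = (cosh u)\<^sup>2 - d\<^sup>2"
        using k unfolding distrib_left power_divide by (simp add: k2 cosh_square_eq)
      then show ?thesis using k by (metis abs_of_pos mult.commute real_sqrt_abs real_sqrt_mult)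
    qed
    ultimately show "(?F has_real_derivative d / sqrt ((cosh u)\<^sup>2 - d\<^sup>2)) (at u)"
      by (simp add: cosh_real_pos[THEN less_imp_neq, THEN not_sym])
  next
    have cont: "isCont (profile_height d) w" for w by (rule DERIV_isCont[OF profile_height_derivative])
    have "((\<lambda>u. arsinh (sinh u / ?k)) \<longlongrightarrow> arsinh (sinh 0 / ?k)) (at_right 0)"
      by (intro tendsto_intros) (use k in auto)
    from isCont_tendsto_compose[OF cont this]
    show "(?F \<longlongrightarrow> 0) (at_right 0)" using d by (simp add: profile_height_antiderivative(1))
    have "filterlim (\<lambda>u. sinh u / ?k) at_top at_top"
      using filterlim_at_top_mult_tendsto_pos[OF tendsto_const _ sinh_real_at_top, of "1 / ?k"] k by simp
    then show "(?F \<longlongrightarrow> profile_limit d) at_top"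
      by (intro filterlim_compose[OF profile_height_at_top] filterlim_compose[OF arsinh_real_at_top]) (use d in auto)
  qed
  then show ?thesis by (simp add: G_height_def)
qed

text \<open>With \<open>C = cosh\<^sup>2 w \<ge> 1\<close> the square of the slope of the height is \<open>d\<^sup>2 / (1 + (d\<^sup>2 - 1) C)\<close>,
  which decreases in \<open>d\<close>.\<close>

theorem H_height_antimono: "antimono_on {1<..} H_height"
proof (rule monotone_onI)
  fix d e :: real assume de: "d \<in> {1<..}" "e \<in> {1<..}" "d \<le> e"
  have d2: "1 \<le> d\<^sup>2" "1 \<le> e\<^sup>2" "d\<^sup>2 \<le> e\<^sup>2" using de by (auto simp: one_le_power intro: power_mono)
  have "e / sqrt (1 + (profile_radius e w)\<^sup>2) \<le> d / sqrt (1 + (profile_radius d w)\<^sup>2)" for w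
  proof -
    define C where "C = (cosh w)\<^sup>2"
    have C: "1 \<le> C" by (simp add: C_def one_le_power cosh_real_ge_1)
    have rad: "1 + (profile_radius x w)\<^sup>2 = 1 + (x\<^sup>2 - 1) * C" if "x > 1" for x
      using that by (simp add: profile_radius_def power_mult_distrib C_def one_le_power)
    have "(d\<^sup>2 - e\<^sup>2) * (1 - C) \<ge> 0" using d2 C by (intro mult_nonpos_nonpos) auto
    then have "e\<^sup>2 * (1 + (d\<^sup>2 - 1) * C) \<le> d\<^sup>2 * (1 + (e\<^sup>2 - 1) * C)" by (simp add: algebra_simps)
    then have "sqrt (e\<^sup>2 * (1 + (d\<^sup>2 - 1) * C)) \<le> sqrt (d\<^sup>2 * (1 + (e\<^sup>2 - 1) * C))" by simp
    then have "e * sqrt (1 + (profile_radius d w)\<^sup>2) \<le> d * sqrt (1 + (profile_radius e w)\<^sup>2)"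
      using de by (simp add: rad real_sqrt_mult)
    then show ?thesis
      using sqrt_one_plus_square_pos[of "profile_radius d w"] sqrt_one_plus_square_pos[of "profile_radius e w"]
      by (simp add: divide_simps mult.commute)
  qed
  then show "H_height d \<ge> H_height e"
    using de by (simp add: H_height_eq profile_limit_mono)
qed

text \<open>For larger \<open>d\<close> the numerator of the slope is larger and the radius is smaller.\<close>

theorem G_height_mono: "mono_on {0<..<1} G_height"
proof (rule monotone_onI)
  fix d e :: real assume de: "d \<in> {0<..<1}" "e \<in> {0<..<1}" "d \<le> e"
  have d2: "d\<^sup>2 \<le> 1" "e\<^sup>2 \<le> 1" "d\<^sup>2 \<le> e\<^sup>2" using de by (auto simp: abs_square_le_1 intro: power_mono)
  have "d / sqrt (1 + (profile_radius d w)\<^sup>2) \<le> e / sqrt (1 + (profile_radius e w)\<^sup>2)" for w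
  proof -
    have sq: "(sqrt (1 - d\<^sup>2))\<^sup>2 = 1 - d\<^sup>2" "(sqrt (1 - e\<^sup>2))\<^sup>2 = 1 - e\<^sup>2" using d2 by auto
    have "(profile_radius e w)\<^sup>2 \<le> (profile_radius d w)\<^sup>2"
      using de d2(3) by (auto simp: profile_radius_def power_mult_distrib sq intro!: mult_right_mono)
    then show ?thesis using de by (intro frac_le sqrt_one_plus_square_pos) auto
  qed
  then show "G_height d \<le> G_height e"
    using de by (simp add: G_height_eq profile_limit_mono)
qed

text \<open>If the radius tends to \<open>0\<close> at each parameter, the slope tends to \<open>1\<close> there, and the height at
  any parameter \<open>W\<close> eventually exceeds every number below \<open>W\<close>. The statement for filters covers
  both sides of \<open>d = 1\<close>.\<close>

lemma profile_limit_at_top_near_one: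
  assumes F: "eventually (\<lambda>d. 0 < d \<and> d \<noteq> 1) F" and lim: "((\<lambda>d. d) \<longlongrightarrow> 1) F"
    and rad: "\<And>w. ((\<lambda>d. profile_radius d w) \<longlongrightarrow> 0) F"
  shows "filterlim profile_limit at_top F"
  unfolding filterlim_at_top
proof
  fix Z :: real
  define W where "W = max 0 Z + 1"
  have "((\<lambda>d. W * (d / sqrt (1 + (profile_radius d W)\<^sup>2))) \<longlongrightarrow> W * (1 / sqrt (1 + 0\<^sup>2))) F"
    by (intro tendsto_intros lim rad) simp
  moreover have "Z < W * (1 / sqrt (1 + 0\<^sup>2))" by (simp add: W_def)
  ultimately have "eventually (\<lambda>d. Z < W * (d / sqrt (1 + (profile_radius d W)\<^sup>2))) F"
    by (rule order_tendstoD(1))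
  with F show "eventually (\<lambda>d. Z \<le> profile_limit d) F"
  proof eventually_elim
    case (elim d)
    have "W \<ge> 0" by (simp add: W_def)
    then show ?case using profile_height_lower_bound[of d W] profile_height_le_limit[of d W] elim by linarith
  qed
qed

theorem H_height_at_right_1: "filterlim H_height at_top (at_right 1)"
proof -
  have ev: "eventually (\<lambda>d. d > 1) (at_right (1::real))" by (simp add: eventually_at_filter)
  have "filterlim profile_limit at_top (at_right 1)"
  proof (rule profile_limit_at_top_near_one)
    show "eventually (\<lambda>d. 0 < d \<and> d \<noteq> 1) (at_right (1::real))" using ev by eventually_elim auto
    fix w :: real
    have "((\<lambda>d. sqrt (d\<^sup>2 - 1) * cosh w) \<longlongrightarrow> sqrt (1\<^sup>2 - 1) * cosh w) (at_right 1)" by (intro tendsto_intros)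
    then have "((\<lambda>d. sqrt (d\<^sup>2 - 1) * cosh w) \<longlongrightarrow> 0) (at_right 1)" by simp
    then show "((\<lambda>d. profile_radius d w) \<longlongrightarrow> 0) (at_right 1)"
      by (rule Lim_transform_eventually) (use ev in \<open>eventually_elim, simp add: profile_radius_def\<close>)
  qed (rule tendsto_ident_at)
  then show ?thesis
    by (rule filterlim_cong[THEN iffD1, rotated -1]) (use ev in \<open>auto elim: eventually_mono simp: H_height_eq\<close>)
qed

theorem G_height_at_left_1: "filterlim G_height at_top (at_left 1)"
proof -
  have ev: "eventually (\<lambda>d. 0 < d \<and> d < 1) (at_left (1::real))"
    by (auto simp: eventually_at_left_field intro!: exI[of _ 0])
  have "filterlim profile_limit at_top (at_left 1)"
  proof (rule profile_limit_at_top_near_one)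
    show "eventually (\<lambda>d. 0 < d \<and> d \<noteq> 1) (at_left (1::real))" using ev by eventually_elim auto
    fix w :: real
    have "((\<lambda>d. sqrt (1 - d\<^sup>2) * sinh w) \<longlongrightarrow> sqrt (1 - 1\<^sup>2) * sinh w) (at_left 1)" by (intro tendsto_intros)
    then have "((\<lambda>d. sqrt (1 - d\<^sup>2) * sinh w) \<longlongrightarrow> 0) (at_left 1)" by simp
    then show "((\<lambda>d. profile_radius d w) \<longlongrightarrow> 0) (at_left 1)"
      by (rule Lim_transform_eventually) (use ev in \<open>eventually_elim, simp add: profile_radius_def\<close>)
  qed (rule tendsto_ident_at)
  then show ?thesis
    by (rule filterlim_cong[THEN iffD1, rotated -1]) (use ev in \<open>auto elim: eventually_mono simp: G_height_eq\<close>)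
qed

theorem G_height_at_right_0: "(G_height \<longlongrightarrow> 0) (at_right 0)"
proof (rule tendsto_sandwich)
  have ev: "eventually (\<lambda>d. 0 < d \<and> d < 1) (at_right (0::real))"
    by (auto simp: eventually_at_right_field intro!: exI[of _ 1])
  show "\<forall>\<^sub>F d in at_right 0. 0 \<le> G_height d"
    using ev by eventually_elim (simp add: G_height_eq profile_limit_pos less_imp_le)
  show "\<forall>\<^sub>F d in at_right 0. G_height d \<le> d / sqrt \<bar>d\<^sup>2 - 1\<bar> * (pi / 2)"
    using ev by eventually_elim (use profile_limit_le in \<open>simp add: G_height_eq\<close>)
  have "((\<lambda>d. d / sqrt \<bar>d\<^sup>2 - 1\<bar> * (pi / 2)) \<longlongrightarrow> 0 / sqrt \<bar>0\<^sup>2 - 1\<bar> * (pi / 2)) (at_right (0::real))"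
    by (intro tendsto_intros) auto
  then show "((\<lambda>d. d / sqrt \<bar>d\<^sup>2 - 1\<bar> * (pi / 2)) \<longlongrightarrow> 0) (at_right (0::real))" by simp
qed (rule tendsto_const)

text \<open>Here \<open>sqrt (1 + \<phi>\<^sup>2) \<le> d cosh w\<close>, so that the slope of the height is at least that of
  \<open>arctan (sinh w)\<close>.\<close>

lemma H_height_ge: assumes "d > 1" shows "pi / 2 \<le> H_height d"
proof -
  have "1 / cosh w \<le> d / sqrt (1 + (profile_radius d w)\<^sup>2)" for w
  proof -
    have "1 \<le> d\<^sup>2" using assms by (simp add: one_le_power)
    then have "1 + (profile_radius d w)\<^sup>2 \<le> (d * cosh w)\<^sup>2"
      using assms one_le_power[OF cosh_real_ge_1, of w 2] by (simp add: profile_radius_def power_mult_distrib algebra_simps)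
    then have "sqrt (1 + (profile_radius d w)\<^sup>2) \<le> d * cosh w" using assms by (intro real_le_lsqrt) auto
    then show ?thesis using sqrt_one_plus_square_pos[of "profile_radius d w"] by (simp add: divide_simps mult.commute)
  qed
  then have "arctan (sinh w) \<le> profile_height d w" if "0 \<le> w" for w
    using DERIV_comparison[OF arctan_sinh_derivative profile_height_derivative[of d]] that assms
    by (simp add: profile_height_antiderivative(1))
  then have "pi / 2 \<le> profile_limit d"
    by (intro tendsto_le[OF _ profile_height_at_top arctan_sinh_at_top] eventually_at_top_linorderI[of 0])
      (use assms in auto)
  then show ?thesis using assms by (simp add: H_height_eq)
qed

theorem H_height_at_top: "(H_height \<longlongrightarrow> pi / 2) at_top"
proof (rule tendsto_sandwich)
  show "\<forall>\<^sub>F d in at_top. pi / 2 \<le> H_height d"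
    by (rule eventually_at_top_linorderI[of 2]) (use H_height_ge in auto)
  show "\<forall>\<^sub>F d in at_top. H_height d \<le> d / sqrt \<bar>d\<^sup>2 - 1\<bar> * (pi / 2)"
  proof (rule eventually_at_top_linorderI[of 2])
    fix d :: real assume "2 \<le> d"
    then have d: "0 < d" "d \<noteq> 1" "d > 1" by auto
    show "H_height d \<le> d / sqrt \<bar>d\<^sup>2 - 1\<bar> * (pi / 2)"
      unfolding H_height_eq[OF d(3)] by (rule profile_limit_le[OF d(1,2)])
  qed
  have "((\<lambda>d::real. d / sqrt \<bar>d\<^sup>2 - 1\<bar>) \<longlongrightarrow> 1) at_top" by real_asymp
  from tendsto_mult_right[OF this, of "pi / 2"]
  show "((\<lambda>d::real. d / sqrt \<bar>d\<^sup>2 - 1\<bar> * (pi / 2)) \<longlongrightarrow> pi / 2) at_top" by simp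
qed (rule tendsto_const)


section \<open>Behaviour at infinity\<close>

context ideal_pair
begin

definition c1 where "c1 = ccw_arc q1 q2"
definition c2 where "c2 = ccw_arc q2 q1"

lemma q_distinct: "q1 \<noteq> q2"
proof
  assume "q1 = q2"
  then have "cnj \<eta> = \<eta>" using m_nonzero by (simp add: q1_def q2_def)
  then have "Im (cnj \<eta>) = Im \<eta>" by simp
  then show False using Im_\<eta> by simp
qed

lemma q2_eq: "q2 = q1 * cis (2 * \<alpha>)"
  by (simp add: q1_def q2_def \<eta>_def cis_cnj cis_mult mult.assoc)

lemma q1_nonzero: "q1 \<noteq> 0" using norm_q by auto

lemma Arg2pi_q: "Arg2pi (q2 / q1) = 2 * \<alpha>" "Arg2pi (q1 / q2) = 2 * pi - 2 * \<alpha>"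
proof -
  show 1: "Arg2pi (q2 / q1) = 2 * \<alpha>"
    using \<alpha> q1_nonzero by (intro Arg2pi_unique[of 1]) (auto simp: q2_eq cis_conv_exp)
  show "Arg2pi (q1 / q2) = 2 * pi - 2 * \<alpha>"
    using Arg2pi_inverse_sum[OF norm_q q_distinct] 1 by simp
qed

text \<open>On the circle \<open>k\<close> is real, by the formula for a chord: a difference \<open>cis x - cis (- x)\<close> is
  \<open>2 \<i> sin x\<close>. The signs of the two sines decide on which side of the geodesic an ideal point
  lies.\<close>

lemma k_unit_circle:
  assumes "sin (\<alpha> - b) \<noteq> 0"
  shows "k (q1 * cis (2 * b)) = of_real (sin b / sin (\<alpha> - b))"
proof -
  have e: "cis x - cis (- x) = 2 * \<i> * of_real (sin x)" for x by (simp add: complex_eq_iff)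
  have "q1 * cis (2 * b) = m * (cis b * cis (b - \<alpha>))"
    by (simp add: q1_def \<eta>_def cis_cnj cis_mult mult.assoc)
  then have "k (q1 * cis (2 * b)) = (m * (1 - cis \<alpha> * (cis b * cis (b - \<alpha>)))) / (m * (cis b * cis (b - \<alpha>) - cis \<alpha>))"
    by (simp add: k_def \<eta>_def algebra_simps)
  also have "\<dots> = (1 - cis \<alpha> * (cis b * cis (b - \<alpha>))) / (cis b * cis (b - \<alpha>) - cis \<alpha>)"
    using m_nonzero by simp
  also have "1 - cis \<alpha> * (cis b * cis (b - \<alpha>)) = - (cis b * (cis b - cis (- b)))"
    by (simp add: right_diff_distrib cis_mult)
  also have "cis b * cis (b - \<alpha>) - cis \<alpha> = - (cis b * (cis (\<alpha> - b) - cis (- (\<alpha> - b))))"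
    by (simp add: right_diff_distrib cis_mult)
  also have "- (cis b * (cis b - cis (- b))) / - (cis b * (cis (\<alpha> - b) - cis (- (\<alpha> - b)))) = of_real (sin b / sin (\<alpha> - b))"
    unfolding e using assms by simp
  finally show ?thesis .
qed

text \<open>With \<open>q = q1 cis t\<close>, membership in the arcs is the comparison of \<open>t\<close> with \<open>2 \<alpha>\<close>, and so is the
  sign of \<open>k q = sin (t / 2) / sin (\<alpha> - t / 2)\<close>.\<close>

lemma ideal_sides:
  assumes q: "norm q = 1" "q \<noteq> q1" "q \<noteq> q2"
  obtains "q \<in> c1" "q \<notin> c2" "0 < Re (k q)" "k q = of_real (Re (k q))"
  | "q \<in> c2" "q \<notin> c1" "Re (k q) < 0" "k q = of_real (Re (k q))"
proof -
  define t where "t = Arg2pi (q / q1)"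
  note T = unit_quotient_Arg2pi[OF norm_q(1) q(1) q(2)[symmetric], folded t_def]
  have qt: "q = q1 * cis t" using T(1) q1_nonzero by (simp add: field_simps)
  have t2: "t \<noteq> 2 * \<alpha>" using q(3) qt q2_eq by auto
  have unique: "t = t'" if "q = q1 * cis t'" "0 \<le> t'" "t' < 2 * pi" for t'
    unfolding t_def using that q1_nonzero by (intro Arg2pi_unique[of 1]) (auto simp: cis_conv_exp)
  have c1: "q \<in> c1 \<longleftrightarrow> t < 2 * \<alpha>"
    unfolding c1_def ccw_arc_def Arg2pi_q
    using qt T t2 \<alpha> unique by (fastforce simp: image_iff)
  have c2: "q \<in> c2 \<longleftrightarrow> 2 * \<alpha> < t"
  proof
    assume "q \<in> c2"
    then obtain s where s: "0 \<le> s" "s \<le> 2 * pi - 2 * \<alpha>" "q = q2 * cis s"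
      unfolding c2_def ccw_arc_def Arg2pi_q by auto
    then have s3: "q = q1 * cis (2 * \<alpha> + s)" by (simp add: q2_eq cis_mult mult.assoc)
    have "2 * \<alpha> + s \<noteq> 2 * pi"
    proof
      assume "2 * \<alpha> + s = 2 * pi"
      then show False using s3 q(2) by (simp add: cis_2pi)
    qed
    then have "t = 2 * \<alpha> + s" using s \<alpha> by (intro unique[OF s3]) auto
    then show "2 * \<alpha> < t" using s t2 by simp
  next
    assume "2 * \<alpha> < t"
    moreover have "q = q2 * cis (t - 2 * \<alpha>)" unfolding qt q2_eq by (simp add: cis_mult mult.assoc)
    ultimately show "q \<in> c2"
      unfolding c2_def ccw_arc_def Arg2pi_q using T by (intro image_eqI[of _ _ "t - 2 * \<alpha>"]) auto
  qed
  have sb: "0 < sin (t / 2)" using T by (intro sin_gt_zero) auto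
  show ?thesis
  proof (cases "t < 2 * \<alpha>")
    case True
    have s: "0 < sin (\<alpha> - t / 2)" using True T \<alpha> by (intro sin_gt_zero) auto
    have "k q = of_real (sin (t / 2) / sin (\<alpha> - t / 2))" using k_unit_circle[of "t / 2"] s qt by simp
    then show ?thesis using that(1) c1 c2 True s sb by simp
  next
    case False
    then have "0 < sin (t / 2 - \<alpha>)" using T \<alpha> t2 by (intro sin_gt_zero) auto
    then have s: "sin (\<alpha> - t / 2) < 0" by (metis minus_diff_eq neg_0_less_iff_less sin_minus)
    have "k q = of_real (sin (t / 2) / sin (\<alpha> - t / 2))" using k_unit_circle[of "t / 2"] s qt by simp
    then show ?thesis using that(2) c1 c2 False t2 s sb by (simp add: divide_pos_neg)
  qed
qed

lemma ideal_points_in_arcs: "q1 \<in> c1" "q2 \<in> c1" "q1 \<in> c2" "q2 \<in> c2"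
  using arc_ccw_arc[OF norm_q q_distinct] arc_ccw_arc[OF norm_q(2,1) q_distinct[symmetric]]
  unfolding c1_def c2_def by (metis pathfinish_in_path_image pathstart_in_path_image)+

lemma arcs_subset_circle: "q \<in> c1 \<Longrightarrow> norm q = 1" "q \<in> c2 \<Longrightarrow> norm q = 1"
  by (auto simp: c1_def c2_def ccw_arc_def norm_mult norm_q)

lemma f_h: "\<zeta> \<in> half_plane \<Longrightarrow> f (h \<zeta>) = Re \<zeta> / Im \<zeta>"
  using denominator_nonzero[of \<zeta>] by (simp add: f_def k_h half_plane_def)

text \<open>At an ideal point other than the ends of the geodesic, \<open>Re \<zeta>\<close> has a nonzero limit and \<open>Im \<zeta>\<close>
  tends to \<open>0\<close>.\<close>

lemma f_tends_to_infinity: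
  assumes z: "\<And>n. z n \<in> disk" "z \<longlonglongrightarrow> q" and q: "norm q = 1" "q \<noteq> q2"
  shows "0 < Re (k q) \<Longrightarrow> filterlim (\<lambda>n. f (z n)) at_top sequentially"
    and "Re (k q) < 0 \<Longrightarrow> filterlim (\<lambda>n. f (z n)) at_bot sequentially"
proof -
  have "isCont k q"
    using continuous_k q(2) continuous_on_eq_continuous_at[of "- {m * \<eta>}" k] by (simp add: q2_def open_Compl)
  then have kz: "(\<lambda>n. k (z n)) \<longlonglongrightarrow> k q" using z(2) by (rule isCont_tendsto_compose)
  have "4 * Im \<eta> * Im (k q) = 0" using Im_k[of q] q by (simp add: q2_def)
  then have "Im (k q) = 0" using Im_\<eta> by simp
  then have Im: "(\<lambda>n. Im (k (z n))) \<longlonglongrightarrow> 0" using tendsto_Im[OF kz] by simp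
  have "Im (k (z n)) > 0" for n using k_in_half_plane[OF z(1)] by (simp add: half_plane_def)
  then have inv: "filterlim (\<lambda>n. inverse (Im (k (z n)))) at_top sequentially"
    using Im by (intro filterlim_inverse_at_top) auto
  have Re: "(\<lambda>n. Re (k (z n))) \<longlonglongrightarrow> Re (k q)" by (rule tendsto_Re[OF kz])
  show "0 < Re (k q) \<Longrightarrow> filterlim (\<lambda>n. f (z n)) at_top sequentially"
    using filterlim_tendsto_pos_mult_at_top[OF Re _ inv] by (simp add: f_def divide_inverse)
  show "Re (k q) < 0 \<Longrightarrow> filterlim (\<lambda>n. f (z n)) at_bot sequentially"
    using filterlim_tendsto_neg_mult_at_bot[OF Re _ inv] by (simp add: f_def divide_inverse)
qed

lemma isCont_h: "Im \<zeta> \<ge> 0 \<Longrightarrow> isCont h \<zeta>"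
  by (rule DERIV_isCont[OF h_derivative[OF denominator_nonzero]])

text \<open>The point of the ray \<open>f = a\<close> at height \<open>y\<close> is \<open>y (a + \<i>)\<close>.\<close>

lemma approach_ideal_point:
  fixes a y :: "nat \<Rightarrow> real"
  assumes y: "\<And>n. 0 < y n" and lim: "(\<lambda>n. of_real (y n) * (of_real (a n) + \<i>)) \<longlonglongrightarrow> of_real x"
  obtains z where "\<And>n. z n \<in> disk" "\<And>n. f (z n) = a n" "z \<longlonglongrightarrow> h (of_real x)"
proof (rule that)
  let ?\<zeta> = "\<lambda>n. of_real (y n) * (of_real (a n) + \<i>)"
  have \<zeta>: "?\<zeta> n \<in> half_plane" for n using y[of n] by (simp add: half_plane_def)
  show "h (?\<zeta> n) \<in> disk" for n by (rule h_in_disk[OF \<zeta>])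
  show "f (h (?\<zeta> n)) = a n" for n using f_h[OF \<zeta>[of n]] y[of n] by simp
  show "(\<lambda>n. h (?\<zeta> n)) \<longlonglongrightarrow> h (of_real x)"
    by (rule isCont_tendsto_compose[OF isCont_h lim]) simp
qed

lemma norm_real_plus_i: "norm (of_real a + \<i>) > 0"
  by (simp add: complex_eq_iff)

text \<open>All rays end in \<open>0\<close>, so \<open>q1\<close> can be approached with any values of \<open>f\<close>: move on the ray to
  distance \<open>1 / (n + 1)\<close> from \<open>0\<close>.\<close>

lemma approach_q1:
  obtains z where "\<And>n. z n \<in> disk" "\<And>n. f (z n) = a n" "z \<longlonglongrightarrow> q1"
proof -
  let ?y = "\<lambda>n. inverse (real (Suc n)) / norm (of_real (a n) + \<i>)"
  have "(\<lambda>n. of_real (?y n) * (of_real (a n) + \<i>)) \<longlonglongrightarrow> 0"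
  proof (rule tendsto_norm_zero_cancel)
    have "norm (of_real (?y n) * (of_real (a n) + \<i>)) = inverse (real (Suc n))" for n
    proof -
      have "0 < ?y n" using norm_real_plus_i[of "a n"] by simp
      then have "norm (of_real (?y n) * (of_real (a n) + \<i>)) = ?y n * norm (of_real (a n) + \<i>)"
        by (simp only: norm_mult norm_of_real abs_of_pos)
      then show ?thesis using norm_real_plus_i[of "a n"] by simp
    qed
    then show "(\<lambda>n. norm (of_real (?y n) * (of_real (a n) + \<i>))) \<longlonglongrightarrow> 0"
      using LIMSEQ_inverse_real_of_nat by simp
  qed
  then obtain z where "\<And>n. z n \<in> disk" "\<And>n. f (z n) = a n" "z \<longlonglongrightarrow> h (of_real 0)"
    using approach_ideal_point[of ?y a 0] norm_real_plus_i by auto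
  moreover have "h 0 = q1"
  proof -
    have "1 / \<eta> = cnj \<eta>" using \<eta>_cnj norm_\<eta> by (metis nonzero_eq_divide_eq mult.commute norm_zero zero_neq_one)
    then have "m * (1 / \<eta>) = q1" by (simp only: q1_def)
    then show ?thesis by (simp add: h_def)
  qed
  ultimately show ?thesis by (intro that[of z]) simp_all
qed

text \<open>All rays go to \<open>\<infinity>\<close>: move on the ray to distance \<open>n + 1\<close> from \<open>0\<close>.\<close>

lemma approach_q2:
  obtains z where "\<And>n. z n \<in> disk" "\<And>n. f (z n) = a n" "z \<longlonglongrightarrow> q2"
proof -
  let ?y = "\<lambda>n. real (Suc n) / norm (of_real (a n) + \<i>)"
  let ?\<zeta> = "\<lambda>n. of_real (?y n) * (of_real (a n) + \<i>)"
  have \<zeta>: "?\<zeta> n \<in> half_plane" for n using norm_real_plus_i[of "a n"] by (simp add: half_plane_def)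
  have norm_\<zeta>: "norm (?\<zeta> n) = real (Suc n)" for n
  proof -
    have "0 < ?y n" using norm_real_plus_i[of "a n"] by simp
    then have "norm (?\<zeta> n) = ?y n * norm (of_real (a n) + \<i>)"
      by (simp only: norm_mult norm_of_real abs_of_pos)
    then show ?thesis using norm_real_plus_i[of "a n"] by simp
  qed
  have "filterlim (\<lambda>n. norm (?\<zeta> n)) at_top sequentially"
    unfolding norm_\<zeta> by (rule filterlim_compose[OF filterlim_real_sequentially filterlim_Suc])
  then have "filterlim ?\<zeta> at_infinity sequentially"
    by (rule filterlim_norm_at_top_imp_at_infinity)
  from tendsto_add_filterlim_at_infinity'[OF this tendsto_const]
  have "filterlim (\<lambda>n. ?\<zeta> n + \<eta>) at_infinity sequentially" .
  from tendsto_add[OF tendsto_const tendsto_divide_0[OF tendsto_const this]]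
  have "(\<lambda>n. m * \<eta> + m * (1 - \<eta>\<^sup>2) / (?\<zeta> n + \<eta>)) \<longlonglongrightarrow> m * \<eta> + 0" .
  moreover have "h (?\<zeta> n) = m * \<eta> + m * (1 - \<eta>\<^sup>2) / (?\<zeta> n + \<eta>)" for n
  proof -
    have "?\<zeta> n + \<eta> \<noteq> 0" using \<zeta>[of n] by (intro denominator_nonzero) (simp add: half_plane_def)
    then have "h \<zeta> = m * \<eta> + m * (1 - \<eta>\<^sup>2) / (\<zeta> + \<eta>)" if "\<zeta> = ?\<zeta> n" for \<zeta>
      using that by (simp add: h_def add_divide_eq_iff) (simp add: power2_eq_square algebra_simps)
    then show ?thesis by simp
  qed
  ultimately have "(\<lambda>n. h (?\<zeta> n)) \<longlonglongrightarrow> q2" by (simp add: q2_def)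
  moreover have "f (h (?\<zeta> n)) = a n" for n
    using f_h[OF \<zeta>[of n]] norm_real_plus_i[of "a n"] by simp
  ultimately show ?thesis using that[of "\<lambda>n. h (?\<zeta> n)"] h_in_disk[OF \<zeta>] by blast
qed

text \<open>For large \<open>\<bar>a\<bar>\<close> take the height \<open>\<bar>x\<bar> / \<bar>a\<bar>\<close>, with \<open>x = k q\<close>; then \<open>Re \<zeta> = x\<close> and \<open>Im \<zeta>\<close> tends to
  \<open>0\<close>.\<close>

lemma approach_open_arc:
  assumes q: "norm q = 1" "q \<noteq> q1" "q \<noteq> q2"
    and a: "q \<in> c1 \<and> filterlim a at_top sequentially \<or> q \<in> c2 \<and> filterlim a at_bot sequentially"
  obtains z where "\<And>n. z n \<in> disk" "\<And>n. f (z n) = a n" "z \<longlonglongrightarrow> q"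
proof -
  define x where "x = Re (k q)"
  have x: "k q = of_real x" "x \<noteq> 0" and sides: "q \<in> c1 \<longleftrightarrow> 0 < x" "q \<in> c2 \<longleftrightarrow> x < 0"
    by (rule ideal_sides[OF q]; simp add: x_def)+
  \<comment> \<open>the maximum keeps the height positive for the finitely many small \<open>a n\<close>\<close>
  define y where "y n = \<bar>x\<bar> / max 1 \<bar>a n\<bar>" for n
  have y: "0 < y n" for n using x(2) by (simp add: y_def)
  have inf: "filterlim (\<lambda>n. \<bar>a n\<bar>) at_top sequentially"
    using a filterlim_at_infinity_imp_norm_at_top[of a] filterlim_at_top_imp_at_infinity[of a] filterlim_at_bot_imp_at_infinity[of a]
    by auto
  then have large: "eventually (\<lambda>n. 1 \<le> \<bar>a n\<bar>) sequentially" by (simp add: filterlim_at_top)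
  have "(\<lambda>n. \<bar>x\<bar> / \<bar>a n\<bar>) \<longlonglongrightarrow> 0"
    by (rule real_tendsto_divide_at_top[OF tendsto_const inf])
  moreover have "eventually (\<lambda>n. \<bar>x\<bar> / \<bar>a n\<bar> = y n) sequentially"
    using large by eventually_elim (simp add: y_def)
  ultimately have y0: "y \<longlonglongrightarrow> 0" by (rule Lim_transform_eventually)
  have "eventually (\<lambda>n. y n * a n = x) sequentially"
  proof -
    have sgn: "eventually (\<lambda>n. sgn (a n) = sgn x) sequentially"
    proof (cases "q \<in> c1")
      case True
      then have "filterlim a at_top sequentially" using a sides by auto
      then have "eventually (\<lambda>n. 0 < a n) sequentially" by (simp add: filterlim_at_top_dense)
      then show ?thesis by eventually_elim (use True sides in auto)
    next
      case False
      then have "filterlim a at_bot sequentially" "x < 0" using a sides by auto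
      then have "eventually (\<lambda>n. a n < 0) sequentially" by (simp add: filterlim_at_bot_dense)
      then show ?thesis by eventually_elim (use \<open>x < 0\<close> in auto)
    qed
    show ?thesis using sgn large
    proof eventually_elim
      case (elim n)
      have "y n * a n = \<bar>x\<bar> * (a n / \<bar>a n\<bar>)" using elim by (simp add: y_def)
      also have "a n / \<bar>a n\<bar> = sgn (a n)" by (simp add: sgn_if)
      also have "\<bar>x\<bar> * sgn (a n) = x" using elim by (simp add: abs_mult_sgn)
      finally show ?case .
    qed
  qed
  then have ya: "(\<lambda>n. y n * a n) \<longlonglongrightarrow> x" by (rule tendsto_eventually)
  have "(\<lambda>n. of_real (y n * a n) + of_real (y n) * \<i>) \<longlonglongrightarrow> of_real x + of_real 0 * \<i>"
    by (intro tendsto_intros ya y0)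
  then have "(\<lambda>n. of_real (y n) * (of_real (a n) + \<i>)) \<longlonglongrightarrow> of_real x"
    by (simp add: distrib_left)
  from approach_ideal_point[OF y this] obtain z where "\<And>n. z n \<in> disk" "\<And>n. f (z n) = a n" "z \<longlonglongrightarrow> h (of_real x)"
    by metis
  moreover have "h (of_real x) = q" using h_k(2)[of q] q(3) x(1) by (simp add: q2_def)
  ultimately show ?thesis by (intro that[of z]) simp_all
qed

definition profile_set :: "(real \<Rightarrow> real) \<Rightarrow> (real \<Rightarrow> real) \<Rightarrow> (complex \<times> real) set" where
  "profile_set \<phi> \<tau> = {(z, t). z \<in> disk \<and> (f z, t) \<in> range (\<lambda>w. (\<phi> w, \<tau> w))}"

text \<open>A sequence in the set is a sequence on the profile together with points of the disk on the
  matching level sets of \<open>f\<close>. Convergence to an ideal point off the ends of the geodesic forces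
  \<open>f\<close> to \<open>\<plusminus>\<infinity>\<close>, and the lemmas on approach show that there is no other restriction.\<close>

lemma asymptotic_boundary_profile_set:
  "(q, t) \<in> asymptotic_boundary (profile_set \<phi> \<tau>) \<longleftrightarrow>
     (q = q1 \<or> q = q2) \<and> t \<in> closure (range \<tau>) \<or>
     q \<in> c1 - {q1, q2} \<and> (\<exists>w. filterlim (\<lambda>n. \<phi> (w n)) at_top sequentially \<and> (\<lambda>n. \<tau> (w n)) \<longlonglongrightarrow> t) \<or>
     q \<in> c2 - {q1, q2} \<and> (\<exists>w. filterlim (\<lambda>n. \<phi> (w n)) at_bot sequentially \<and> (\<lambda>n. \<tau> (w n)) \<longlonglongrightarrow> t)"
    (is "?L \<longleftrightarrow> ?R")
proof
  assume ?L
  then obtain \<sigma> where q: "norm q = 1" and \<sigma>: "\<And>n. \<sigma> n \<in> profile_set \<phi> \<tau>" "\<sigma> \<longlonglongrightarrow> (q, t)"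
    unfolding asymptotic_boundary_def by auto
  have "\<exists>w. fst (\<sigma> n) \<in> disk \<and> f (fst (\<sigma> n)) = \<phi> w \<and> snd (\<sigma> n) = \<tau> w" for n
    using \<sigma>(1)[of n] by (auto simp: profile_set_def)
  then obtain w where w: "\<And>n. fst (\<sigma> n) \<in> disk" "\<And>n. f (fst (\<sigma> n)) = \<phi> (w n)" "\<And>n. snd (\<sigma> n) = \<tau> (w n)"
    by metis
  have z: "(\<lambda>n. fst (\<sigma> n)) \<longlonglongrightarrow> q" and t: "(\<lambda>n. \<tau> (w n)) \<longlonglongrightarrow> t"
    using tendsto_fst[OF \<sigma>(2)] tendsto_snd[OF \<sigma>(2)] by (simp_all add: w(3))
  have "t \<in> closure (range \<tau>)" using t by (auto simp: closure_sequential intro!: exI[of _ "\<lambda>n. \<tau> (w n)"])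
  moreover have ?R if q12: "q \<noteq> q1" "q \<noteq> q2"
  proof (rule ideal_sides[OF q q12])
    assume side: "q \<in> c1" "0 < Re (k q)"
    have "filterlim (\<lambda>n. \<phi> (w n)) at_top sequentially"
      using f_tends_to_infinity(1)[OF w(1) z q q12(2) side(2)] by (simp add: w(2))
    then show ?R using t q12 side(1) by blast
  next
    assume side: "q \<in> c2" "Re (k q) < 0"
    have "filterlim (\<lambda>n. \<phi> (w n)) at_bot sequentially"
      using f_tends_to_infinity(2)[OF w(1) z q q12(2) side(2)] by (simp add: w(2))
    then show ?R using t q12 side(1) by blast
  qed
  ultimately show ?R by blast
next
  assume R: ?R
  have q: "norm q = 1" using R norm_q arcs_subset_circle by auto
  have L: ?L if z: "\<And>n. z n \<in> disk" "\<And>n. f (z n) = \<phi> (w n)" "z \<longlonglongrightarrow> q" and t: "(\<lambda>n. \<tau> (w n)) \<longlonglongrightarrow> t" for z w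
  proof -
    have "(z n, \<tau> (w n)) \<in> profile_set \<phi> \<tau>" for n using z by (auto simp: profile_set_def)
    moreover have "(\<lambda>n. (z n, \<tau> (w n))) \<longlonglongrightarrow> (q, t)" by (rule tendsto_Pair[OF z(3) t])
    ultimately show ?L using q unfolding asymptotic_boundary_def by (auto intro!: exI[of _ "\<lambda>n. (z n, \<tau> (w n))"])
  qed
  show ?L
  proof (cases "q = q1 \<or> q = q2")
    case True
    then have "t \<in> closure (range \<tau>)" using R by auto
    then have "\<exists>u. (\<forall>n. u n \<in> range \<tau>) \<and> u \<longlonglongrightarrow> t" by (simp add: closure_sequential)
    then obtain u where u: "\<And>n. u n \<in> range \<tau>" "u \<longlonglongrightarrow> t" by auto
    have "\<exists>w. u n = \<tau> w" for n using u(1)[of n] by auto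
    then obtain w where "\<And>n. u n = \<tau> (w n)" by metis
    then have "u = (\<lambda>n. \<tau> (w n))" by auto
    then have w: "(\<lambda>n. \<tau> (w n)) \<longlonglongrightarrow> t" using u(2) by simp
    show ?L
    proof (cases "q = q1")
      case True
      obtain z where "\<And>n. z n \<in> disk" "\<And>n. f (z n) = \<phi> (w n)" "z \<longlonglongrightarrow> q1"
        using approach_q1[of "\<lambda>n. \<phi> (w n)"] by metis
      then show ?L using True w by (intro L[of z w]) auto
    next
      case False
      then have "q = q2" using \<open>q = q1 \<or> q = q2\<close> by simp
      obtain z where "\<And>n. z n \<in> disk" "\<And>n. f (z n) = \<phi> (w n)" "z \<longlonglongrightarrow> q2"
        using approach_q2[of "\<lambda>n. \<phi> (w n)"] by metis
      then show ?L using \<open>q = q2\<close> w by (intro L[of z w]) auto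
    qed
  next
    case False
    then obtain w where w: "(\<lambda>n. \<tau> (w n)) \<longlonglongrightarrow> t"
      "q \<in> c1 \<and> filterlim (\<lambda>n. \<phi> (w n)) at_top sequentially \<or> q \<in> c2 \<and> filterlim (\<lambda>n. \<phi> (w n)) at_bot sequentially"
      using R by blast
    have q12: "q \<noteq> q1" "q \<noteq> q2" using False by auto
    obtain z where "\<And>n. z n \<in> disk" "\<And>n. f (z n) = \<phi> (w n)" "z \<longlonglongrightarrow> q"
      using approach_open_arc[OF q q12 w(2)] by metis
    then show ?L using w(1) by (rule L)
  qed
qed

section \<open>Components of the complement of equidistant lines\<close>

definition level :: "real \<Rightarrow> complex set" where "level r = {z \<in> disk. f z = r}"
definition beyond :: "real \<Rightarrow> complex set" where "beyond r = {z \<in> disk. r < f z}"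

text \<open>The sides of an equidistant line are the images of sectors of the half plane, which are convex.\<close>

lemma connected_sides: "connected (beyond r)" "connected {z \<in> disk. f z < r}"
proof -
  have conn: "connected (h ` C)" if "convex C" "C \<subseteq> half_plane" for C
    using that isCont_h by (intro connected_continuous_image convex_connected continuous_at_imp_continuous_on)
      (auto simp: half_plane_def)
  have im: "{z \<in> disk. P (f z)} = h ` {\<zeta> \<in> half_plane. P (Re \<zeta> / Im \<zeta>)}" for P
  proof (intro equalityI subsetI)
    fix z assume "z \<in> {z \<in> disk. P (f z)}"
    then show "z \<in> h ` {\<zeta> \<in> half_plane. P (Re \<zeta> / Im \<zeta>)}"
      using h_k(2)[OF disk_nonideal] k_in_half_plane by (intro image_eqI[of _ _ "k z"]) (auto simp: f_def)
  qed (auto simp: h_in_disk f_h)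
  have hp: "\<zeta> \<in> half_plane \<and> r < Re \<zeta> / Im \<zeta> \<longleftrightarrow> 0 < Im \<zeta> \<and> r * Im \<zeta> < Re \<zeta>"
    "\<zeta> \<in> half_plane \<and> Re \<zeta> / Im \<zeta> < r \<longleftrightarrow> 0 < Im \<zeta> \<and> Re \<zeta> < r * Im \<zeta>" for \<zeta>
    by (auto simp: half_plane_def pos_less_divide_eq pos_divide_less_eq)
  have "{\<zeta> \<in> half_plane. r < Re \<zeta> / Im \<zeta>} = {\<zeta>. \<i> \<bullet> \<zeta> > 0} \<inter> {\<zeta>. (1 - of_real r * \<i>) \<bullet> \<zeta> > 0}"
    unfolding hp by (auto simp: inner_complex_def)
  then have "convex {\<zeta> \<in> half_plane. r < Re \<zeta> / Im \<zeta>}"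
    by (simp only: convex_Int convex_halfspace_gt)
  then show "connected (beyond r)" unfolding beyond_def im[of "\<lambda>x. r < x"] by (intro conn) auto
  have "{\<zeta> \<in> half_plane. Re \<zeta> / Im \<zeta> < r} = {\<zeta>. \<i> \<bullet> \<zeta> > 0} \<inter> {\<zeta>. (of_real r * \<i> - 1) \<bullet> \<zeta> > 0}"
    unfolding hp by (auto simp: inner_complex_def)
  then have "convex {\<zeta> \<in> half_plane. Re \<zeta> / Im \<zeta> < r}"
    by (simp only: convex_Int convex_halfspace_gt)
  then show "connected {z \<in> disk. f z < r}" unfolding im[of "\<lambda>x. x < r"] by (intro conn) auto
qed

lemma open_sides: "open (beyond r)" "open {z \<in> disk. f z < r}"
proof -
  have eq: "beyond r = disk \<inter> f -` {r<..}" "{z \<in> disk. f z < r} = disk \<inter> f -` {..<r}"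
    by (auto simp: beyond_def)
  show "open (beyond r)" "open {z \<in> disk. f z < r}"
    unfolding eq by (intro continuous_open_preimage continuous_f disk.open_domain; simp)+
qed

lemma ideal_boundary_beyond:
  assumes r: "0 \<le> r" shows "ideal_boundary (beyond r) = c1"
proof (intro equalityI subsetI)
  fix q assume "q \<in> ideal_boundary (beyond r)"
  then obtain \<sigma> where q: "norm q = 1" and \<sigma>: "\<And>n. \<sigma> n \<in> beyond r" "\<sigma> \<longlonglongrightarrow> q"
    unfolding ideal_boundary_def by auto
  show "q \<in> c1"
  proof (cases "q = q1 \<or> q = q2")
    case False
    then have q12: "q \<noteq> q1" "q \<noteq> q2" by auto
    show ?thesis
    proof (rule ideal_sides[OF q q12])
      assume "Re (k q) < 0"
      moreover have "\<sigma> n \<in> disk" for n using \<sigma>(1) by (auto simp: beyond_def)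
      ultimately have "filterlim (\<lambda>n. f (\<sigma> n)) at_bot sequentially"
        using f_tends_to_infinity(2)[of \<sigma> q] \<sigma> q q12 by blast
      then have "eventually (\<lambda>n. f (\<sigma> n) < r) sequentially" by (simp add: filterlim_at_bot_dense)
      then have "eventually (\<lambda>n. False) sequentially"
        by eventually_elim (use \<sigma>(1) in \<open>auto simp: beyond_def dest: less_asym\<close>)
      then show ?thesis by simp
    qed
  qed (use ideal_points_in_arcs in auto)
next
  fix q assume q: "q \<in> c1"
  let ?a = "\<lambda>n. r + 1 + real n"
  have a: "filterlim ?a at_top sequentially"
    by (rule filterlim_tendsto_add_at_top[OF tendsto_const filterlim_real_sequentially])
  obtain z where z: "\<And>n. z n \<in> disk" "\<And>n. f (z n) = ?a n" "z \<longlonglongrightarrow> q"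
    using approach_q1[of ?a] approach_q2[of ?a] approach_open_arc[of q ?a] q a arcs_subset_circle by metis
  then have "range z \<subseteq> beyond r" by (auto simp: beyond_def)
  then show "q \<in> ideal_boundary (beyond r)"
    using z arcs_subset_circle(1)[OF q] unfolding ideal_boundary_def by blast
qed

lemma midpoint_in_arc: "m \<in> c1" "m \<noteq> q1" "m \<noteq> q2" "0 < Re (k m)"
proof -
  have "cnj \<eta> \<noteq> 1" "\<eta> \<noteq> 1" using Im_\<eta> by (auto simp: complex_eq_iff)
  then show m12: "m \<noteq> q1" "m \<noteq> q2" using m_nonzero by (auto simp: q1_def q2_def)
  have "k m = 1"
  proof -
    have "\<eta> \<noteq> 1" using Im_\<eta> by auto
    then show ?thesis using m_nonzero by (simp add: k_def field_simps)
  qed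
  then show pos: "0 < Re (k m)" by simp
  show "m \<in> c1" by (rule ideal_sides[OF norm_m m12]) (use pos in auto)
qed

lemma midpoint_not_ideal_boundary: "m \<notin> ideal_boundary {z \<in> disk. f z < r}"
proof
  assume "m \<in> ideal_boundary {z \<in> disk. f z < r}"
  then obtain \<sigma> where \<sigma>: "\<And>n. \<sigma> n \<in> disk" "\<And>n. f (\<sigma> n) < r" "\<sigma> \<longlonglongrightarrow> m"
    unfolding ideal_boundary_def by auto
  have "filterlim (\<lambda>n. f (\<sigma> n)) at_top sequentially"
    using f_tends_to_infinity(1)[OF \<sigma>(1,3) norm_m] midpoint_in_arc by auto
  then have "eventually (\<lambda>n. r < f (\<sigma> n)) sequentially" by (simp add: filterlim_at_top_dense)
  then have "eventually (\<lambda>n. False) sequentially"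
    by eventually_elim (use \<sigma>(2) in \<open>auto dest: less_asym\<close>)
  then show False by simp
qed

lemma ideal_boundary_mono: "A \<subseteq> B \<Longrightarrow> ideal_boundary A \<subseteq> ideal_boundary B"
  unfolding ideal_boundary_def by blast

text \<open>Both sides of the line are connected and open, so they are the components. The ideal boundary
  selects one of them: the midpoint of \<open>c1\<close> is not an ideal point of the other side, because \<open>f\<close>
  tends to \<open>+\<infinity>\<close> there.\<close>

theorem the_component_level:
  assumes r: "0 \<le> r" shows "the_component (level r) c1 = beyond r"
  unfolding the_component_def
proof (rule the_equality)
  have split: "disk - level r = beyond r \<union> {z \<in> disk. f z < r}" by (auto simp: level_def beyond_def)
  have dichotomy: "C \<subseteq> beyond r \<or> C \<subseteq> {z \<in> disk. f z < r}" if "connected C" "C \<subseteq> disk - level r" for C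
  proof -
    have "beyond r \<inter> C = {} \<or> {z \<in> disk. f z < r} \<inter> C = {}"
      by (rule connectedD[OF that(1) open_sides(1) open_sides(2)]) (use that(2) split in \<open>auto simp: beyond_def\<close>)
    then show ?thesis using that(2) unfolding split by blast
  qed
  have nonempty: "beyond r \<noteq> {}"
    using midpoint_in_arc(1) ideal_boundary_beyond[OF r] by (auto simp: ideal_boundary_def)
  have "beyond r \<in> components (disk - level r)"
    unfolding in_components_maximal
  proof (intro conjI allI impI)
    fix D assume D: "D \<noteq> {} \<and> beyond r \<subseteq> D \<and> D \<subseteq> disk - level r \<and> connected D"
    then have "D \<subseteq> beyond r \<or> D \<subseteq> {z \<in> disk. f z < r}" using dichotomy by blast
    then show "D = beyond r" using D nonempty by (auto simp: beyond_def)
  qed (use nonempty connected_sides split in auto)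
  note component = this
  then show "beyond r \<in> components (disk - level r) \<and> ideal_boundary (beyond r) = c1"
    using ideal_boundary_beyond[OF r] by simp
  fix C assume C: "C \<in> components (disk - level r) \<and> ideal_boundary C = c1"
  then have "connected C" "C \<subseteq> disk - level r" "C \<noteq> {}"
    using in_components_connected in_components_subset in_components_nonempty by blast+
  moreover have "\<not> C \<subseteq> {z \<in> disk. f z < r}"
    using C midpoint_in_arc(1) midpoint_not_ideal_boundary ideal_boundary_mono by blast
  ultimately have "C \<subseteq> beyond r" using dichotomy by blast
  then have "C \<inter> beyond r \<noteq> {}" using \<open>C \<noteq> {}\<close> by blast
  then show "C = beyond r"
    using C component components_nonoverlap by blast
qed

text \<open>A point on the line is a limit of points beyond it: move it horizontally in the half plane.\<close>

lemma closure_beyond: "closure (beyond r) \<inter> disk = {z \<in> disk. r \<le> f z}"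
proof (intro equalityI subsetI)
  fix z assume z: "z \<in> closure (beyond r) \<inter> disk"
  then have "\<exists>\<sigma>. (\<forall>n. \<sigma> n \<in> beyond r) \<and> \<sigma> \<longlonglongrightarrow> z" by (simp add: closure_sequential)
  then obtain \<sigma> where \<sigma>: "\<And>n. \<sigma> n \<in> beyond r" "\<sigma> \<longlonglongrightarrow> z" by auto
  have "isCont f z" using continuous_f disk.open_domain z by (auto simp: continuous_on_eq_continuous_at)
  then have "(\<lambda>n. f (\<sigma> n)) \<longlonglongrightarrow> f z" using \<sigma>(2) by (rule isCont_tendsto_compose)
  then have "r \<le> f z"
    by (rule LIMSEQ_le_const) (use \<sigma>(1) in \<open>auto simp: beyond_def less_imp_le\<close>)
  then show "z \<in> {z \<in> disk. r \<le> f z}" using z by simp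
next
  fix z assume "z \<in> {z \<in> disk. r \<le> f z}"
  then have z: "z \<in> disk" "r \<le> f z" by auto
  let ?\<zeta> = "\<lambda>n. k z + of_real (inverse (real (Suc n)))"
  have Im: "Im (k z) > 0" using k_in_half_plane[OF z(1)] by (simp add: half_plane_def)
  have hp: "?\<zeta> n \<in> half_plane" for n using Im by (simp add: half_plane_def)
  have beyond: "f (h (k z + of_real e)) > r" if e: "e > 0" for e
  proof -
    have "k z + of_real e \<in> half_plane" using Im by (simp add: half_plane_def)
    then have "f (h (k z + of_real e)) = (Re (k z) + e) / Im (k z)" by (simp add: f_h)
    moreover have "f z < (Re (k z) + e) / Im (k z)"
      unfolding f_def using Im e by (intro divide_strict_right_mono) auto
    ultimately show ?thesis using z(2) by simp
  qed
  have "f (h (?\<zeta> n)) > r" for n by (rule beyond) simp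
  then have "h (?\<zeta> n) \<in> beyond r" for n using h_in_disk[OF hp] by (simp add: beyond_def)
  moreover have "?\<zeta> \<longlonglongrightarrow> k z + of_real 0"
    by (intro tendsto_intros LIMSEQ_inverse_real_of_nat)
  then have "?\<zeta> \<longlonglongrightarrow> k z" by simp
  then have "(\<lambda>n. h (?\<zeta> n)) \<longlonglongrightarrow> h (k z)"
    using Im by (intro isCont_tendsto_compose[OF isCont_h]) auto
  then have "(\<lambda>n. h (?\<zeta> n)) \<longlonglongrightarrow> z" using h_k(2)[OF disk_nonideal[OF z(1)]] by simp
  ultimately have "(\<forall>n. h (?\<zeta> n) \<in> beyond r) \<and> (\<lambda>n. h (?\<zeta> n)) \<longlonglongrightarrow> z"
    by (intro conjI allI)
  then have "z \<in> closure (beyond r)" unfolding closure_sequential by (rule exI[of _ "\<lambda>n. h (?\<zeta> n)"])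
  then show "z \<in> closure (beyond r) \<inter> disk" using z by simp
qed

end


section \<open>Distance to the geodesic\<close>

context ideal_pair
begin

lemma k_derivative:
  assumes z: "z \<in> disk" shows "(k has_field_derivative inverse (h' (k z))) (at z)"
proof -
  have kz: "k z \<in> half_plane" by (rule k_in_half_plane[OF z])
  have nz: "h' (k z) \<noteq> 0"
  proof
    assume "h' (k z) = 0"
    then have "1 / (Im (k z))\<^sup>2 = 0" using isometry[OF kz] by simp
    then show False using kz by (simp add: half_plane_def)
  qed
  have "(k has_field_derivative inverse (h' (k z))) (at (h (k z)))"
    by (rule has_field_derivative_inverse_strong[OF h[OF kz] nz half_plane.open_domain kz])
      (use smooth_on_imp_continuous_on[OF smooth_h] local.k_h kz in \<open>auto simp: half_plane_def denominator_nonzero\<close>)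
  then show ?thesis using local.h_k(2)[OF disk_nonideal[OF z]] by simp
qed

text \<open>The signed distance to the geodesic has a gradient of length at most \<open>1\<close>. In the half plane this
  is \<open>\<bar>Re u Im \<zeta> - Re \<zeta> Im u\<bar> \<le> \<bar>u\<bar> \<bar>\<zeta>\<bar>\<close>, the Cauchy-Schwarz inequality.\<close>

lemma arsinh_f_derivative:
  assumes z: "z \<in> disk"
  shows "\<exists>D. ((\<lambda>z. arsinh (f z)) has_derivative D) (at z) \<and> (\<forall>v. \<bar>D v\<bar> \<le> sqrt (disk_metric z v v))"
proof -
  let ?\<zeta> = "k z" and ?k' = "inverse (h' (k z))"
  have kz: "?\<zeta> \<in> half_plane" and y: "Im ?\<zeta> > 0" using k_in_half_plane[OF z] by (auto simp: half_plane_def)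
  have dk: "(k has_derivative (\<lambda>v. ?k' * v)) (at z)"
    using k_derivative[OF z] by (simp add: has_field_derivative_def)
  let ?F = "\<lambda>v. (Re (?k' * v) * Im ?\<zeta> - Re ?\<zeta> * Im (?k' * v)) / (Im ?\<zeta> * Im ?\<zeta>)"
  have df: "(f has_derivative ?F) (at z)"
    unfolding f_def[abs_def] using y
    by (intro has_derivative_divide' bounded_linear.has_derivative[OF bounded_linear_Re dk]
        bounded_linear.has_derivative[OF bounded_linear_Im dk]) auto
  have D: "((\<lambda>z. arsinh (f z)) has_derivative (\<lambda>v. 1 / sqrt ((f z)\<^sup>2 + 1) * ?F v)) (at z)"
    using has_derivative_compose[OF df arsinh_real_has_field_derivative[unfolded has_field_derivative_def]] .
  have scale: "sqrt (disk_metric z v v) = norm (?k' * v) / Im ?\<zeta>" for v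
  proof -
    have iso: "4 / (1 - (norm z)\<^sup>2)\<^sup>2 * (norm (h' ?\<zeta>))\<^sup>2 = 1 / (Im ?\<zeta>)\<^sup>2"
      using isometry[OF kz] local.h_k(2)[OF disk_nonideal[OF z]] by simp
    have "h' ?\<zeta> \<noteq> 0" using iso y by auto
    then have kn: "(norm (h' ?\<zeta>))\<^sup>2 * (norm ?k')\<^sup>2 = 1"
      by (simp add: norm_inverse flip: power_mult_distrib)
    have "4 / (1 - (norm z)\<^sup>2)\<^sup>2 = 4 / (1 - (norm z)\<^sup>2)\<^sup>2 * ((norm (h' ?\<zeta>))\<^sup>2 * (norm ?k')\<^sup>2)"
      by (simp only: kn mult_1_right)
    also have "\<dots> = 1 / (Im ?\<zeta>)\<^sup>2 * (norm ?k')\<^sup>2" by (simp only: mult.assoc[symmetric] iso)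
    finally have factor: "4 / (1 - (norm z)\<^sup>2)\<^sup>2 = 1 / (Im ?\<zeta>)\<^sup>2 * (norm ?k')\<^sup>2" .
    have "disk_metric z v v = (norm (?k' * v) / Im ?\<zeta>)\<^sup>2"
      unfolding disk.metric factor power2_norm_eq_inner[symmetric] norm_mult by (simp add: power_mult_distrib power_divide)
    then show ?thesis using y by simp
  qed
  have bound: "\<bar>1 / sqrt ((f z)\<^sup>2 + 1) * ?F v\<bar> \<le> sqrt (disk_metric z v v)" for v
  proof -
    let ?u = "?k' * v"
    have norm_\<zeta>: "sqrt ((f z)\<^sup>2 + 1) = norm ?\<zeta> / Im ?\<zeta>"
    proof -
      have "(f z)\<^sup>2 + 1 = (norm ?\<zeta> / Im ?\<zeta>)\<^sup>2"
        using y by (simp add: f_def cmod_power2 power_divide add_divide_distrib)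
      then show ?thesis using y by simp
    qed
    have "\<bar>Re u * Im w - Re w * Im u\<bar> \<le> norm u * norm w" for u w
    proof -
      have "Re u * Im w - Re w * Im u = (\<i> * u) \<bullet> w" by (simp add: inner_complex_def)
      then show ?thesis using Cauchy_Schwarz_ineq2[of "\<i> * u" w] by (simp add: norm_mult)
    qed
    then have "\<bar>Re ?u * Im ?\<zeta> - Re ?\<zeta> * Im ?u\<bar> \<le> norm ?u * norm ?\<zeta>" .
    moreover have nz: "norm ?\<zeta> > 0" using y by auto
    ultimately have "\<bar>Re ?u * Im ?\<zeta> - Re ?\<zeta> * Im ?u\<bar> / (norm ?\<zeta> * Im ?\<zeta>) \<le> norm ?u / Im ?\<zeta>"
      using y by (simp add: field_simps)
    moreover have "\<bar>1 / sqrt ((f z)\<^sup>2 + 1) * ?F v\<bar> = \<bar>Re ?u * Im ?\<zeta> - Re ?\<zeta> * Im ?u\<bar> / (norm ?\<zeta> * Im ?\<zeta>)"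
      unfolding norm_\<zeta> using y nz by (simp add: abs_mult abs_divide)
    ultimately show ?thesis unfolding scale by (simp only:)
  qed
  show ?thesis using D bound by blast
qed

lemma distance_to_geodesic_ge:
  assumes p: "p \<in> disk" and q: "q \<in> level 0"
  shows "ennreal \<bar>arsinh (f p)\<bar> \<le> path_dist disk_metric disk p q"
proof -
  obtain D where D: "\<And>z. z \<in> disk \<Longrightarrow> ((\<lambda>z. arsinh (f z)) has_derivative D z) (at z)"
    "\<And>z v. z \<in> disk \<Longrightarrow> \<bar>D z v\<bar> \<le> sqrt (disk_metric z v v)"
    using arsinh_f_derivative by metis
  have "ennreal \<bar>arsinh (f q) - arsinh (f p)\<bar> \<le> path_dist disk_metric disk p q"
    by (rule path_dist_ge[where f' = D]) (use D in auto)
  then show ?thesis using q by (simp add: level_def)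
qed

text \<open>The unit circle of the half plane as a unit speed geodesic; it meets the imaginary axis
  orthogonally at \<open>u = 0\<close>, and \<open>Re \<zeta> / Im \<zeta> = sinh u\<close> along it.\<close>

definition half_circle :: "real \<Rightarrow> complex" where
  "half_circle u = of_real (tanh u) + \<i> * of_real (1 / cosh u)"

lemma sech_tanh_squares: "(1 / cosh u)\<^sup>2 + (tanh u)\<^sup>2 = (1::real)"
proof -
  have c: "(cosh u)\<^sup>2 \<noteq> 0" using cosh_real_pos[of u] by simp
  have "(1 / cosh u)\<^sup>2 + (tanh u)\<^sup>2 = (1 + (sinh u)\<^sup>2) / (cosh u)\<^sup>2"
    by (simp add: tanh_def power_divide add_divide_distrib)
  also have "1 + (sinh u)\<^sup>2 = (cosh u)\<^sup>2" by (simp add: cosh_square_eq)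
  finally show ?thesis using c by simp
qed

lemma half_circle_derivative:
  "(half_circle has_vector_derivative of_real (1 / cosh u) * (of_real (1 / cosh u) - \<i> * of_real (tanh u))) (at u)"
proof -
  have c: "cosh u \<noteq> 0" by (metis cosh_real_pos less_irrefl)
  have "1 - (tanh u)\<^sup>2 = (1 / cosh u) * (1 / cosh u)"
    using sech_tanh_squares[of u] by (simp add: power2_eq_square)
  moreover have "(tanh has_real_derivative 1 - (tanh u)\<^sup>2) (at u)"
    using has_field_derivative_tanh[OF c DERIV_ident, of UNIV] by simp
  ultimately have t: "(tanh has_real_derivative (1 / cosh u) * (1 / cosh u)) (at u)" by (simp only:)
  have dc: "(cosh has_real_derivative sinh u) (at u)"
    by (auto intro!: derivative_eq_intros)
  have s: "((\<lambda>u. 1 / cosh u) has_real_derivative - (1 / cosh u * tanh u)) (at u)"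
    by (rule DERIV_cong[OF DERIV_divide[OF DERIV_const dc c]]) (simp add: tanh_def)
  have "(half_circle has_vector_derivative of_real ((1 / cosh u) * (1 / cosh u)) + \<i> * of_real (- (1 / cosh u * tanh u))) (at u)"
    unfolding half_circle_def[abs_def]
    by (intro has_vector_derivative_add has_vector_derivative_mult_right has_vector_derivative_of_real
        has_real_derivative_iff_has_vector_derivative[THEN iffD1] t s)
  then show ?thesis by (simp add: algebra_simps)
qed

lemma half_circle_in: "R > 0 \<Longrightarrow> of_real R * half_circle u \<in> half_plane"
  by (simp add: half_circle_def half_plane_def)

lemma norm_half_circle_velocity: "norm (of_real (1 / cosh u) - \<i> * of_real (tanh u)) = 1"
proof -
  show ?thesis using sech_tanh_squares[of u] by (simp add: cmod_def)
qed

text \<open>The half circle around \<open>0\<close> through the point is the perpendicular to the imaginary axis; the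
  part of it between the point and the axis has the length \<open>\<bar>arsinh (f p)\<bar>\<close>.\<close>

lemma distance_to_geodesic_le:
  assumes p: "p \<in> disk"
  shows "\<exists>q\<in>level 0. path_dist disk_metric disk p q \<le> ennreal \<bar>arsinh (f p)\<bar>"
proof -
  let ?\<zeta> = "k p" and ?R = "norm (k p)" and ?\<rho> = "arsinh (f p)"
  have y: "Im ?\<zeta> > 0" using k_in_half_plane[OF p] by (simp add: half_plane_def)
  then have R: "?R > 0" by auto
  define b where "b s = of_real ?R * half_circle (?\<rho> * (1 - s))" for s
  define b' where "b' s = of_real (- (?\<rho> * ?R) * (1 / cosh (?\<rho> * (1 - s)))) * (of_real (1 / cosh (?\<rho> * (1 - s))) - \<i> * of_real (tanh (?\<rho> * (1 - s))))" for s
  have b_in: "b s \<in> half_plane" for s unfolding b_def by (rule half_circle_in[OF R])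
  have db: "(b has_vector_derivative b' s) (at s)" for s
  proof -
    have "((\<lambda>s. ?\<rho> * (1 - s)) has_vector_derivative - ?\<rho>) (at s)"
      unfolding has_real_derivative_iff_has_vector_derivative[symmetric] by (auto intro!: derivative_eq_intros)
    from vector_diff_chain_at[OF this half_circle_derivative]
    have "((\<lambda>s. half_circle (?\<rho> * (1 - s))) has_vector_derivative
      (- ?\<rho>) *\<^sub>R (of_real (1 / cosh (?\<rho> * (1 - s))) * (of_real (1 / cosh (?\<rho> * (1 - s))) - \<i> * of_real (tanh (?\<rho> * (1 - s)))))) (at s)"
      by (simp add: o_def)
    from has_vector_derivative_mult_right[OF this, of "of_real ?R"]
    show ?thesis unfolding b_def[abs_def] b'_def by (simp add: scaleR_conv_of_real mult_ac)
  qed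
  have dh: "((\<lambda>s. h (b s)) has_vector_derivative h' (b s) * b' s) (at s)" for s
    using field_vector_diff_chain_at[OF db h[OF b_in]] by (simp add: o_def mult.commute)
  have nz: "cosh (x::real) \<noteq> 0" for x by (metis cosh_real_pos less_irrefl)
  have "path_dist disk_metric disk (h (b 0)) (h (b 1)) \<le> ennreal \<bar>?\<rho>\<bar>"
  proof (rule path_dist_le)
    have bc: "continuous_on UNIV b" using db by (auto intro!: continuous_at_imp_continuous_on has_vector_derivative_continuous)
    have hc: "continuous_on half_plane h'"
      unfolding h'_def[abs_def] by (intro continuous_intros) (auto simp: half_plane_def denominator_nonzero)
    have "continuous_on {0..1} (\<lambda>s. h' (b s))"
      by (rule continuous_on_compose2[OF hc continuous_on_subset[OF bc subset_UNIV]]) (use b_in in auto)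
    moreover have "continuous_on {0..1} b'"
      unfolding b'_def[abs_def] by (intro continuous_intros) (auto simp: nz)
    ultimately have "continuous_on {0..1} (\<lambda>s. h' (b s) * b' s)" by (rule continuous_on_mult)
    then show "(\<lambda>s. h (b s)) C1_differentiable_on {0..1}"
      unfolding C1_differentiable_on_def using dh by (intro exI[of _ "\<lambda>s. h' (b s) * b' s"]) simp
    show "(\<lambda>s. h (b s)) ` {0..1} \<subseteq> disk" using h_in_disk[OF b_in] by auto
    fix s :: real
    have "Im (b s) = ?R * (1 / cosh (?\<rho> * (1 - s)))" by (simp add: b_def half_circle_def)
    then have nb': "norm (b' s) = \<bar>?\<rho>\<bar> * Im (b s)"
      unfolding b'_def norm_mult norm_half_circle_velocity norm_of_real using R by (simp add: abs_mult)
    have "disk_metric (h (b s)) (h' (b s) * b' s) (h' (b s) * b' s) = (4 / (1 - (norm (h (b s)))\<^sup>2)\<^sup>2 * (norm (h' (b s)))\<^sup>2) * (norm (b' s))\<^sup>2"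
      by (simp add: disk.metric power2_norm_eq_inner[symmetric] norm_mult power_mult_distrib)
    also have "\<dots> = ?\<rho>\<^sup>2"
      unfolding isometry[OF b_in] nb' using b_in[of s] by (simp add: half_plane_def power_mult_distrib)
    finally show "sqrt (disk_metric (h (b s)) (vector_derivative (\<lambda>s. h (b s)) (at s)) (vector_derivative (\<lambda>s. h (b s)) (at s))) \<le> \<bar>?\<rho>\<bar>"
      using vector_derivative_at[OF dh] by simp
  qed
  moreover have "b 0 = ?\<zeta>"
  proof -
    have "(f p)\<^sup>2 + 1 = (?R / Im ?\<zeta>)\<^sup>2"
      using y by (simp add: f_def cmod_power2 power_divide add_divide_distrib)
    then have c: "cosh ?\<rho> = ?R / Im ?\<zeta>" using y by (simp add: cosh_arsinh_real)
    have "tanh ?\<rho> = Re ?\<zeta> / ?R" using y R by (simp add: tanh_def c) (simp add: f_def)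
    then show ?thesis using y R by (simp add: b_def half_circle_def c complex_eq_iff)
  qed
  ultimately have "path_dist disk_metric disk p (h (b 1)) \<le> ennreal \<bar>?\<rho>\<bar>"
    using local.h_k(2)[OF disk_nonideal[OF p]] by simp
  moreover have "h (b 1) \<in> level 0"
    using h_in_disk[OF b_in[of 1]] f_h[OF b_in[of 1]] by (simp add: level_def b_def half_circle_def)
  ultimately show ?thesis by (rule rev_bexI[rotated])
qed

lemma distance_to_geodesic:
  assumes p: "p \<in> disk"
  shows "(INF q\<in>level 0. path_dist disk_metric disk p q) = ennreal \<bar>arsinh (f p)\<bar>"
proof (rule antisym)
  obtain q where "q \<in> level 0" "path_dist disk_metric disk p q \<le> ennreal \<bar>arsinh (f p)\<bar>"
    using distance_to_geodesic_le[OF p] by blast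
  then show "(INF q\<in>level 0. path_dist disk_metric disk p q) \<le> ennreal \<bar>arsinh (f p)\<bar>" by (rule INF_lower2)
  show "ennreal \<bar>arsinh (f p)\<bar> \<le> (INF q\<in>level 0. path_dist disk_metric disk p q)"
    by (rule INF_greatest) (rule distance_to_geodesic_ge[OF p])
qed

text \<open>Since \<open>sinh (arcosh d) = sqrt (d\<^sup>2 - 1)\<close>, the distance is \<open>arcosh d\<close> exactly where \<open>f\<close> has this
  value.\<close>

theorem equidistant_line_eq:
  assumes d: "d > 1"
  shows "equidistant_line (level 0) (beyond 0) (arcosh d) = level (sqrt (d\<^sup>2 - 1))"
proof -
  have pos: "sqrt (d\<^sup>2 - 1) > 0" using d by (simp add: one_less_power)
  have s: "sinh (arcosh d) = sqrt (d\<^sup>2 - 1)" using d by (simp add: sinh_arcosh_real)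
  have "arsinh x = arcosh d \<longleftrightarrow> x = sqrt (d\<^sup>2 - 1)" for x
    using s arsinh_sinh_real[of "arcosh d"] sinh_arsinh_real[of x] by metis
  moreover have "\<bar>arsinh (f p)\<bar> = arsinh (f p)" "0 \<le> arsinh (f p)" if "0 < f p" for p
    using that arsinh_real_pos_iff[of "f p"] by linarith+
  moreover have "0 \<le> arcosh d" using d by simp
  ultimately have eq: "ennreal \<bar>arsinh (f p)\<bar> = ennreal (arcosh d) \<longleftrightarrow> f p = sqrt (d\<^sup>2 - 1)" if "0 < f p" for p
    using that by (simp add: ennreal_inj)
  show ?thesis
    unfolding equidistant_line_def
  proof (intro equalityI subsetI)
    fix p assume "p \<in> {p \<in> beyond 0. (INF q\<in>level 0. path_dist disk_metric disk p q) = ennreal (arcosh d)}"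
    then have "p \<in> disk" "0 < f p" "(INF q\<in>level 0. path_dist disk_metric disk p q) = ennreal (arcosh d)"
      by (auto simp: beyond_def)
    then show "p \<in> level (sqrt (d\<^sup>2 - 1))" using eq[of p] distance_to_geodesic[of p] by (simp add: level_def)
  next
    fix p assume "p \<in> level (sqrt (d\<^sup>2 - 1))"
    then have p: "p \<in> disk" "f p = sqrt (d\<^sup>2 - 1)" by (auto simp: level_def)
    then have "0 < f p" using pos by simp
    then show "p \<in> {p \<in> beyond 0. (INF q\<in>level 0. path_dist disk_metric disk p q) = ennreal (arcosh d)}"
      using p eq[of p] distance_to_geodesic[OF p(1)] by (simp add: beyond_def)
  qed
qed

section \<open>Translations along the geodesic\<close>

lemma range_geodesic:
  assumes c: "unit_speed_geodesic disk disk_metric c" and ends: "ideal_boundary (range c) = {q1, q2}"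
  shows "range c = level 0"
proof -
  obtain P e where P: "0 < P" "e = 1 \<or> e = -1" "\<And>s. c s = h (\<i> * of_real (P * exp (e * s)))"
    using geodesic_imaginary_axis[OF assms] by metis
  have in_hp: "\<i> * of_real (P * exp (e * s)) \<in> half_plane" for s using P(1) by (simp add: half_plane_def)
  show ?thesis
  proof (intro equalityI subsetI)
    fix z assume "z \<in> range c"
    then show "z \<in> level 0" using h_in_disk[OF in_hp] f_h[OF in_hp] by (auto simp: P(3) level_def)
  next
    fix z assume "z \<in> level 0"
    then have z: "z \<in> disk" "f z = 0" by (auto simp: level_def)
    have y: "Im (k z) > 0" using k_in_half_plane[OF z(1)] by (simp add: half_plane_def)
    define s where "s = e * ln (Im (k z) / P)"
    have "e * s = ln (Im (k z) / P)" using P(2) by (auto simp: s_def)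
    then have "P * exp (e * s) = Im (k z)" using P(1) y by simp
    moreover have "k z = \<i> * of_real (Im (k z))" using z(2) y by (simp add: f_def complex_eq_iff)
    ultimately have "c s = h (k z)" by (simp add: P(3))
    then show "z \<in> range c" using local.h_k(2)[OF disk_nonideal[OF z(1)]] by (metis rangeI)
  qed
qed

text \<open>On the geodesic the translation agrees with a dilation \<open>\<zeta> \<mapsto> L \<zeta>\<close>. Both maps are holomorphic on
  the disk and the geodesic has limit points, so they agree everywhere; and a dilation does not
  change \<open>Re \<zeta> / Im \<zeta>\<close>.\<close>

lemma hyperbolic_translation_preserves_f:
  assumes T: "hyperbolic_translation (level 0) T" and ends: "ideal_boundary (level 0) = {q1, q2}" and z: "z \<in> disk"
  shows "f (T z) = f z"
proof -
  obtain c \<tau> where hol: "T holomorphic_on disk" and c: "unit_speed_geodesic disk disk_metric c" "range c = level 0"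
    and Tc: "\<And>s. T (c s) = c (s + \<tau>)"
    using T by (auto simp: hyperbolic_translation_def)
  obtain P e where P: "0 < P" "e = 1 \<or> e = -1" "\<And>s. c s = h (\<i> * of_real (P * exp (e * s)))"
    using geodesic_imaginary_axis[OF c(1)] ends c(2) by metis
  define L where "L = exp (e * \<tau>)"
  have L: "L > 0" by (simp add: L_def)
  \<comment> \<open>\<open>T0\<close> is the dilation by \<open>L\<close>, read in the disk\<close>
  define T0 where "T0 z = h (of_real L * k z)" for z
  have in_hp: "of_real L * k z \<in> half_plane" if "z \<in> disk" for z
    using k_in_half_plane[OF that] L by (simp add: half_plane_def)
  have hol_k: "k holomorphic_on disk"
    using k_derivative disk.open_domain by (auto simp: holomorphic_on_open)
  have hol_h: "h holomorphic_on half_plane"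
    using h half_plane.open_domain by (auto simp: holomorphic_on_open)
  have "T0 holomorphic_on disk"
    unfolding T0_def[abs_def]
    using holomorphic_on_compose_gen[OF holomorphic_on_mult[OF holomorphic_on_const hol_k] hol_h, of "of_real L"] in_hp
    by (auto simp: o_def)
  with hol have hol0: "(\<lambda>z. T z - T0 z) holomorphic_on disk" by (rule holomorphic_on_diff)
  have on_line: "T z - T0 z = 0" if z: "z \<in> level 0" for z
  proof -
    obtain s where s: "z = c s" using z unfolding c(2)[symmetric] by blast
    have "\<i> * of_real (P * exp (e * s)) \<in> half_plane" using P(1) by (simp add: half_plane_def)
    then have "k z = \<i> * of_real (P * exp (e * s))" unfolding s P(3) by (rule half_plane_chart.k_h[OF half_plane_chart_axioms])
    then have "T0 z = c (s + \<tau>)" unfolding T0_def P(3) L_def by (simp add: distrib_left exp_add mult_ac)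
    then show ?thesis using Tc s by simp
  qed
  let ?z0 = "c 0"
  have z0: "?z0 \<in> disk" using c(2) by (auto simp: level_def)
  have "?z0 islimpt level 0"
    unfolding islimpt_sequential
  proof (intro exI[of _ "\<lambda>n. c (inverse (real (Suc n)))"] conjI allI)
    fix n
    have hp: "\<i> * of_real (P * exp (e * s)) \<in> half_plane" for s using P(1) by (simp add: half_plane_def)
    have "c (inverse (real (Suc n))) \<noteq> c 0"
    proof
      assume "c (inverse (real (Suc n))) = c 0"
      then have "k (c (inverse (real (Suc n)))) = k (c 0)" by simp
      then have "\<i> * complex_of_real (P * exp (e * inverse (real (Suc n)))) = \<i> * of_real (P * exp (e * 0))"
        unfolding P(3) half_plane_chart.k_h[OF half_plane_chart_axioms hp] .
      then have "exp (e * inverse (real (Suc n))) = exp (e * 0)" using P(1) by (simp del: of_nat_Suc)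
      then show False using P(2) by (auto simp del: of_nat_Suc)
    qed
    then show "c (inverse (real (Suc n))) \<in> level 0 - {c 0}" using c(2) by auto
    have "isCont c 0"
      using smooth_on_imp_continuous_on[of UNIV c] c(1) by (simp add: unit_speed_geodesic_def continuous_on_eq_continuous_at)
    then show "(\<lambda>n. c (inverse (real (Suc n)))) \<longlonglongrightarrow> c 0"
      using LIMSEQ_inverse_real_of_nat by (rule isCont_tendsto_compose)
  qed
  note limit_point = this
  have "T z - T0 z = 0"
  proof (rule analytic_continuation[OF hol0 disk.open_domain _ _ z0 limit_point on_line z])
    show "connected disk" by (simp add: disk_def)
    show "level 0 \<subseteq> disk" by (auto simp: level_def)
  qed
  then have "f (T z) = f (T0 z)" by simp
  also have "\<dots> = f z" unfolding T0_def f_h[OF in_hp[OF z]] using L by (simp add: f_def)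
  finally show ?thesis .
qed

theorem translation_invariant_profile_set:
  assumes ends: "ideal_boundary (level 0) = {q1, q2}"
  shows "translation_invariant (level 0) (profile_set \<phi> \<tau>)"
  unfolding translation_invariant_def
proof (intro allI impI)
  fix T assume T: "hyperbolic_translation (level 0) T"
  then have bij: "T ` disk = disk"
    by (simp add: hyperbolic_translation_def riemannian_isometry_def bij_betw_def)
  note fT = hyperbolic_translation_preserves_f[OF T ends]
  show "(\<lambda>(z, t). (T z, t)) ` profile_set \<phi> \<tau> = profile_set \<phi> \<tau>"
  proof (intro equalityI subsetI)
    fix p assume "p \<in> (\<lambda>(z, t). (T z, t)) ` profile_set \<phi> \<tau>"
    then show "p \<in> profile_set \<phi> \<tau>" using fT bij by (auto simp: profile_set_def)
  next
    fix p assume p: "p \<in> profile_set \<phi> \<tau>"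
    then have "fst p \<in> T ` disk" using bij by (auto simp: profile_set_def)
    then obtain z where z: "z \<in> disk" "fst p = T z" by auto
    then have "(z, snd p) \<in> profile_set \<phi> \<tau>" using p fT by (auto simp: profile_set_def)
    then show "p \<in> (\<lambda>(z, t). (T z, t)) ` profile_set \<phi> \<tau>"
      using z by (intro image_eqI[of _ _ "(z, snd p)"]) (auto simp: prod_eq_iff)
  qed
qed

end

section \<open>Completeness\<close>

text \<open>The Euclidean coordinates of the disk do not increase lengths.\<close>

lemma disk_metric_ge: assumes "z \<in> disk" shows "norm v \<le> sqrt (disk_metric z v v)"
proof -
  have z: "0 < 1 - (norm z)\<^sup>2" "1 - (norm z)\<^sup>2 \<le> 1" using assms by (auto simp: disk_iff)
  then have "(1 - (norm z)\<^sup>2)\<^sup>2 \<le> 1" by (simp add: power_le_one)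
  then have "1 * (norm v)\<^sup>2 \<le> 4 / (1 - (norm z)\<^sup>2)\<^sup>2 * (norm v)\<^sup>2"
    using z by (intro mult_right_mono) (auto simp: divide_simps)
  then show ?thesis by (intro real_le_rsqrt) (simp add: disk.metric power2_norm_eq_inner)
qed

lemma H2xR_metric_ge:
  assumes "p \<in> H2xR"
  shows "sqrt (disk_metric (fst p) (fst v) (fst v)) \<le> sqrt (H2xR_metric p v v)" "\<bar>snd v\<bar> \<le> sqrt (H2xR_metric p v v)"
proof -
  have "fst p \<in> disk" using assms by auto
  then have "0 \<le> disk_metric (fst p) (fst v) (fst v)"
    using disk.factor_pos[of "fst p"] by (simp add: disk.metric)
  then show "sqrt (disk_metric (fst p) (fst v) (fst v)) \<le> sqrt (H2xR_metric p v v)" "\<bar>snd v\<bar> \<le> sqrt (H2xR_metric p v v)"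
    by (auto simp: times_R_def power2_eq_square intro!: real_le_rsqrt)
qed

text \<open>The logarithm of \<open>(1 + \<bar>z\<bar>\<^sup>2) / (1 - \<bar>z\<bar>\<^sup>2)\<close>, which is the hyperbolic cosine of the distance to
  the origin. It does not increase lengths and is infinite on the ideal boundary, as the
  distance itself, but it is smooth at the origin too.\<close>

definition log_height :: "complex \<Rightarrow> real" where
  "log_height z = ln (1 + z \<bullet> z) - ln (1 - z \<bullet> z)"

text \<open>The differential is \<open>4 (z \<bullet> v) / ((1 + \<bar>z\<bar>\<^sup>2) (1 - \<bar>z\<bar>\<^sup>2))\<close>, and \<open>2 \<bar>z\<bar> \<le> 1 + \<bar>z\<bar>\<^sup>2\<close>.\<close>

lemma log_height_derivative:
  assumes z: "z \<in> disk"
  shows "(log_height has_derivative (\<lambda>v. 2 * (z \<bullet> v) / (1 + z \<bullet> z) + 2 * (z \<bullet> v) / (1 - z \<bullet> z))) (at z)"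
    and "\<bar>2 * (z \<bullet> v) / (1 + z \<bullet> z) + 2 * (z \<bullet> v) / (1 - z \<bullet> z)\<bar> \<le> sqrt (disk_metric z v v)"
proof -
  let ?s = "z \<bullet> z"
  have s: "0 \<le> ?s" "?s < 1" using z by (auto simp: disk_iff power2_norm_eq_inner)
  have d: "((\<lambda>z. z \<bullet> z) has_derivative (\<lambda>v. z \<bullet> v + v \<bullet> z)) (at z)"
    by (rule has_derivative_inner[OF has_derivative_ident has_derivative_ident])
  have "((\<lambda>s. ln (1 + s) - ln (1 - s)) has_real_derivative 1 / (1 + s) + 1 / (1 - s)) (at s)"
    if "0 \<le> s" "s < 1" for s :: real
    using that by (auto intro!: derivative_eq_intros simp: divide_simps)
  from this[OF s] have "((\<lambda>s. ln (1 + s) - ln (1 - s)) has_real_derivative 1 / (1 + ?s) + 1 / (1 - ?s)) (at ?s)" .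
  from has_derivative_compose[OF d this[unfolded has_field_derivative_def]]
  have "(log_height has_derivative (\<lambda>v. (1 / (1 + ?s) + 1 / (1 - ?s)) * (z \<bullet> v + v \<bullet> z))) (at z)"
    by (simp add: log_height_def[abs_def])
  moreover have eq: "(1 / (1 + ?s) + 1 / (1 - ?s)) * (z \<bullet> v + v \<bullet> z) = 2 * (z \<bullet> v) / (1 + ?s) + 2 * (z \<bullet> v) / (1 - ?s)" for v
    by (simp add: inner_commute distrib_right)
  ultimately show "(log_height has_derivative (\<lambda>v. 2 * (z \<bullet> v) / (1 + ?s) + 2 * (z \<bullet> v) / (1 - ?s))) (at z)" by simp
  have n: "(norm z)\<^sup>2 = ?s" by (simp add: power2_norm_eq_inner)
  have "2 * norm z \<le> 1 + ?s"
    using zero_le_power2[of "1 - norm z"] n by (simp add: power2_eq_square algebra_simps)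
  moreover have "0 < 1 + ?s" using s by linarith
  ultimately have a: "2 * norm z / (1 + ?s) \<le> 1" by (simp add: pos_divide_le_eq)
  have "2 * x / a + 2 * x / b = x * (2 / a) * (2 / b)" if "a \<noteq> 0" "b \<noteq> 0" "a + b = 2" for x a b :: real
  proof -
    have "2 * x / a + 2 * x / b = 2 * x * (a + b) / (a * b)" using that(1,2) by (simp add: field_simps)
    then show ?thesis by (simp add: that(3))
  qed
  from this[of "1 + ?s" "1 - ?s" "z \<bullet> v"] s
  have "2 * (z \<bullet> v) / (1 + ?s) + 2 * (z \<bullet> v) / (1 - ?s) = (z \<bullet> v) * (2 / (1 + ?s)) * (2 / (1 - ?s))"
    by linarith
  then have "\<bar>2 * (z \<bullet> v) / (1 + ?s) + 2 * (z \<bullet> v) / (1 - ?s)\<bar> = \<bar>z \<bullet> v\<bar> * (2 / (1 + ?s)) * (2 / (1 - ?s))"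
    using s by (simp add: abs_mult)
  also have "\<dots> \<le> (norm z * norm v) * (2 / (1 + ?s)) * (2 / (1 - ?s))"
    using s Cauchy_Schwarz_ineq2[of z v] by (intro mult_right_mono) auto
  also have "\<dots> = (2 * norm z / (1 + ?s)) * (norm v * (2 / (1 - ?s)))" by simp
  also have "\<dots> \<le> 1 * (norm v * (2 / (1 - ?s)))" using s a by (intro mult_right_mono) auto
  also have "\<dots> = sqrt (disk_metric z v v)"
  proof -
    have "disk_metric z v v = (norm v * (2 / (1 - ?s)))\<^sup>2"
      by (simp add: disk.metric n power_mult_distrib power_divide) (simp add: power2_norm_eq_inner)
    then show ?thesis using s by simp
  qed
  finally show "\<bar>2 * (z \<bullet> v) / (1 + ?s) + 2 * (z \<bullet> v) / (1 - ?s)\<bar> \<le> sqrt (disk_metric z v v)" .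
qed

text \<open>A function that does not increase lengths maps Cauchy sequences for the intrinsic distance of
  any subset to Cauchy sequences.\<close>

lemma Cauchy_of_lipschitz:
  fixes f :: "complex \<times> real \<Rightarrow> real"
  assumes M: "M \<subseteq> H2xR"
    and f: "\<And>x. x \<in> H2xR \<Longrightarrow> (f has_derivative f' x) (at x)" "\<And>x v. x \<in> H2xR \<Longrightarrow> \<bar>f' x v\<bar> \<le> sqrt (H2xR_metric x v v)"
    and \<sigma>: "\<And>\<epsilon>. \<epsilon> > 0 \<Longrightarrow> \<exists>N. \<forall>m\<ge>N. \<forall>n\<ge>N. path_dist H2xR_metric M (\<sigma> m) (\<sigma> n) < \<epsilon>"
  shows "convergent (\<lambda>n. f (\<sigma> n))"
  unfolding Cauchy_convergent_iff[symmetric]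
proof (rule metric_CauchyI)
  fix e :: real assume "0 < e"
  then obtain N where N: "\<And>m n. m \<ge> N \<Longrightarrow> n \<ge> N \<Longrightarrow> path_dist H2xR_metric M (\<sigma> m) (\<sigma> n) < ennreal e"
    using \<sigma>[of "ennreal e"] by auto
  have "dist (f (\<sigma> m)) (f (\<sigma> n)) < e" if "m \<ge> N" "n \<ge> N" for m n
  proof -
    have "ennreal \<bar>f (\<sigma> n) - f (\<sigma> m)\<bar> \<le> path_dist H2xR_metric M (\<sigma> m) (\<sigma> n)"
      by (rule path_dist_ge[where f' = f']) (use f M in auto)
    also have "\<dots> < ennreal e" by (rule N[OF that])
    finally show ?thesis by (simp add: dist_real_def abs_minus_commute ennreal_less_iff)
  qed
  then show "\<exists>N. \<forall>m\<ge>N. \<forall>n\<ge>N. dist (f (\<sigma> m)) (f (\<sigma> n)) < e" by blast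
qed

text \<open>Let a sequence be Cauchy for the intrinsic distance. The Euclidean coordinates and the height do
  not increase lengths, so the sequence converges in the closed disk times \<open>\<real>\<close>. Since
  \<open>log_height\<close> converges along it as well, the limit is not ideal: passing to the limit in
  \<open>exp (log_height z) (1 - \<bar>z\<bar>\<^sup>2) = 1 + \<bar>z\<bar>\<^sup>2\<close> shows \<open>\<bar>z\<bar> < 1\<close>. So the limit belongs to \<open>M\<close> when
  \<open>M\<close> is closed in \<open>H2xR\<close>, and convergence for the intrinsic distance is the second hypothesis.\<close>

theorem complete_surface_criterion:
  assumes M: "M \<subseteq> H2xR" and closed: "\<And>\<sigma> l. (\<And>n. \<sigma> n \<in> M) \<Longrightarrow> \<sigma> \<longlonglongrightarrow> l \<Longrightarrow> l \<in> H2xR \<Longrightarrow> l \<in> M"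
    and local: "\<And>\<sigma> l. (\<And>n. \<sigma> n \<in> M) \<Longrightarrow> l \<in> M \<Longrightarrow> \<sigma> \<longlonglongrightarrow> l \<Longrightarrow> (\<lambda>n. path_dist H2xR_metric M (\<sigma> n) l) \<longlonglongrightarrow> 0"
  shows "complete_surface H2xR_metric M"
  unfolding complete_surface_def
proof (intro allI impI)
  fix \<sigma> :: "nat \<Rightarrow> complex \<times> real"
  assume "range \<sigma> \<subseteq> M \<and> (\<forall>\<epsilon>>0. \<exists>N. \<forall>m\<ge>N. \<forall>n\<ge>N. path_dist H2xR_metric M (\<sigma> m) (\<sigma> n) < \<epsilon>)"
  then have \<sigma>M: "\<And>n. \<sigma> n \<in> M" and cauchy: "\<And>\<epsilon>. \<epsilon> > 0 \<Longrightarrow> \<exists>N. \<forall>m\<ge>N. \<forall>n\<ge>N. path_dist H2xR_metric M (\<sigma> m) (\<sigma> n) < \<epsilon>"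
    by auto
  note conv = Cauchy_of_lipschitz[OF M _ _ cauchy]
  have norm_le: "norm (fst v) \<le> sqrt (H2xR_metric p v v)" if "p \<in> H2xR" for p v
    by (rule order_trans[OF disk_metric_ge H2xR_metric_ge(1)[OF that]]) (use that in auto)
  have "convergent (\<lambda>n. Re (fst (\<sigma> n)))"
  proof (rule conv)
    show "((\<lambda>p. Re (fst p)) has_derivative (\<lambda>v. Re (fst v))) (at p)" for p :: "complex \<times> real"
      by (intro bounded_linear_imp_has_derivative bounded_linear_compose[OF bounded_linear_Re bounded_linear_fst, unfolded o_def])
    show "\<bar>Re (fst v)\<bar> \<le> sqrt (H2xR_metric p v v)" if "p \<in> H2xR" for p v
      using norm_le[OF that, of v] abs_Re_le_cmod[of "fst v"] by linarith
  qed
  then obtain x where x: "(\<lambda>n. Re (fst (\<sigma> n))) \<longlonglongrightarrow> x" by (auto simp: convergent_def)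
  have "convergent (\<lambda>n. Im (fst (\<sigma> n)))"
  proof (rule conv)
    show "((\<lambda>p. Im (fst p)) has_derivative (\<lambda>v. Im (fst v))) (at p)" for p :: "complex \<times> real"
      by (intro bounded_linear_imp_has_derivative bounded_linear_compose[OF bounded_linear_Im bounded_linear_fst, unfolded o_def])
    show "\<bar>Im (fst v)\<bar> \<le> sqrt (H2xR_metric p v v)" if "p \<in> H2xR" for p v
      using norm_le[OF that, of v] abs_Im_le_cmod[of "fst v"] by linarith
  qed
  then obtain y where y: "(\<lambda>n. Im (fst (\<sigma> n))) \<longlonglongrightarrow> y" by (auto simp: convergent_def)
  have "convergent (\<lambda>n. snd (\<sigma> n))"
  proof (rule conv)
    show "(snd has_derivative snd) (at p)" for p :: "complex \<times> real"
      by (intro bounded_linear_imp_has_derivative bounded_linear_snd)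
    show "\<bar>snd v\<bar> \<le> sqrt (H2xR_metric p v v)" if "p \<in> H2xR" for p v
      by (rule H2xR_metric_ge(2)[OF that])
  qed
  then obtain t where t: "(\<lambda>n. snd (\<sigma> n)) \<longlonglongrightarrow> t" by (auto simp: convergent_def)
  let ?D = "\<lambda>p v. 2 * (fst p \<bullet> fst v) / (1 + fst p \<bullet> fst p) + 2 * (fst p \<bullet> fst v) / (1 - fst p \<bullet> fst p)"
  have "convergent (\<lambda>n. log_height (fst (\<sigma> n)))"
  proof (rule conv)
    fix p :: "complex \<times> real" assume p: "p \<in> H2xR"
    then have p': "fst p \<in> disk" by auto
    show "((\<lambda>p. log_height (fst p)) has_derivative ?D p) (at p)"
      by (rule has_derivative_compose[OF has_derivative_fst[OF has_derivative_ident] log_height_derivative(1)[OF p']])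
    show "\<bar>?D p v\<bar> \<le> sqrt (H2xR_metric p v v)" for v
      using log_height_derivative(2)[OF p', of "fst v"] H2xR_metric_ge(1)[OF p, of v] by linarith
  qed
  then obtain L where L: "(\<lambda>n. log_height (fst (\<sigma> n))) \<longlonglongrightarrow> L" by (auto simp: convergent_def)
  define z where "z = Complex x y"
  have z: "(\<lambda>n. fst (\<sigma> n)) \<longlonglongrightarrow> z"
    using tendsto_Complex[OF x y] by (simp add: z_def)
  have in_disk: "fst (\<sigma> n) \<in> disk" for n using \<sigma>M[of n] M by auto
  have "(\<lambda>n. exp (log_height (fst (\<sigma> n))) * (1 - fst (\<sigma> n) \<bullet> fst (\<sigma> n))) \<longlonglongrightarrow> exp L * (1 - z \<bullet> z)"
    by (intro tendsto_intros L z)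
  moreover have "exp (log_height (fst (\<sigma> n))) * (1 - fst (\<sigma> n) \<bullet> fst (\<sigma> n)) = 1 + fst (\<sigma> n) \<bullet> fst (\<sigma> n)" for n
  proof -
    have "0 \<le> fst (\<sigma> n) \<bullet> fst (\<sigma> n)" "fst (\<sigma> n) \<bullet> fst (\<sigma> n) < 1"
      using in_disk[of n] by (auto simp: disk_iff power2_norm_eq_inner)
    then have "0 < 1 + fst (\<sigma> n) \<bullet> fst (\<sigma> n)" "0 < 1 - fst (\<sigma> n) \<bullet> fst (\<sigma> n)" by linarith+
    then show ?thesis by (simp add: log_height_def exp_diff)
  qed
  moreover have "(\<lambda>n. 1 + fst (\<sigma> n) \<bullet> fst (\<sigma> n)) \<longlonglongrightarrow> 1 + z \<bullet> z" by (intro tendsto_intros z)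
  ultimately have "exp L * (1 - z \<bullet> z) = 1 + z \<bullet> z" using LIMSEQ_unique by fastforce
  moreover have "1 + z \<bullet> z > 0" by (simp add: add_pos_nonneg)
  ultimately have "exp L * (1 - z \<bullet> z) > 0" by simp
  then have "1 - z \<bullet> z > 0" by (simp add: zero_less_mult_iff)
  then have "z \<in> disk" by (simp add: disk_iff power2_norm_eq_inner)
  moreover have lim: "\<sigma> \<longlonglongrightarrow> (z, t)" using tendsto_Pair[OF z t] by simp
  ultimately have "(z, t) \<in> M" using closed[OF \<sigma>M lim] by simp
  then show "\<exists>l\<in>M. (\<lambda>n. path_dist H2xR_metric M (\<sigma> n) l) \<longlonglongrightarrow> 0"
    using local[OF \<sigma>M _ lim] by blast
qed


section \<open>Ends of the profile curves\<close>

lemma closure_range_profile_height: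
  assumes d: "0 < d" "d \<noteq> 1"
  shows "closure (range (profile_height d)) = {- profile_limit d..profile_limit d}"
proof -
  let ?L = "profile_limit d"
  have "t \<in> range (profile_height d)" if t: "- ?L < t" "t < ?L" for t
  proof -
    have ev: "eventually (\<lambda>w. max t (- t) < profile_height d w) at_top"
      using t by (intro order_tendstoD(1)[OF profile_height_at_top[OF d]]) auto
    then obtain w where w: "max t (- t) < profile_height d w" by (auto simp: eventually_at_top_linorder)
    have cont: "isCont (profile_height d) x" for x by (rule DERIV_isCont[OF profile_height_derivative])
    have "profile_height d (- w) < t" "t < profile_height d w" using w by (auto simp: profile_height_odd[OF d(2)])
    moreover have "- w \<le> w"
      using calculation strict_mono_less[OF strict_mono_profile_height[OF d(1)], of "- w" w] by simp
    ultimately show ?thesis using IVT[of "profile_height d" "- w" t w] cont by (auto simp: less_imp_le)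
  qed
  then have "range (profile_height d) = {- ?L<..<?L}"
    using profile_height_less_limit[OF d] by auto
  then show ?thesis using profile_limit_pos[OF d] by simp
qed

lemma closure_range_profile_height_1: "closure (range (profile_height 1)) = {..0}"
proof -
  have "t \<in> range (profile_height 1)" if "t < 0" for t
  proof -
    have "sinh (- t) > 0" using that by simp
    then have "exp (- (- ln (sinh (- t)))) = sinh (- t)" by simp
    then have "profile_height 1 (- ln (sinh (- t))) = t"
      by (simp only: profile_height_def if_True arsinh_sinh_real) (simp add: arsinh_sinh_real)
    then show ?thesis by (metis rangeI)
  qed
  moreover have "profile_height 1 w < 0" for w
    using arsinh_real_pos_iff[of "exp (- w)"] by (simp add: profile_height_def)
  ultimately have "range (profile_height 1) = {..<0}" by auto
  then show ?thesis by simp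
qed

text \<open>For \<open>d \<ge> 1\<close> the surface stays on one side of the geodesic, so that \<open>c2\<close> does not contribute to
  its asymptotic boundary.\<close>

lemma profile_radius_not_at_bot:
  assumes "1 \<le> d" shows "\<not> filterlim (\<lambda>n. profile_radius d (w n)) at_bot sequentially"
proof
  assume "filterlim (\<lambda>n. profile_radius d (w n)) at_bot sequentially"
  then have "eventually (\<lambda>n. profile_radius d (w n) < 0) sequentially" by (simp add: filterlim_at_bot_dense)
  moreover have "0 \<le> profile_radius d w" for w
    using assms by (auto simp: profile_radius_def one_le_power intro!: mult_nonneg_nonneg less_imp_le[OF cosh_real_pos])
  ultimately have "eventually (\<lambda>n. False) sequentially" by (simp add: not_less[symmetric])
  then show False by simp
qed

text \<open>The radius is even and the height odd, so both ends of the profile go to the same side, with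
  opposite limits of the height. A sequence with radius tending to infinity has \<open>\<bar>w\<bar> \<rightarrow> \<infinity>\<close> but
  may jump between the ends; this is why the limit is computed for the absolute value of the
  height.\<close>

lemma profile_end_greater_1:
  assumes d: "1 < d"
  shows "(\<exists>w. filterlim (\<lambda>n. profile_radius d (w n)) at_top sequentially \<and> (\<lambda>n. profile_height d (w n)) \<longlonglongrightarrow> t)
    \<longleftrightarrow> t = profile_limit d \<or> t = - profile_limit d"
proof -
  let ?k = "sqrt (d\<^sup>2 - 1)" and ?L = "profile_limit d"
  have k: "0 < ?k" using d by (simp add: one_less_power)
  have d': "0 < d" "d \<noteq> 1" using d by auto
  have abs_height: "\<bar>profile_height d w\<bar> = profile_height d \<bar>w\<bar>" for w
  proof -
    have nonneg: "0 \<le> profile_height d u" if "0 \<le> u" for u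
      using that strict_mono_less_eq[OF strict_mono_profile_height[OF d'(1)], of 0 u] profile_height_antiderivative(1)[OF d'(2)] by simp
    show ?thesis
    proof (cases "0 \<le> w")
      case True
      then show ?thesis using nonneg[of w] by (simp only: abs_of_nonneg)
    next
      case False
      then have "\<bar>w\<bar> = - w" by simp
      then show ?thesis using nonneg[of "- w"] profile_height_odd[OF d'(2), of w] False by simp
    qed
  qed
  have at_top: "filterlim (\<lambda>n. profile_radius d (w n)) at_top sequentially \<longleftrightarrow> filterlim (\<lambda>n. \<bar>w n\<bar>) at_top sequentially" for w
  proof
    assume "filterlim (\<lambda>n. profile_radius d (w n)) at_top sequentially"
    from filterlim_tendsto_pos_mult_at_top[OF tendsto_const _ this, of "1 / ?k"] k
    have "filterlim (\<lambda>n. 1 / ?k * profile_radius d (w n)) at_top sequentially" by simp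
    moreover have "1 / ?k * profile_radius d u = cosh \<bar>u\<bar>" for u
    proof -
      have "profile_radius d u = ?k * cosh \<bar>u\<bar>" using d by (simp add: profile_radius_def)
      moreover have "1 / c * (c * x) = x" if "0 < c" for c x :: real using that by simp
      ultimately show ?thesis using k by (simp only:)
    qed
    ultimately have "filterlim (\<lambda>n. arcosh (cosh \<bar>w n\<bar>)) at_top sequentially"
      using filterlim_compose[OF arcosh_real_at_top] by simp
    then show "filterlim (\<lambda>n. \<bar>w n\<bar>) at_top sequentially" by (simp only: arcosh_cosh_real abs_ge_zero)
  next
    assume "filterlim (\<lambda>n. \<bar>w n\<bar>) at_top sequentially"
    then have "filterlim (\<lambda>n. cosh \<bar>w n\<bar>) at_top sequentially" by (rule filterlim_compose[OF cosh_real_at_top])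
    from filterlim_tendsto_pos_mult_at_top[OF tendsto_const k this]
    show "filterlim (\<lambda>n. profile_radius d (w n)) at_top sequentially" using d by (simp add: profile_radius_def)
  qed
  show ?thesis
  proof
    assume "\<exists>w. filterlim (\<lambda>n. profile_radius d (w n)) at_top sequentially \<and> (\<lambda>n. profile_height d (w n)) \<longlonglongrightarrow> t"
    then obtain w where w: "filterlim (\<lambda>n. \<bar>w n\<bar>) at_top sequentially" "(\<lambda>n. profile_height d (w n)) \<longlonglongrightarrow> t"
      using at_top by auto
    have "(\<lambda>n. profile_height d \<bar>w n\<bar>) \<longlonglongrightarrow> ?L"
      by (rule filterlim_compose[OF profile_height_at_top[OF d'] w(1)])
    moreover have "(\<lambda>n. profile_height d \<bar>w n\<bar>) \<longlonglongrightarrow> \<bar>t\<bar>"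
      using tendsto_rabs[OF w(2)] by (simp add: abs_height)
    ultimately have "\<bar>t\<bar> = ?L" using LIMSEQ_unique by blast
    then show "t = ?L \<or> t = - ?L" by linarith
  next
    have lim: "(\<lambda>n. profile_height d (real n)) \<longlonglongrightarrow> ?L"
      by (rule filterlim_compose[OF profile_height_at_top[OF d'] filterlim_real_sequentially])
    from tendsto_minus[OF this] have lim': "(\<lambda>n. profile_height d (- real n)) \<longlonglongrightarrow> - ?L"
      by (simp add: profile_height_odd[OF d'(2)])
    have inf: "filterlim (\<lambda>n. profile_radius d (real n)) at_top sequentially" "filterlim (\<lambda>n. profile_radius d (- real n)) at_top sequentially"
      using filterlim_real_sequentially by (simp_all add: at_top)
    assume "t = ?L \<or> t = - ?L"
    then show "\<exists>w. filterlim (\<lambda>n. profile_radius d (w n)) at_top sequentially \<and> (\<lambda>n. profile_height d (w n)) \<longlonglongrightarrow> t"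
    proof
      assume "t = ?L"
      then show ?thesis using lim inf(1) by (intro exI[of _ "\<lambda>n. real n"] conjI) simp_all
    next
      assume "t = - ?L"
      then show ?thesis using lim' inf(2) by (intro exI[of _ "\<lambda>n. - real n"] conjI) simp_all
    qed
  qed
qed

lemma profile_end_1:
  "(\<exists>w. filterlim (\<lambda>n. profile_radius 1 (w n)) at_top sequentially \<and> (\<lambda>n. profile_height 1 (w n)) \<longlonglongrightarrow> t) \<longleftrightarrow> t = 0"
proof -
  have lim: "(\<lambda>n. profile_height 1 (w n)) \<longlonglongrightarrow> 0" if "filterlim (\<lambda>n. profile_radius 1 (w n)) at_top sequentially" for w
  proof -
    have "filterlim (\<lambda>n. exp (w n)) at_top sequentially" using that by (simp add: profile_radius_def)
    then have "(\<lambda>n. inverse (exp (w n))) \<longlonglongrightarrow> 0" by (rule filterlim_compose[OF tendsto_inverse_0_at_top[OF filterlim_ident]])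
    from tendsto_minus[OF tendsto_arsinh[OF this]] show ?thesis by (simp add: profile_height_def exp_minus)
  qed
  have "filterlim (\<lambda>n. profile_radius 1 (real n)) at_top sequentially"
    using filterlim_compose[OF exp_at_top filterlim_real_sequentially] by (simp add: profile_radius_def)
  note inf = this
  show ?thesis
  proof
    assume "\<exists>w. filterlim (\<lambda>n. profile_radius 1 (w n)) at_top sequentially \<and> (\<lambda>n. profile_height 1 (w n)) \<longlonglongrightarrow> t"
    then obtain w where "filterlim (\<lambda>n. profile_radius 1 (w n)) at_top sequentially" "(\<lambda>n. profile_height 1 (w n)) \<longlonglongrightarrow> t" by auto
    then show "t = 0" using LIMSEQ_unique lim by blast
  next
    assume "t = 0"
    then show "\<exists>w. filterlim (\<lambda>n. profile_radius 1 (w n)) at_top sequentially \<and> (\<lambda>n. profile_height 1 (w n)) \<longlonglongrightarrow> t"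
      using inf lim[OF inf] by (intro exI[of _ "\<lambda>n. real n"] conjI) simp_all
  qed
qed

text \<open>Radius and height are both odd and increasing, so that each side of the geodesic sees one end of
  the profile.\<close>

lemma profile_end_less_1:
  assumes d: "0 < d" "d < 1"
  shows "(\<exists>w. filterlim (\<lambda>n. profile_radius d (w n)) at_top sequentially \<and> (\<lambda>n. profile_height d (w n)) \<longlonglongrightarrow> t)
      \<longleftrightarrow> t = profile_limit d"
    and "(\<exists>w. filterlim (\<lambda>n. profile_radius d (w n)) at_bot sequentially \<and> (\<lambda>n. profile_height d (w n)) \<longlonglongrightarrow> t)
      \<longleftrightarrow> t = - profile_limit d"
proof -
  let ?k = "sqrt (1 - d\<^sup>2)" and ?L = "profile_limit d"
  have k: "0 < ?k" using d by (simp add: abs_square_less_1)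
  have d': "d \<noteq> 1" using d by auto
  have radius_odd: "profile_radius d (- w) = - profile_radius d w" for w using d by (simp add: profile_radius_def)
  have at_top: "filterlim (\<lambda>n. profile_radius d (w n)) at_top sequentially \<longleftrightarrow> filterlim w at_top sequentially" for w
  proof
    assume "filterlim (\<lambda>n. profile_radius d (w n)) at_top sequentially"
    from filterlim_tendsto_pos_mult_at_top[OF tendsto_const _ this, of "1 / ?k"] k
    have "filterlim (\<lambda>n. 1 / ?k * profile_radius d (w n)) at_top sequentially" by simp
    moreover have "1 / ?k * profile_radius d u = sinh u" for u
    proof -
      have "profile_radius d u = ?k * sinh u" using d by (simp add: profile_radius_def)
      moreover have "1 / c * (c * x) = x" if "0 < c" for c x :: real using that by simp
      ultimately show ?thesis using k by (simp only:)
    qed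
    ultimately have "filterlim (\<lambda>n. arsinh (sinh (w n))) at_top sequentially"
      using filterlim_compose[OF arsinh_real_at_top] by simp
    then show "filterlim w at_top sequentially" by (simp add: arsinh_sinh_real)
  next
    assume "filterlim w at_top sequentially"
    then have "filterlim (\<lambda>n. sinh (w n)) at_top sequentially" by (rule filterlim_compose[OF sinh_real_at_top])
    from filterlim_tendsto_pos_mult_at_top[OF tendsto_const k this]
    show "filterlim (\<lambda>n. profile_radius d (w n)) at_top sequentially" using d by (simp add: profile_radius_def)
  qed
  have top: "(\<exists>w. filterlim (\<lambda>n. profile_radius d (w n)) at_top sequentially \<and> (\<lambda>n. profile_height d (w n)) \<longlonglongrightarrow> t) \<longleftrightarrow> t = ?L" for t
  proof -
    have lim: "(\<lambda>n. profile_height d (w n)) \<longlonglongrightarrow> ?L" if "filterlim (\<lambda>n. profile_radius d (w n)) at_top sequentially" for w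
      using filterlim_compose[OF profile_height_at_top[OF d(1) d']] that by (simp add: at_top)
    have inf: "filterlim (\<lambda>n. profile_radius d (real n)) at_top sequentially" using filterlim_real_sequentially by (simp add: at_top)
    show ?thesis
    proof
      assume "\<exists>w. filterlim (\<lambda>n. profile_radius d (w n)) at_top sequentially \<and> (\<lambda>n. profile_height d (w n)) \<longlonglongrightarrow> t"
      then obtain w where "filterlim (\<lambda>n. profile_radius d (w n)) at_top sequentially" "(\<lambda>n. profile_height d (w n)) \<longlonglongrightarrow> t" by auto
      then show "t = ?L" using LIMSEQ_unique lim by blast
    next
      assume "t = ?L"
      then show "\<exists>w. filterlim (\<lambda>n. profile_radius d (w n)) at_top sequentially \<and> (\<lambda>n. profile_height d (w n)) \<longlonglongrightarrow> t"
        using inf lim[OF inf] by (intro exI[of _ "\<lambda>n. real n"] conjI) simp_all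
    qed
  qed
  then show "(\<exists>w. filterlim (\<lambda>n. profile_radius d (w n)) at_top sequentially \<and> (\<lambda>n. profile_height d (w n)) \<longlonglongrightarrow> t) \<longleftrightarrow> t = ?L" .
  have mirror: "filterlim (\<lambda>n. profile_radius d (- w n)) at_top sequentially \<longleftrightarrow> filterlim (\<lambda>n. profile_radius d (w n)) at_bot sequentially"
    "(\<lambda>n. profile_height d (- w n)) \<longlonglongrightarrow> - t \<longleftrightarrow> (\<lambda>n. profile_height d (w n)) \<longlonglongrightarrow> t" for w t
    unfolding radius_odd profile_height_odd[OF d'] by (simp_all add: filterlim_uminus_at_bot tendsto_minus_cancel_left)
  show "(\<exists>w. filterlim (\<lambda>n. profile_radius d (w n)) at_bot sequentially \<and> (\<lambda>n. profile_height d (w n)) \<longlonglongrightarrow> t) \<longleftrightarrow> t = - ?L"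
  proof
    assume "\<exists>w. filterlim (\<lambda>n. profile_radius d (w n)) at_bot sequentially \<and> (\<lambda>n. profile_height d (w n)) \<longlonglongrightarrow> t"
    then obtain w where "filterlim (\<lambda>n. profile_radius d (- w n)) at_top sequentially" "(\<lambda>n. profile_height d (- w n)) \<longlonglongrightarrow> - t"
      using mirror(1) mirror(2)[of _ t] by blast
    then have "- t = ?L" by (intro top[THEN iffD1] exI[of _ "\<lambda>n. - w n"] conjI)
    then show "t = - ?L" by simp
  next
    assume t: "t = - ?L"
    obtain w where w: "filterlim (\<lambda>n. profile_radius d (w n)) at_top sequentially" "(\<lambda>n. profile_height d (w n)) \<longlonglongrightarrow> ?L"
      using top[of ?L] by blast
    have "filterlim (\<lambda>n. profile_radius d (- w n)) at_bot sequentially \<and> (\<lambda>n. profile_height d (- w n)) \<longlonglongrightarrow> t"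
      using w mirror(1)[of "\<lambda>n. - w n"] mirror(2)[of "\<lambda>n. - w n" t] t by simp
    then show "\<exists>w. filterlim (\<lambda>n. profile_radius d (w n)) at_bot sequentially \<and> (\<lambda>n. profile_height d (w n)) \<longlonglongrightarrow> t"
      by (rule exI[of _ "\<lambda>n. - w n"])
  qed
qed

section \<open>The family of surfaces\<close>

lemma pair_set_eqI: "(\<And>x y. (x, y) \<in> A \<longleftrightarrow> (x, y) \<in> B) \<Longrightarrow> A = B"
  by auto

context ideal_pair
begin

definition surface :: "real \<Rightarrow> (complex \<times> real) set" where
  "surface d = profile_set (profile_radius d) (profile_height d)"

lemma mem_surface: "(z, t) \<in> surface d \<longleftrightarrow> z \<in> disk \<and> (\<exists>w. f z = profile_radius d w \<and> t = profile_height d w)"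
  by (auto simp: surface_def profile_set_def)

theorem surface_properties:
  assumes d: "0 < d"
  shows "minimal_surface H2xR H2xR_metric (surface d)" "properly_embedded_surface H2xR (surface d)"
    "complete_surface H2xR_metric (surface d)"
proof -
  interpret T: translation_surface disk disk_metric "\<lambda>z. 4 / (1 - (norm z)\<^sup>2)\<^sup>2" "\<lambda>z. 2 * cnj z / of_real (1 - (norm z)\<^sup>2)"
    h h' h'' k d "profile_radius d" "profile_radius' d" "profile_height d" 1
    by (intro translation_surface.intro half_plane_chart_axioms profile_radius_height d translation_surface_axioms.intro) simp
  have M: "T.M = surface d" by (auto simp: T.M_def surface_def profile_set_def)
  show "minimal_surface H2xR H2xR_metric (surface d)" "properly_embedded_surface H2xR (surface d)"
    using T.minimal T.properly_embedded unfolding M .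
  show "complete_surface H2xR_metric (surface d)"
  proof (rule complete_surface_criterion)
    show "surface d \<subseteq> H2xR" by (auto simp: mem_surface)
    show "(\<lambda>n. path_dist H2xR_metric (surface d) (\<sigma> n) l) \<longlonglongrightarrow> 0"
      if "\<And>n. \<sigma> n \<in> surface d" "l \<in> surface d" "\<sigma> \<longlonglongrightarrow> l" for \<sigma> l
      using T.path_dist_tendsto_zero[of \<sigma> l] that unfolding M .
    fix \<sigma> l assume \<sigma>: "\<And>n. \<sigma> n \<in> surface d" "\<sigma> \<longlonglongrightarrow> l" "l \<in> H2xR"
    have "isCont f (fst l)"
      using continuous_f disk.open_domain \<sigma>(3) by (auto simp: continuous_on_eq_continuous_at)
    then have lim: "(\<lambda>n. (f (fst (\<sigma> n)), snd (\<sigma> n))) \<longlonglongrightarrow> (f (fst l), snd l)"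
      using \<sigma>(2) by (intro tendsto_Pair isCont_tendsto_compose[of _ f] tendsto_fst tendsto_snd)
    have mem: "(f (fst (\<sigma> n)), snd (\<sigma> n)) \<in> range (\<lambda>w. (profile_radius d w, profile_height d w))" for n
      using \<sigma>(1)[of n] by (auto simp: surface_def profile_set_def)
    have "(f (fst l), snd l) \<in> range (\<lambda>w. (profile_radius d w, profile_height d w))"
      by (rule closed_sequentially[OF T.closed_profile mem lim])
    then show "l \<in> surface d" using \<sigma>(3) by (auto simp: surface_def profile_set_def)
  qed
qed

theorem asymptotic_boundary_surface:
  shows "1 < d \<Longrightarrow> asymptotic_boundary (surface d) =
      (c1 \<times> {- profile_limit d}) \<union> (c1 \<times> {profile_limit d})
        \<union> ({q2} \<times> {- profile_limit d..profile_limit d}) \<union> ({q1} \<times> {- profile_limit d..profile_limit d})"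
    and "asymptotic_boundary (surface 1) = ({q1} \<times> {..0}) \<union> (c1 \<times> {0}) \<union> ({q2} \<times> {..0})"
    and "0 < d \<Longrightarrow> d < 1 \<Longrightarrow> asymptotic_boundary (surface d) =
      (c2 \<times> {- profile_limit d}) \<union> (c1 \<times> {profile_limit d})
        \<union> ({q1} \<times> {- profile_limit d..profile_limit d}) \<union> ({q2} \<times> {- profile_limit d..profile_limit d})"
proof -
  assume d: "1 < d"
  then have L: "0 < profile_limit d" by (intro profile_limit_pos) auto
  have cl: "closure (range (profile_height d)) = {- profile_limit d..profile_limit d}"
    using d by (intro closure_range_profile_height) auto
  have bot: "\<not> filterlim (\<lambda>n. profile_radius d (w n)) at_bot sequentially" for w
    using d by (intro profile_radius_not_at_bot) auto
  show "asymptotic_boundary (surface d) =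
      (c1 \<times> {- profile_limit d}) \<union> (c1 \<times> {profile_limit d})
        \<union> ({q2} \<times> {- profile_limit d..profile_limit d}) \<union> ({q1} \<times> {- profile_limit d..profile_limit d})"
    unfolding surface_def
    by (rule pair_set_eqI, unfold asymptotic_boundary_profile_set profile_end_greater_1[OF d] cl)
      (use L bot in auto)
next
  have bot: "\<not> filterlim (\<lambda>n. profile_radius 1 (w n)) at_bot sequentially" for w
    by (intro profile_radius_not_at_bot) auto
  show "asymptotic_boundary (surface 1) = ({q1} \<times> {..0}) \<union> (c1 \<times> {0}) \<union> ({q2} \<times> {..0})"
    unfolding surface_def
    by (rule pair_set_eqI, unfold asymptotic_boundary_profile_set profile_end_1 closure_range_profile_height_1)
      (use bot in auto)
next
  assume d: "0 < d" "d < 1"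
  then have L: "0 < profile_limit d" by (intro profile_limit_pos) auto
  have cl: "closure (range (profile_height d)) = {- profile_limit d..profile_limit d}"
    using d by (intro closure_range_profile_height) auto
  show "asymptotic_boundary (surface d) =
      (c2 \<times> {- profile_limit d}) \<union> (c1 \<times> {profile_limit d})
        \<union> ({q1} \<times> {- profile_limit d..profile_limit d}) \<union> ({q2} \<times> {- profile_limit d..profile_limit d})"
    unfolding surface_def
    by (rule pair_set_eqI, unfold asymptotic_boundary_profile_set profile_end_less_1[OF d] cl)
      (use L in auto)
qed

text \<open>The profile turns at \<open>w = 0\<close>, over the equidistant line. Its upper half \<open>w \<ge> 0\<close> is a graph
  because the radius \<open>sqrt (d\<^sup>2 - 1) cosh w\<close> increases there, with the inverse given by
  \<open>arcosh\<close>.\<close>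

theorem surface_greater_1:
  assumes d: "1 < d"
  shows "level (sqrt (d\<^sup>2 - 1)) \<times> {0} \<subseteq> surface d" "symmetric_wrt_slice (surface d)"
    "vertical_graph_over {z \<in> disk. sqrt (d\<^sup>2 - 1) \<le> f z} (surface d \<inter> (disk \<times> {0..profile_limit d}))"
proof -
  let ?k = "sqrt (d\<^sup>2 - 1)"
  have k: "0 < ?k" using d by (simp add: one_less_power)
  have d': "0 < d" "d \<noteq> 1" using d by auto
  have rad: "profile_radius d w = ?k * cosh w" for w using d by (simp add: profile_radius_def)
  have h0: "profile_height d 0 = 0" by (rule profile_height_antiderivative(1)[OF d'(2)])
  show "level ?k \<times> {0} \<subseteq> surface d"
    using h0 by (auto simp: mem_surface level_def rad intro!: exI[of _ 0])
  have sym: "(z, - t) \<in> surface d" if zt: "(z, t) \<in> surface d" for z t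
  proof -
    obtain w where "z \<in> disk" "f z = profile_radius d w" "t = profile_height d w"
      using zt unfolding mem_surface by blast
    then show ?thesis by (auto simp: mem_surface rad profile_height_odd[OF d'(2)] intro!: exI[of _ "- w"])
  qed
  show "symmetric_wrt_slice (surface d)"
    unfolding symmetric_wrt_slice_def
  proof (intro equalityI subsetI)
    fix p assume "p \<in> surface d"
    then show "p \<in> (\<lambda>(z, t). (z, - t)) ` surface d"
      using sym[of "fst p" "snd p"] by (intro image_eqI[of _ _ "(fst p, - snd p)"]) auto
  qed (use sym in auto)
  have radius: "profile_radius d (arcosh (x / ?k)) = x" if "?k \<le> x" for x
  proof -
    have "1 \<le> x / ?k" using k that by (simp add: pos_le_divide_eq)
    then have "profile_radius d (arcosh (x / ?k)) = ?k * (x / ?k)" unfolding rad by simp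
    moreover have "c * (x / c) = x" if "0 < c" for c :: real using that by simp
    ultimately show ?thesis using k by (simp only:)
  qed
  have arcosh: "arcosh (?k * cosh w / ?k) = w" if "0 \<le> w" for w
  proof -
    have "c * x / c = x" if "0 < c" for c x :: real using that by simp
    from this[OF k] show ?thesis using that by (simp only: arcosh_cosh_real)
  qed
  have nonneg: "0 \<le> profile_height d w \<longleftrightarrow> 0 \<le> w" for w
    using strict_mono_less_eq[OF strict_mono_profile_height[OF d'(1)], of 0 w] h0 by simp
  show "vertical_graph_over {z \<in> disk. ?k \<le> f z} (surface d \<inter> (disk \<times> {0..profile_limit d}))"
    unfolding vertical_graph_over_def
  proof (intro exI[of _ "\<lambda>p. profile_height d (arcosh (f p / ?k))"] equalityI subsetI)
    fix p assume "p \<in> surface d \<inter> (disk \<times> {0..profile_limit d})"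
    then obtain w where w: "fst p \<in> disk" "f (fst p) = ?k * cosh w" "snd p = profile_height d w" "0 \<le> w"
      using nonneg by (cases p) (auto simp: mem_surface rad)
    have "?k * 1 \<le> f (fst p)" unfolding w(2) using k cosh_real_ge_1[of w] by (intro mult_left_mono) auto
    then show "p \<in> (\<lambda>p. (p, profile_height d (arcosh (f p / ?k)))) ` {z \<in> disk. ?k \<le> f z}"
      using w(1,3) arcosh[OF w(4)] by (intro image_eqI[of _ _ "fst p"]) (auto simp: prod_eq_iff w(2))
  next
    fix p assume "p \<in> (\<lambda>p. (p, profile_height d (arcosh (f p / ?k)))) ` {z \<in> disk. ?k \<le> f z}"
    then obtain z where z: "z \<in> disk" "?k \<le> f z" "p = (z, profile_height d (arcosh (f z / ?k)))" by auto
    have "1 \<le> f z / ?k" using k z(2) by (simp add: pos_le_divide_eq)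
    then have "0 \<le> profile_height d (arcosh (f z / ?k))" unfolding nonneg by simp
    then show "p \<in> surface d \<inter> (disk \<times> {0..profile_limit d})"
      using z radius[OF z(2)] profile_height_le_limit[OF d'] by (auto simp: mem_surface intro!: exI[of _ "arcosh (f z / ?k)"])
  qed
qed

text \<open>The radius is a bijection of \<open>\<real>\<close>, with the inverse given by \<open>arsinh\<close>.\<close>

theorem surface_less_1:
  assumes d: "0 < d" "d < 1"
  shows "vertical_graph_over disk (surface d)" "level 0 \<times> {0} \<subseteq> surface d"
proof -
  let ?k = "sqrt (1 - d\<^sup>2)"
  have k: "0 < ?k" using d by (simp add: abs_square_less_1)
  have d': "d \<noteq> 1" using d by auto
  have rad: "profile_radius d w = ?k * sinh w" for w using d by (simp add: profile_radius_def)
  show "level 0 \<times> {0} \<subseteq> surface d"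
    using profile_height_antiderivative(1)[OF d'] by (auto simp: mem_surface level_def rad intro!: exI[of _ 0])
  have cancel: "c * (x / c) = x" "c * x / c = x" if "0 < c" for c x :: real using that by auto
  have radius: "profile_radius d (arsinh (x / ?k)) = x" for x
    unfolding rad using cancel[OF k] by simp
  have arsinh: "arsinh (?k * sinh w / ?k) = w" for w
    using cancel(2)[OF k, of "sinh w"] by (simp only: arsinh_sinh_real)
  show "vertical_graph_over disk (surface d)"
    unfolding vertical_graph_over_def
  proof (intro exI[of _ "\<lambda>p. profile_height d (arsinh (f p / ?k))"] equalityI subsetI)
    fix p assume "p \<in> surface d"
    then obtain w where w: "fst p \<in> disk" "f (fst p) = ?k * sinh w" "snd p = profile_height d w"
      by (cases p) (auto simp: mem_surface rad)
    then show "p \<in> (\<lambda>p. (p, profile_height d (arsinh (f p / ?k)))) ` disk"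
      using arsinh[of w] by (intro image_eqI[of _ _ "fst p"]) (auto simp: prod_eq_iff w(2))
  next
    fix p assume "p \<in> (\<lambda>p. (p, profile_height d (arsinh (f p / ?k)))) ` disk"
    then show "p \<in> surface d"
      using radius by (auto simp: mem_surface) metis
  qed
qed

text \<open>The explicit graph has positive height, while the surface with \<open>d = 1\<close> lies below the slice of
  height \<open>0\<close>; the congruence between them is the chart composed with a reflection.\<close>

definition reflected_chart :: "complex \<times> real \<Rightarrow> complex \<times> real" where
  "reflected_chart p = (h (fst p), - snd p)"

lemma reflected_chart_isometry:
  "riemannian_isometry (half_plane \<times> UNIV) (times_R half_plane_metric) H2xR H2xR_metric reflected_chart"
proof -
  have op: "open (half_plane \<times> (UNIV :: real set))" by (intro open_Times half_plane.open_domain open_UNIV)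
  have bij: "bij_betw reflected_chart (half_plane \<times> UNIV) H2xR"
  proof (rule bij_betw_byWitness[where f' = "\<lambda>p. (k (fst p), - snd p)"])
    show "\<forall>p\<in>half_plane \<times> UNIV. (k (fst (reflected_chart p)), - snd (reflected_chart p)) = p"
      using half_plane_chart.k_h[OF half_plane_chart_axioms] by (auto simp: reflected_chart_def)
    show "\<forall>p\<in>H2xR. reflected_chart (k (fst p), - snd p) = p"
      using local.h_k(2)[OF disk_nonideal] by (auto simp: reflected_chart_def)
  qed (auto simp: reflected_chart_def h_in_disk k_in_half_plane)
  have smooth: "smooth_on (half_plane \<times> UNIV) reflected_chart"
    unfolding reflected_chart_def[abs_def]
    by (intro smooth_on_Pair smooth_on_minus op smooth_on_bounded_linear bounded_linear_snd
        smooth_on_compose[OF op half_plane.open_domain smooth_h] bounded_linear_fst) auto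
  have "H2xR_metric (reflected_chart p) (frechet_derivative reflected_chart (at p) v) (frechet_derivative reflected_chart (at p) w)
      = times_R half_plane_metric p v w" if p: "p \<in> half_plane \<times> UNIV" for p v w
  proof -
    have p': "fst p \<in> half_plane" using p by auto
    have "((\<lambda>p. h (fst p)) has_derivative (\<lambda>v. h' (fst p) * fst v)) (at p)"
      using has_derivative_compose[OF has_derivative_fst[OF has_derivative_ident] h[OF p', unfolded has_field_derivative_def]] by simp
    then have "(reflected_chart has_derivative (\<lambda>v. (h' (fst p) * fst v, - snd v))) (at p)"
      unfolding reflected_chart_def[abs_def]
      by (intro has_derivative_Pair has_derivative_minus has_derivative_snd has_derivative_ident)
    then have D: "frechet_derivative reflected_chart (at p) = (\<lambda>v. (h' (fst p) * fst v, - snd v))"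
      by (rule frechet_derivative_at[symmetric])
    show ?thesis
      unfolding D times_R_def disk.metric half_plane.metric reflected_chart_def fst_conv snd_conv inner_complex_mult_left
      using isometry[OF p'] by (simp flip: mult.assoc)
  qed
  then show ?thesis using bij smooth by (simp add: riemannian_isometry_def)
qed

end

text \<open>The given function of \<open>x\<close> and \<open>y\<close> is \<open>arsinh (y / x)\<close>, and \<open>x / y = exp w\<close> is the radius.\<close>

lemma half_plane_graph_eq:
  "half_plane_graph = {(\<zeta>, t). \<zeta> \<in> half_plane \<and> (Re \<zeta> / Im \<zeta>, - t) \<in> range (\<lambda>w. (profile_radius 1 w, profile_height 1 w))}"
proof -
  have height: "ln ((sqrt (x\<^sup>2 + y\<^sup>2) + y) / x) = arsinh (y / x)" if "0 < x" for x y :: real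
  proof -
    have "sqrt ((y / x)\<^sup>2 + 1) = sqrt ((x\<^sup>2 + y\<^sup>2) / x\<^sup>2)" using that by (simp add: power_divide add_divide_distrib add.commute)
    also have "\<dots> = sqrt (x\<^sup>2 + y\<^sup>2) / x" using that by (simp add: real_sqrt_divide)
    finally show ?thesis by (simp add: arsinh_real_def add_divide_distrib add.commute)
  qed
  have graph: "(\<zeta>, t) \<in> half_plane_graph \<longleftrightarrow> 0 < Im \<zeta> \<and> 0 < Re \<zeta> \<and> t = arsinh (Im \<zeta> / Re \<zeta>)" for \<zeta> t
    unfolding half_plane_graph_def
    by (auto simp: height intro!: exI[of _ "Re \<zeta>"] exI[of _ "Im \<zeta>"] simp: complex_eq_iff)
  have range: "(Re \<zeta> / Im \<zeta>, - t) \<in> range (\<lambda>w. (profile_radius 1 w, profile_height 1 w)) \<longleftrightarrow> 0 < Re \<zeta> \<and> t = arsinh (Im \<zeta> / Re \<zeta>)"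
    if y: "0 < Im \<zeta>" for \<zeta> t
  proof
    assume "(Re \<zeta> / Im \<zeta>, - t) \<in> range (\<lambda>w. (profile_radius 1 w, profile_height 1 w))"
    then obtain w where w: "Re \<zeta> / Im \<zeta> = exp w" "t = arsinh (exp (- w))"
      by (auto simp: profile_radius_def profile_height_def)
    have "0 < Re \<zeta> / Im \<zeta>" using w(1) by simp
    then have "0 < Re \<zeta>" using y by (simp add: zero_less_divide_iff)
    moreover have "Im \<zeta> / Re \<zeta> = exp (- w)" using w(1) by (metis exp_minus inverse_divide)
    ultimately show "0 < Re \<zeta> \<and> t = arsinh (Im \<zeta> / Re \<zeta>)" using w(2) by simp
  next
    assume x: "0 < Re \<zeta> \<and> t = arsinh (Im \<zeta> / Re \<zeta>)"
    have e: "exp (ln (Re \<zeta> / Im \<zeta>)) = Re \<zeta> / Im \<zeta>" using x y by simp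
    moreover have "exp (- ln (Re \<zeta> / Im \<zeta>)) = Im \<zeta> / Re \<zeta>" unfolding exp_minus e by simp
    ultimately show "(Re \<zeta> / Im \<zeta>, - t) \<in> range (\<lambda>w. (profile_radius 1 w, profile_height 1 w))"
      using x by (intro image_eqI[of _ _ "ln (Re \<zeta> / Im \<zeta>)"]) (simp_all add: profile_radius_def profile_height_def)
  qed
  show ?thesis
    by (rule pair_set_eqI, unfold graph half_plane_def mem_Collect_eq prod.case) (use range in blast)
qed

lemma (in ideal_pair) reflected_chart_half_plane_graph: "reflected_chart ` half_plane_graph = surface 1"
proof (intro equalityI subsetI)
  fix p assume "p \<in> reflected_chart ` half_plane_graph"
  then obtain \<zeta> t where p: "p = (h \<zeta>, - t)" "(\<zeta>, t) \<in> half_plane_graph" by (auto simp: reflected_chart_def)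
  then show "p \<in> surface 1"
    using f_h[of \<zeta>] h_in_disk[of \<zeta>] by (auto simp: half_plane_graph_eq surface_def profile_set_def)
next
  fix p assume p: "p \<in> surface 1"
  then have z: "fst p \<in> disk" "(f (fst p), snd p) \<in> range (\<lambda>w. (profile_radius 1 w, profile_height 1 w))"
    by (auto simp: surface_def profile_set_def)
  then have "(k (fst p), - snd p) \<in> half_plane_graph"
    using k_in_half_plane by (simp add: half_plane_graph_eq f_def)
  then show "p \<in> reflected_chart ` half_plane_graph"
    using local.h_k(2)[OF disk_nonideal[OF z(1)]]
    by (intro image_eqI[of _ _ "(k (fst p), - snd p)"]) (simp_all add: reflected_chart_def)
qed

text \<open>Here the chart is the identity of the half plane, and \<open>\<sigma> = - 1\<close>.\<close>

theorem half_plane_graph_minimal: "minimal_surface (half_plane \<times> UNIV) (times_R half_plane_metric) half_plane_graph"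
proof -
  interpret T: translation_surface half_plane half_plane_metric "\<lambda>z. 1 / (Im z)\<^sup>2" "\<lambda>z. \<i> / of_real (Im z)"
    "\<lambda>z. z" "\<lambda>z. 1" "\<lambda>z. 0" "\<lambda>z. z" 1 "profile_radius 1" "profile_radius' 1" "profile_height 1" "- 1"
    by (intro translation_surface.intro half_plane.half_plane_chart_axioms profile_radius_height translation_surface_axioms.intro) simp_all
  have "T.M = half_plane_graph"
    by (auto simp: T.M_def half_plane_graph_eq half_plane.f_def)
  then show ?thesis using T.minimal by simp
qed

theorem proposition2p1:
  fixes q1 q2 :: complex and \<gamma> c1 c2 :: "complex set"
  assumes "norm q1 = 1" and "norm q2 = 1" and "q1 \<noteq> q2"
    and "complete_geodesic disk disk_metric \<gamma>" and "ideal_boundary \<gamma> = {q1, q2}"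
    and "c1 = ccw_arc q1 q2" and "c2 = ccw_arc q2 q1"
  shows "\<exists>M :: real \<Rightarrow> (complex \<times> real) set.
    (\<forall>d>0. complete_surface H2xR_metric (M d)
         \<and> properly_embedded_surface H2xR (M d)
         \<and> minimal_surface H2xR H2xR_metric (M d)
         \<and> translation_invariant \<gamma> (M d))
  \<and> (\<forall>d>1. let \<gamma>d = equidistant_line \<gamma> (the_component \<gamma> c1) (arcosh d);
               H = H_height d in
           \<gamma>d \<times> {0} \<subseteq> M d
         \<and> symmetric_wrt_slice (M d)
         \<and> asymptotic_boundary (M d) =
             (c1 \<times> {- H}) \<union> (c1 \<times> {H}) \<union> ({q2} \<times> {- H..H}) \<union> ({q1} \<times> {- H..H})
         \<and> Jordan_curve_homologous_to_zero ideal_cylinder (asymptotic_boundary (M d))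
         \<and> vertical_graph_over (closure (the_component \<gamma>d c1) \<inter> disk) (M d \<inter> (disk \<times> {0..H})))
  \<and> antimono_on {1<..} H_height
  \<and> filterlim H_height at_top (at_right 1)
  \<and> (H_height \<longlongrightarrow> pi / 2) at_top
  \<and> minimal_surface (half_plane \<times> UNIV) (times_R half_plane_metric) half_plane_graph
  \<and> (\<exists>F. riemannian_isometry (half_plane \<times> UNIV) (times_R half_plane_metric) H2xR H2xR_metric F
         \<and> F ` half_plane_graph = M 1)
  \<and> asymptotic_boundary (M 1) = ({q1} \<times> {..0}) \<union> (c1 \<times> {0}) \<union> ({q2} \<times> {..0})
  \<and> (\<forall>d. 0 < d \<and> d < 1 \<longrightarrow> (let G = G_height d in
           vertical_graph_over disk (M d)
         \<and> \<gamma> \<times> {0} \<subseteq> M d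
         \<and> asymptotic_boundary (M d) =
             (c2 \<times> {- G}) \<union> (c1 \<times> {G}) \<union> ({q1} \<times> {- G..G}) \<union> ({q2} \<times> {- G..G})
         \<and> Jordan_curve_not_homologous_to_zero ideal_cylinder (asymptotic_boundary (M d))))
  \<and> mono_on {0<..<1} G_height
  \<and> (G_height \<longlongrightarrow> 0) (at_right 0)
  \<and> filterlim G_height at_top (at_left 1)"
proof -
  \<comment> \<open>half the opening angle of \<open>c1\<close>; then \<open>m\<close> is the midpoint of \<open>c1\<close>, and \<open>q1\<close>, \<open>q2\<close> are the
    ideal points of the locale\<close>
  define \<alpha> where "\<alpha> = Arg2pi (q2 / q1) / 2"
  define m where "m = q1 * cis \<alpha>"
  note A = unit_quotient_Arg2pi[OF assms(1-3)]
  interpret I: ideal_pair m \<alpha>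
    by unfold_locales (use A assms(1) in \<open>auto simp: m_def \<alpha>_def norm_mult\<close>)
  have q1: "I.q1 = q1"
    unfolding I.q1_def I.\<eta>_def by (simp add: m_def cis_cnj cis_mult mult.assoc)
  have "q1 \<noteq> 0" using assms(1) by auto
  then have q2: "I.q2 = q2"
    unfolding I.q2_eq q1 using A(1) by (simp add: \<alpha>_def)
  have c1: "I.c1 = c1" and c2: "I.c2 = c2" by (simp_all add: I.c1_def I.c2_def q1 q2 assms)
  obtain c where c: "unit_speed_geodesic disk disk_metric c" "range c = \<gamma>"
    using assms(4) by (auto simp: complete_geodesic_def)
  have \<gamma>: "\<gamma> = I.level 0"
    using I.range_geodesic[OF c(1)] c(2) assms(5) by (simp add: q1 q2)
  have ends: "ideal_boundary (I.level 0) = {I.q1, I.q2}" using assms(5) by (simp add: \<gamma> q1 q2)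
  have line: "equidistant_line \<gamma> (the_component \<gamma> c1) (arcosh d) = I.level (sqrt (d\<^sup>2 - 1))" if "d > 1" for d
    using I.equidistant_line_eq[OF that] I.the_component_level[of 0] by (simp add: \<gamma> c1)
  have comp: "closure (the_component (I.level (sqrt (d\<^sup>2 - 1))) c1) \<inter> disk = {z \<in> disk. sqrt (d\<^sup>2 - 1) \<le> I.f z}" if "d > 1" for d
    using I.the_component_level[of "sqrt (d\<^sup>2 - 1)"] I.closure_beyond that by (simp add: c1 one_le_power)
  have pos: "0 < profile_limit d" if "0 < d" "d \<noteq> 1" for d using that by (rule profile_limit_pos)
  show ?thesis
  proof (intro exI[of _ I.surface] conjI allI impI)
    fix d :: real assume d: "0 < d"
    show "complete_surface H2xR_metric (I.surface d)" "properly_embedded_surface H2xR (I.surface d)"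
      "minimal_surface H2xR H2xR_metric (I.surface d)"
      using I.surface_properties[OF d] by simp_all
    show "translation_invariant \<gamma> (I.surface d)"
      unfolding I.surface_def \<gamma> by (rule I.translation_invariant_profile_set[OF ends])
  next
    fix d :: real assume d: "1 < d"
    have bd: "asymptotic_boundary (I.surface d) = (c1 \<times> {- H_height d}) \<union> (c1 \<times> {H_height d})
        \<union> ({q2} \<times> {- H_height d..H_height d}) \<union> ({q1} \<times> {- H_height d..H_height d})"
      using I.asymptotic_boundary_surface(1)[OF d] by (simp add: c1 q1 q2 H_height_eq[OF d])
    have "0 < H_height d" using pos[of d] d by (simp add: H_height_eq)
    then have "Jordan_curve_homologous_to_zero ideal_cylinder (asymptotic_boundary (I.surface d))"
      using rectangle_over_arc_null_homologous[OF assms(1-3), of "H_height d"]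
      unfolding bd assms(6) by (simp add: Un_ac)
    then show "let \<gamma>d = equidistant_line \<gamma> (the_component \<gamma> c1) (arcosh d);
               H = H_height d in
           \<gamma>d \<times> {0} \<subseteq> I.surface d
         \<and> symmetric_wrt_slice (I.surface d)
         \<and> asymptotic_boundary (I.surface d) =
             (c1 \<times> {- H}) \<union> (c1 \<times> {H}) \<union> ({q2} \<times> {- H..H}) \<union> ({q1} \<times> {- H..H})
         \<and> Jordan_curve_homologous_to_zero ideal_cylinder (asymptotic_boundary (I.surface d))
         \<and> vertical_graph_over (closure (the_component \<gamma>d c1) \<inter> disk) (I.surface d \<inter> (disk \<times> {0..H}))"
      using I.surface_greater_1[OF d] bd unfolding Let_def line[OF d] comp[OF d] H_height_eq[OF d] by blast
  next
    show "antimono_on {1<..} H_height" by (rule H_height_antimono)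
    show "filterlim H_height at_top (at_right 1)" by (rule H_height_at_right_1)
    show "(H_height \<longlongrightarrow> pi / 2) at_top" by (rule H_height_at_top)
    show "minimal_surface (half_plane \<times> UNIV) (times_R half_plane_metric) half_plane_graph"
      by (rule half_plane_graph_minimal)
    show "\<exists>F. riemannian_isometry (half_plane \<times> UNIV) (times_R half_plane_metric) H2xR H2xR_metric F
         \<and> F ` half_plane_graph = I.surface 1"
      using I.reflected_chart_isometry I.reflected_chart_half_plane_graph by blast
    show "asymptotic_boundary (I.surface 1) = ({q1} \<times> {..0}) \<union> (c1 \<times> {0}) \<union> ({q2} \<times> {..0})"
      using I.asymptotic_boundary_surface(2) by (simp add: c1 q1 q2)
  next
    fix d :: real assume "0 < d \<and> d < 1"
    then have d: "0 < d" "d < 1" by auto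
    have bd: "asymptotic_boundary (I.surface d) = (c2 \<times> {- G_height d}) \<union> (c1 \<times> {G_height d})
        \<union> ({q1} \<times> {- G_height d..G_height d}) \<union> ({q2} \<times> {- G_height d..G_height d})"
      using I.asymptotic_boundary_surface(3)[OF d] by (simp add: c1 c2 q1 q2 G_height_eq[OF d])
    have "0 < G_height d" using pos[of d] d by (simp add: G_height_eq)
    then have "Jordan_curve_not_homologous_to_zero ideal_cylinder (asymptotic_boundary (I.surface d))"
      using curve_around_cylinder_not_null_homologous[OF assms(1-3), of "G_height d"]
      unfolding bd assms(6,7) by simp
    then show "let G = G_height d in
           vertical_graph_over disk (I.surface d)
         \<and> \<gamma> \<times> {0} \<subseteq> I.surface d
         \<and> asymptotic_boundary (I.surface d) =
             (c2 \<times> {- G}) \<union> (c1 \<times> {G}) \<union> ({q1} \<times> {- G..G}) \<union> ({q2} \<times> {- G..G})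
         \<and> Jordan_curve_not_homologous_to_zero ideal_cylinder (asymptotic_boundary (I.surface d))"
      using I.surface_less_1[OF d] bd unfolding Let_def \<gamma> by blast
  next
    show "mono_on {0<..<1} G_height" by (rule G_height_mono)
    show "(G_height \<longlongrightarrow> 0) (at_right 0)" by (rule G_height_at_right_0)
    show "filterlim G_height at_top (at_left 1)" by (rule G_height_at_left_1)
  qed
qed

end
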